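(* Let $q\in\mathbb{C}\setminus\{0\}$ be not a root of unity. Let $\mathcal{S}$ be the set of all $U_q(\mathfrak{sl}_2)$-module algebra structures on the quantum plane $\mathbb{C}_q[x,y]$ such that $$(\mathsf{e}(x))_0=(\mathsf{e}(y))_0=(\mathsf{f}(x))_0=(\mathsf{f}(y))_0=0,$$ $$(\mathsf{e}(x))_1=0,\quad(\mathsf{e}(y))_1\ne 0,\quad(\mathsf{f}(x))_1\ne 0,\quad(\mathsf{f}(y))_1=0 .$$ Then $\mathcal{S}$ consists of exactly the one-parameter family, indexed by $\tau\in\mathbb{C}\setminus\{0\}$, of structures given by $$\mathsf{k}(x)=qx,\quad \mathsf{k}(y)=q^{-1}y,\quad \mathsf{e}(x)=0,\quad \mathsf{e}(y)=\tau x,\quad \mathsf{f}(x)=\tau^{-1}y,\quad \mathsf{f}(y)=0 .$$ (Each $\tau\ne 0$ gives a well-defined structure.) All these structures are isomorphic, in particular to the one with $\tau=1$.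
   Context: The quantum plane $\mathbb{C}_q[x,y]$ is the unital associative $\mathbb{C}$-algebra with generators $x,y$ and the single relation $yx=qxy$; the monomials $x^my^n$ ($m,n\ge 0$) form a basis. Its $i$-th homogeneous component is the linear span of the $x^my^n$ with $m+n=i$; for a polynomial $p$, $(p)_i$ denotes the projection of $p$ to the $i$-th homogeneous component (parallel to the other components). $U_q(\mathfrak{sl}_2)$ is the unital associative $\mathbb{C}$-algebra with generators $\mathsf{k},\mathsf{k}^{-1},\mathsf{e},\mathsf{f}$ and relations $\mathsf{k}^{-1}\mathsf{k}=\mathsf{k}\mathsf{k}^{-1}=\mathbf{1}$, $\mathsf{k}\mathsf{e}=q^2\mathsf{e}\mathsf{k}$, $\mathsf{k}\mathsf{f}=q^{-2}\mathsf{f}\mathsf{k}$, $\mathsf{e}\mathsf{f}-\mathsf{f}\mathsf{e}=\frac{\mathsf{k}-\mathsf{k}^{-1}}{q-q^{-1}}$, with Hopf algebra structure $\Delta(\mathsf{k})=\mathsf{k}\otimes\mathsf{k}$, $\Delta(\mathsf{e})=\mathbf{1}\otimes\mathsf{e}+\mathsf{e}\otimes\mathsf{k}$, $\Delta(\mathsf{f})=\mathsf{f}\otimes\mathbf{1}+\mathsf{k}^{-1}\otimes\mathsf{f}$, $\varepsilon(\mathsf{k})=1$, $\varepsilon(\mathsf{e})=\varepsilon(\mathsf{f})=0$, $S(\mathsf{k})=\mathsf{k}^{-1}$, $S(\mathsf{e})=-\mathsf{e}\mathsf{k}^{-1}$, $S(\mathsf{f})=-\mathsf{k}\mathsf{f}$.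 For a Hopf algebra $H$ and a unital algebra $A$, a structure of $H$-module algebra on $A$ is an algebra homomorphism $\pi:H\to\operatorname{End}_{\mathbb{C}}A$ such that $\pi(h)(ab)=\sum_i\pi(h_i')(a)\,\pi(h_i'')(b)$ (where $\Delta(h)=\sum_i h_i'\otimes h_i''$) and $\pi(h)(\mathbf{1})=\varepsilon(h)\mathbf{1}$ for all $h\in H$, $a,b\in A$. One writes $h(a)$ for $\pi(h)(a)$. A structure on $\mathbb{C}_q[x,y]$ is uniquely determined by the values of $\mathsf{k},\mathsf{e},\mathsf{f}$ on $x,y$. Structures $\pi_1,\pi_2$ are isomorphic if there is an algebra automorphism $\Psi$ of $A$ with $\Psi\pi_1(h)\Psi^{-1}=\pi_2(h)$ for all $h\in H$. *)

theory Defs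
  imports Complex_Main "HOL-Algebra.QuotRing" "HOL-Algebra.Module" "HOL-Library.Poly_Mapping"
begin

section \<open>Complex algebras\<close>

text \<open>
  A unital associative algebra over the complex numbers is carried by a \<^typ>\<open>(complex, 'a) module\<close>
  record: a ring together with a scalar multiplication.  Types cannot depend on the parameter
  \<open>q\<close>, hence the use of records with explicit carriers.
\<close>

definition complex_alg :: "(complex, complex) module" where
  "complex_alg = \<lparr>carrier = UNIV, mult = (*), one = 1, zero = 0, add = (+), smult = (*)\<rparr>"

definition op_alg :: "(complex, 'a, 'm) module_scheme \<Rightarrow> (complex, 'a) module" where
  "op_alg A = \<lparr>carrier = carrier A, mult = (\<lambda>a b. b \<otimes>\<^bsub>A\<^esub> a), one = \<one>\<^bsub>A\<^esub>,
     zero = \<zero>\<^bsub>A\<^esub>, add = add A, smult = smult A\<rparr>"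

definition alg_hom ::
  "(complex, 'a, 'm) module_scheme \<Rightarrow> (complex, 'b, 'n) module_scheme \<Rightarrow> ('a \<Rightarrow> 'b) set" where
  "alg_hom A B = {h \<in> ring_hom A B. \<forall>c. \<forall>a \<in> carrier A. h (c \<odot>\<^bsub>A\<^esub> a) = c \<odot>\<^bsub>B\<^esub> h a}"

definition alg_aut :: "(complex, 'a, 'm) module_scheme \<Rightarrow> ('a \<Rightarrow> 'a) set" where
  "alg_aut A = {\<Psi> \<in> alg_hom A A. bij_betw \<Psi> (carrier A) (carrier A)}"

definition linear_end :: "(complex, 'a, 'm) module_scheme \<Rightarrow> ('a \<Rightarrow> 'a) set" where
  "linear_end A = {f \<in> carrier A \<rightarrow>\<^sub>E carrier A.
     (\<forall>a \<in> carrier A. \<forall>b \<in> carrier A. f (a \<oplus>\<^bsub>A\<^esub> b) = f a \<oplus>\<^bsub>A\<^esub> f b) \<and>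
     (\<forall>c. \<forall>a \<in> carrier A. f (c \<odot>\<^bsub>A\<^esub> a) = c \<odot>\<^bsub>A\<^esub> f a)}"

definition end_alg :: "(complex, 'a, 'm) module_scheme \<Rightarrow> (complex, 'a \<Rightarrow> 'a) module" where
  "end_alg A = \<lparr>carrier = linear_end A,
     mult = (\<lambda>f g. compose (carrier A) f g),
     one = (\<lambda>a \<in> carrier A. a),
     zero = (\<lambda>a \<in> carrier A. \<zero>\<^bsub>A\<^esub>),
     add = (\<lambda>f g. \<lambda>a \<in> carrier A. f a \<oplus>\<^bsub>A\<^esub> g a),
     smult = (\<lambda>c f. \<lambda>a \<in> carrier A. c \<odot>\<^bsub>A\<^esub> f a)\<rparr>"

definition lin_span :: "(complex, 'a, 'm) module_scheme \<Rightarrow> 'a set \<Rightarrow> 'a set" where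
  "lin_span A B = {\<Oplus>\<^bsub>A\<^esub>b \<in> F. c b \<odot>\<^bsub>A\<^esub> b | F c. finite F \<and> F \<subseteq> B}"


section \<open>Monoid algebras, quotients, presentations, tensor products\<close>

text \<open>The element \<open>\<Sum>\<^sub>m t\<^sub>m m\<close> of the monoid algebra is the finitely supported function \<open>t\<close>.\<close>

definition monoid_alg :: "('m, 'r) monoid_scheme \<Rightarrow> (complex, 'm \<Rightarrow>\<^sub>0 complex) module" where
  "monoid_alg M = \<lparr>carrier = {t. Poly_Mapping.keys t \<subseteq> carrier M},
     mult = (\<lambda>s t. \<Sum>u \<in> Poly_Mapping.keys s. \<Sum>v \<in> Poly_Mapping.keys t.
        Poly_Mapping.single (u \<otimes>\<^bsub>M\<^esub> v) (Poly_Mapping.lookup s u * Poly_Mapping.lookup t v)),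
     one = Poly_Mapping.single \<one>\<^bsub>M\<^esub> 1,
     zero = 0,
     add = (+),
     smult = (\<lambda>c t. Poly_Mapping.map ((*) c) t)\<rparr>"

text \<open>
  The quotient by a two-sided ideal.  For a coset \<open>X\<close> the union below is the single coset of
  \<open>c x\<close> for any \<open>x \<in> X\<close>.
\<close>

definition quot_alg :: "(complex, 'a, 'm) module_scheme \<Rightarrow> 'a set \<Rightarrow> (complex, 'a set) module" where
  "quot_alg A I = ring.extend (A Quot I)
     (module.fields (\<lambda>c X. \<Union>x \<in> X. I +>\<^bsub>A\<^esub> (c \<odot>\<^bsub>A\<^esub> x)))"

definition word_monoid :: "'g list monoid" where
  "word_monoid = \<lparr>carrier = UNIV, mult = (@), one = []\<rparr>"

definition free_alg :: "(complex, 'g list \<Rightarrow>\<^sub>0 complex) module" where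
  "free_alg = monoid_alg word_monoid"

text \<open>The algebra with generators \<open>'g\<close> and relations \<open>r = 0\<close> for \<open>r \<in> R\<close>.\<close>

definition pres_alg ::
  "('g list \<Rightarrow>\<^sub>0 complex) set \<Rightarrow> (complex, ('g list \<Rightarrow>\<^sub>0 complex) set) module" where
  "pres_alg R = quot_alg free_alg (Idl\<^bsub>free_alg\<^esub> R)"

definition pres_gen :: "('g list \<Rightarrow>\<^sub>0 complex) set \<Rightarrow> 'g \<Rightarrow> ('g list \<Rightarrow>\<^sub>0 complex) set" where
  "pres_gen R g = (Idl\<^bsub>free_alg\<^esub> R) +>\<^bsub>free_alg\<^esub> Poly_Mapping.single [g] 1"

text \<open>
  The algebra homomorphism out of a presented algebra with prescribed values on the generators.
  It is unique if it exists, and it exists iff the values satisfy the relations.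
\<close>

definition pres_hom ::
  "('g list \<Rightarrow>\<^sub>0 complex) set \<Rightarrow> (complex, 'b, 'n) module_scheme \<Rightarrow> ('g \<Rightarrow> 'b)
     \<Rightarrow> ('g list \<Rightarrow>\<^sub>0 complex) set \<Rightarrow> 'b" where
  "pres_hom R B v = (THE h. h \<in> alg_hom (pres_alg R) B \<and> h \<in> extensional (carrier (pres_alg R))
     \<and> (\<forall>g. h (pres_gen R g) = v g))"

text \<open>
  The tensor product is the space of formal combinations of pairs modulo bilinearity.  The span of
  the relators below is stable under multiplication by pairs \<open>(a, b)\<close> on either side, so it is the
  two-sided ideal they generate in the monoid algebra of \<open>A \<times>\<times> B\<close>.  An element of
  \<open>tensor_alg A B\<close> is a coset, that is, the set of all \<open>t\<close> with keys in
  \<open>carrier A \<times> carrier B\<close> for which \<open>\<Sum> t (a, b) a \<otimes> b\<close> represents it.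
\<close>

definition tensor_rels ::
  "(complex, 'a, 'm) module_scheme \<Rightarrow> (complex, 'b, 'n) module_scheme
     \<Rightarrow> (('a \<times> 'b) \<Rightarrow>\<^sub>0 complex) set" where
  "tensor_rels A B =
     {Poly_Mapping.single (a \<oplus>\<^bsub>A\<^esub> a', b) 1
        - Poly_Mapping.single (a, b) 1 - Poly_Mapping.single (a', b) 1
        | a a' b. a \<in> carrier A \<and> a' \<in> carrier A \<and> b \<in> carrier B} \<union>
     {Poly_Mapping.single (a, b \<oplus>\<^bsub>B\<^esub> b') 1
        - Poly_Mapping.single (a, b) 1 - Poly_Mapping.single (a, b') 1
        | a b b'. a \<in> carrier A \<and> b \<in> carrier B \<and> b' \<in> carrier B} \<union>
     {Poly_Mapping.single (c \<odot>\<^bsub>A\<^esub> a, b) 1 - Poly_Mapping.single (a, b) c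
        | c a b. a \<in> carrier A \<and> b \<in> carrier B} \<union>
     {Poly_Mapping.single (a, c \<odot>\<^bsub>B\<^esub> b) 1 - Poly_Mapping.single (a, b) c
        | c a b. a \<in> carrier A \<and> b \<in> carrier B}"

definition tensor_alg ::
  "(complex, 'a, 'm) module_scheme \<Rightarrow> (complex, 'b, 'n) module_scheme
     \<Rightarrow> (complex, (('a \<times> 'b) \<Rightarrow>\<^sub>0 complex) set) module" where
  "tensor_alg A B =
     quot_alg (monoid_alg (A \<times>\<times> B)) (Idl\<^bsub>monoid_alg (A \<times>\<times> B)\<^esub> (tensor_rels A B))"

definition pure_tensor ::
  "(complex, 'a, 'm) module_scheme \<Rightarrow> (complex, 'b, 'n) module_scheme
     \<Rightarrow> 'a \<Rightarrow> 'b \<Rightarrow> (('a \<times> 'b) \<Rightarrow>\<^sub>0 complex) set" where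
  "pure_tensor A B a b =
     (Idl\<^bsub>monoid_alg (A \<times>\<times> B)\<^esub> (tensor_rels A B)) +>\<^bsub>monoid_alg (A \<times>\<times> B)\<^esub>
       Poly_Mapping.single (a, b) 1"


section \<open>Module algebras over a Hopf algebra\<close>

record 'a hopf = "(complex, 'a) module" +
  comult :: "'a \<Rightarrow> (('a \<times> 'a) \<Rightarrow>\<^sub>0 complex) set"
  counit :: "'a \<Rightarrow> complex"
  antipode :: "'a \<Rightarrow> 'a"

text \<open>
  Structures are extensional functions, so that equality of structures means equality on the
  carriers.  In the product rule, \<open>t\<close> ranges over all ways of writing \<open>\<Delta>(h)\<close> as a finite sum
  \<open>\<Sum> t (u, v) u \<otimes> v\<close>.
\<close>

definition module_alg_structures ::
  "('h, 'r) hopf_scheme \<Rightarrow> (complex, 'a, 'm) module_scheme \<Rightarrow> ('h \<Rightarrow> 'a \<Rightarrow> 'a) set" where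
  "module_alg_structures H A =
     {\<pi> \<in> alg_hom H (end_alg A). \<pi> \<in> extensional (carrier H) \<and>
       (\<forall>h \<in> carrier H. \<forall>a \<in> carrier A. \<forall>b \<in> carrier A. \<forall>t \<in> comult H h.
          \<pi> h (a \<otimes>\<^bsub>A\<^esub> b) = (\<Oplus>\<^bsub>A\<^esub>w \<in> Poly_Mapping.keys t.
             Poly_Mapping.lookup t w \<odot>\<^bsub>A\<^esub> (\<pi> (fst w) a \<otimes>\<^bsub>A\<^esub> \<pi> (snd w) b))) \<and>
       (\<forall>h \<in> carrier H. \<pi> h \<one>\<^bsub>A\<^esub> = counit H h \<odot>\<^bsub>A\<^esub> \<one>\<^bsub>A\<^esub>)}"

definition iso_structures ::
  "('h, 'r) hopf_scheme \<Rightarrow> (complex, 'a, 'm) module_scheme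
     \<Rightarrow> ('h \<Rightarrow> 'a \<Rightarrow> 'a) \<Rightarrow> ('h \<Rightarrow> 'a \<Rightarrow> 'a) \<Rightarrow> bool" where
  "iso_structures H A \<pi>1 \<pi>2 \<longleftrightarrow> (\<exists>\<Psi> \<in> alg_aut A. \<forall>h \<in> carrier H. \<forall>a \<in> carrier A.
     \<Psi> (\<pi>1 h (inv_into (carrier A) \<Psi> a)) = \<pi>2 h a)"


section \<open>The quantum enveloping algebra of sl(2)\<close>

datatype uq_gen = Gk | Gkinv | Ge | Gf

definition uq_rels :: "complex \<Rightarrow> (uq_gen list \<Rightarrow>\<^sub>0 complex) set" where
  "uq_rels q =
     {Poly_Mapping.single [Gkinv, Gk] 1 - Poly_Mapping.single [] 1,
      Poly_Mapping.single [Gk, Gkinv] 1 - Poly_Mapping.single [] 1,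
      Poly_Mapping.single [Gk, Ge] 1 - Poly_Mapping.single [Ge, Gk] (q ^ 2),
      Poly_Mapping.single [Gk, Gf] 1 - Poly_Mapping.single [Gf, Gk] (inverse (q ^ 2)),
      Poly_Mapping.single [Ge, Gf] 1 - Poly_Mapping.single [Gf, Ge] 1
        - (Poly_Mapping.single [Gk] (1 / (q - inverse q))
           - Poly_Mapping.single [Gkinv] (1 / (q - inverse q)))}"

type_synonym uq_elem = "(uq_gen list \<Rightarrow>\<^sub>0 complex) set"

definition uq_alg :: "complex \<Rightarrow> (complex, uq_elem) module" where
  "uq_alg q = pres_alg (uq_rels q)"

definition uq_k :: "complex \<Rightarrow> uq_elem" where "uq_k q = pres_gen (uq_rels q) Gk"
definition uq_kinv :: "complex \<Rightarrow> uq_elem" where "uq_kinv q = pres_gen (uq_rels q) Gkinv"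
definition uq_e :: "complex \<Rightarrow> uq_elem" where "uq_e q = pres_gen (uq_rels q) Ge"
definition uq_f :: "complex \<Rightarrow> uq_elem" where "uq_f q = pres_gen (uq_rels q) Gf"

text \<open>
  The values of the three structure maps on the inverse of \<open>k\<close> are forced by those on \<open>k\<close>.  The
  antipode is an antihomomorphism, i.e. a homomorphism into the opposite algebra.
\<close>

definition uq_comult :: "complex \<Rightarrow> uq_elem \<Rightarrow> ((uq_elem \<times> uq_elem) \<Rightarrow>\<^sub>0 complex) set" where
  "uq_comult q = (let U = uq_alg q; T = tensor_alg U U; tens = pure_tensor U U in
     pres_hom (uq_rels q) T (\<lambda>g. case g of
         Gk \<Rightarrow> tens (uq_k q) (uq_k q)
       | Gkinv \<Rightarrow> tens (uq_kinv q) (uq_kinv q)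
       | Ge \<Rightarrow> tens \<one>\<^bsub>U\<^esub> (uq_e q) \<oplus>\<^bsub>T\<^esub> tens (uq_e q) (uq_k q)
       | Gf \<Rightarrow> tens (uq_f q) \<one>\<^bsub>U\<^esub> \<oplus>\<^bsub>T\<^esub> tens (uq_kinv q) (uq_f q)))"

definition uq_counit :: "complex \<Rightarrow> uq_elem \<Rightarrow> complex" where
  "uq_counit q = pres_hom (uq_rels q) complex_alg
     (\<lambda>g. case g of Gk \<Rightarrow> 1 | Gkinv \<Rightarrow> 1 | Ge \<Rightarrow> 0 | Gf \<Rightarrow> 0)"

definition uq_antipode :: "complex \<Rightarrow> uq_elem \<Rightarrow> uq_elem" where
  "uq_antipode q = (let U = uq_alg q in pres_hom (uq_rels q) (op_alg U) (\<lambda>g. case g of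
         Gk \<Rightarrow> uq_kinv q
       | Gkinv \<Rightarrow> uq_k q
       | Ge \<Rightarrow> \<ominus>\<^bsub>U\<^esub> (uq_e q \<otimes>\<^bsub>U\<^esub> uq_kinv q)
       | Gf \<Rightarrow> \<ominus>\<^bsub>U\<^esub> (uq_k q \<otimes>\<^bsub>U\<^esub> uq_f q)))"

definition uq_sl2 :: "complex \<Rightarrow> uq_elem hopf" where
  "uq_sl2 q = module.extend (uq_alg q) (hopf.fields (uq_comult q) (uq_counit q) (uq_antipode q))"


section \<open>The quantum plane\<close>

datatype qp_gen = Gx | Gy

definition qp_rels :: "complex \<Rightarrow> (qp_gen list \<Rightarrow>\<^sub>0 complex) set" where
  "qp_rels q = {Poly_Mapping.single [Gy, Gx] 1 - Poly_Mapping.single [Gx, Gy] q}"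

type_synonym qp_elem = "(qp_gen list \<Rightarrow>\<^sub>0 complex) set"

definition quantum_plane :: "complex \<Rightarrow> (complex, qp_elem) module" where
  "quantum_plane q = pres_alg (qp_rels q)"

definition qp_x :: "complex \<Rightarrow> qp_elem" where "qp_x q = pres_gen (qp_rels q) Gx"
definition qp_y :: "complex \<Rightarrow> qp_elem" where "qp_y q = pres_gen (qp_rels q) Gy"

definition qp_mono :: "complex \<Rightarrow> nat \<Rightarrow> nat \<Rightarrow> qp_elem" where
  "qp_mono q m n = (qp_x q [^]\<^bsub>quantum_plane q\<^esub> m) \<otimes>\<^bsub>quantum_plane q\<^esub> (qp_y q [^]\<^bsub>quantum_plane q\<^esub> n)"

text \<open>
  The projection to the \<open>i\<close>-th homogeneous component along all the others.  It is well defined for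
  \<open>q \<noteq> 0\<close> because the monomials form a basis.
\<close>

definition hom_part :: "complex \<Rightarrow> nat \<Rightarrow> qp_elem \<Rightarrow> qp_elem" where
  "hom_part q i p = (THE r. r \<in> lin_span (quantum_plane q) {qp_mono q m n | m n. m + n = i} \<and>
     (\<exists>s \<in> lin_span (quantum_plane q) {qp_mono q m n | m n. m + n \<noteq> i}.
        p = r \<oplus>\<^bsub>quantum_plane q\<^esub> s))"


section \<open>The structures to be classified\<close>

type_synonym qp_action = "uq_elem \<Rightarrow> qp_elem \<Rightarrow> qp_elem"

definition qp_structures :: "complex \<Rightarrow> qp_action set" where
  "qp_structures q = module_alg_structures (uq_sl2 q) (quantum_plane q)"

definition linear_type_structures :: "complex \<Rightarrow> qp_action set" where
  "linear_type_structures q = {\<pi> \<in> qp_structures q.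
     hom_part q 0 (\<pi> (uq_e q) (qp_x q)) = \<zero>\<^bsub>quantum_plane q\<^esub> \<and>
     hom_part q 0 (\<pi> (uq_e q) (qp_y q)) = \<zero>\<^bsub>quantum_plane q\<^esub> \<and>
     hom_part q 0 (\<pi> (uq_f q) (qp_x q)) = \<zero>\<^bsub>quantum_plane q\<^esub> \<and>
     hom_part q 0 (\<pi> (uq_f q) (qp_y q)) = \<zero>\<^bsub>quantum_plane q\<^esub> \<and>
     hom_part q 1 (\<pi> (uq_e q) (qp_x q)) = \<zero>\<^bsub>quantum_plane q\<^esub> \<and>
     hom_part q 1 (\<pi> (uq_e q) (qp_y q)) \<noteq> \<zero>\<^bsub>quantum_plane q\<^esub> \<and>
     hom_part q 1 (\<pi> (uq_f q) (qp_x q)) \<noteq> \<zero>\<^bsub>quantum_plane q\<^esub> \<and>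
     hom_part q 1 (\<pi> (uq_f q) (qp_y q)) = \<zero>\<^bsub>quantum_plane q\<^esub>}"

definition has_parameter :: "complex \<Rightarrow> complex \<Rightarrow> qp_action \<Rightarrow> bool" where
  "has_parameter q \<tau> \<pi> \<longleftrightarrow>
     \<pi> (uq_k q) (qp_x q) = q \<odot>\<^bsub>quantum_plane q\<^esub> qp_x q \<and>
     \<pi> (uq_k q) (qp_y q) = inverse q \<odot>\<^bsub>quantum_plane q\<^esub> qp_y q \<and>
     \<pi> (uq_e q) (qp_x q) = \<zero>\<^bsub>quantum_plane q\<^esub> \<and>
     \<pi> (uq_e q) (qp_y q) = \<tau> \<odot>\<^bsub>quantum_plane q\<^esub> qp_x q \<and>
     \<pi> (uq_f q) (qp_x q) = inverse \<tau> \<odot>\<^bsub>quantum_plane q\<^esub> qp_y q \<and>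
     \<pi> (uq_f q) (qp_y q) = \<zero>\<^bsub>quantum_plane q\<^esub>"

end

theory Submission
  imports Defs "HOL-Library.Product_Plus"
begin

text \<open>
  The plane embeds into the quantum torus, spanned by the monomials \<open>x\<^sup>iy\<^sup>j\<close> with integer exponents.
  There the operators in question become inner: the operator \<open>e\<close> satisfies
  \<open>e(ab) = a e(b) + e(a) k(b)\<close>, and together with its weight under \<open>k\<close> this forces
  \<open>e(p) = z k(p) - p z\<close> for a Laurent polynomial \<open>z\<close>; likewise \<open>f(p) = w p - k\<^sup>-\<^sup>1(p) w\<close>
  (\<open>E_inner\<close>, \<open>F_inner\<close>).  Expanding both products (\<open>inner_commutator\<close>) then gives
  \<open>(ef - fe)(p) = c k(p) - k\<^sup>-\<^sup>1(p) c\<close> with \<open>c = q\<^sup>-\<^sup>2zw - wz\<close>, and given the supports of \<open>z\<close> and \<open>w\<close>,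
  the last defining relation of the quantum group forces \<open>c\<close> to be the scalar \<open>1 / (q - q\<^sup>-\<^sup>1)\<close>.

  Order exponents by an injective additive weight.  The leading exponents of \<open>z\<close> and \<open>w\<close> add up
  in \<open>c\<close>, and the corresponding coefficient is a nonzero multiple of the product of the leading
  coefficients because \<open>q\<close> is not a root of unity.  Since \<open>c\<close> is constant, \<open>z\<close> and \<open>w\<close> have to be the
  monomials \<open>\<lambda>xy\<^sup>-\<^sup>1\<close> and \<open>\<mu>x\<^sup>-\<^sup>1y\<close>, with \<open>\<lambda>\<mu>\<close> determined by \<open>q\<close>: this is the one-parameter family
  (\<open>linear_classification\<close>).  Conversely, the same formulas with such \<open>z\<close> and \<open>w\<close> define operators on
  the torus which satisfy all relations and leave the plane invariant (\<open>sl2_action_model\<close>).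

  Before this argument applies, \<open>k\<close> has to be known.  It acts as an automorphism of the plane, and
  the leading exponents of \<open>k(x)\<close> and \<open>k(y)\<close> form a matrix of determinant one and generate the
  monoid \<open>\<nat> \<times> \<nat>\<close>; hence \<open>k\<close> rescales \<open>x\<close> and \<open>y\<close> (\<open>K_diagonal\<close>).  Comparing coefficients in
  \<open>e(yx) = q e(xy)\<close> then fixes the two scalars.

  Two dictionaries connect this computation with the definitions.  A module algebra structure is
  the same as four operators that satisfy the defining relations and the product rules on
  generators (\<open>module_alg_structuresD\<close>, \<open>sl2_action.structure_exists\<close>); this rests on the universal
  property of presented algebras, the existence of the coproduct, and the fact that the product
  rule does not depend on how an element of the tensor square is written as a sum.
  The coordinates of an element of the plane with respect to monomials (\<open>coord\<close>) are obtained from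
  a twisted monoid algebra.  Finally, isomorphisms between the structures rescale \<open>y\<close>
  (\<open>intertwining\<close>).
\<close>

section \<open>Complex algebras and linear extension\<close>

abbreviation "lookup \<equiv> Poly_Mapping.lookup"
abbreviation "keys \<equiv> Poly_Mapping.keys"
abbreviation "single \<equiv> Poly_Mapping.single"

abbreviation scale :: "'b::mult_zero \<Rightarrow> ('a \<Rightarrow>\<^sub>0 'b) \<Rightarrow> 'a \<Rightarrow>\<^sub>0 'b" where
  "scale c t \<equiv> Poly_Mapping.map ((*) c) t"

lemma lookup_scale [simp]:
  "lookup (scale c t) k = c * lookup t k"
  for c :: "'b::mult_zero"
  by (simp add: Poly_Mapping.map.rep_eq when_def)

lemma keys_scale: "keys (scale c t) \<subseteq> keys t"
  for c :: "'b::mult_zero"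
  by (auto simp: in_keys_iff)

lemma scale_zero [simp]: "scale c 0 = 0" for c :: "'b::mult_zero"
  by (rule poly_mapping_eqI) simp

lemma scale_add: "scale c (s + t) = scale c s + scale c t"
  for c :: "'b::semiring_0"
  by (rule poly_mapping_eqI) (simp add: lookup_add algebra_simps)

lemma diff_eq_scale: "s - t = s + scale (-1) t"
  for s :: "'a \<Rightarrow>\<^sub>0 'b::ring_1"
  by (rule poly_mapping_eqI) (simp add: lookup_add lookup_minus)

lemma scale_diff: "scale c (p - r) = scale c p - scale c r"
  for c :: "'b::ring_1"
  by (rule poly_mapping_eqI) (simp add: lookup_minus algebra_simps)

lemma scale_scale: "scale c (scale d p) = scale (c * d) p"
  for c :: "'b::semiring_0"
  by (rule poly_mapping_eqI) (simp add: mult.assoc)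

lemma scale_one [simp]: "scale 1 p = p"
  for p :: "'a \<Rightarrow>\<^sub>0 'b::semiring_1"
  by (rule poly_mapping_eqI) simp

lemma single_eq_zero_iff [simp]: "single u c = 0 \<longleftrightarrow> c = 0"
  by (metis inj_single injD single_zero)

lemma sum_singles_superset:
  "finite S \<Longrightarrow> keys p \<subseteq> S \<Longrightarrow> p = (\<Sum>u\<in>S. single u (lookup p u))"
  by (rule poly_mapping_eqI) (auto simp: lookup_sum lookup_single when_def in_keys_iff sum.delta)

lemma scale_by_zero [simp]: "scale 0 p = 0"
  for p :: "'a \<Rightarrow>\<^sub>0 'b::mult_zero"
  by (rule poly_mapping_eqI) simp

lemma pm_eq_sum_singles:
  "t = (\<Sum>u\<in>keys t. single u (lookup t u))"
  by (rule sum_singles_superset) simp_all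

text \<open>
  Linear statements about elements of a monoid algebra reduce to monomials with this rule; the set
  \<open>S\<close> keeps track of the carrier.
\<close>

lemma pm_support_induct [consumes 1, case_names zero single add]:
  fixes t :: "'a \<Rightarrow>\<^sub>0 'b::comm_monoid_add"
  assumes "keys t \<subseteq> S" and zero: "P 0"
    and single: "\<And>u c. u \<in> S \<Longrightarrow> P (single u c)"
    and add: "\<And>s t. keys s \<subseteq> S \<Longrightarrow> keys t \<subseteq> S \<Longrightarrow> P s \<Longrightarrow> P t \<Longrightarrow> P (s + t)"
  shows "P t"
proof -
  have "P (\<Sum>u\<in>F. single u (lookup t u)) \<and>
      keys (\<Sum>u\<in>F. single u (lookup t u)) \<subseteq> S"
    if "finite F" "F \<subseteq> keys t" for F
    using that
  proof (induction F)
    case (insert u F)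
    let ?s = "single u (lookup t u)"
    let ?r = "\<Sum>u\<in>F. single u (lookup t u)"
    have u: "u \<in> S" using insert.prems assms(1) by auto
    then have s: "keys ?s \<subseteq> S" by simp
    have r: "P ?r" "keys ?r \<subseteq> S" using insert by auto
    have "P (?s + ?r)" using add[OF s r(2) single[OF u] r(1)] .
    moreover have "keys (?s + ?r) \<subseteq> S"
      using s r(2) keys_add[of ?s ?r] by blast
    ultimately show ?case using insert by simp
  qed (simp add: zero)
  from this[OF finite_keys order_refl] show ?thesis
    by (subst pm_eq_sum_singles) simp
qed

lemmas pm_induct [case_names zero single add] = pm_support_induct[where S = UNIV, simplified]

locale calg = ring A for A :: "(complex, 'a, 'm) module_scheme" (structure) +
  assumes smult_closed [simp, intro]: "a \<in> carrier A \<Longrightarrow> c \<odot> a \<in> carrier A"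
    and smult_l_distr: "a \<in> carrier A \<Longrightarrow> (c + d) \<odot> a = c \<odot> a \<oplus> d \<odot> a"
    and smult_r_distr: "a \<in> carrier A \<Longrightarrow> b \<in> carrier A \<Longrightarrow> c \<odot> (a \<oplus> b) = c \<odot> a \<oplus> c \<odot> b"
    and smult_assoc: "a \<in> carrier A \<Longrightarrow> (c * d) \<odot> a = c \<odot> (d \<odot> a)"
    and smult_one [simp]: "a \<in> carrier A \<Longrightarrow> 1 \<odot> a = a"
    and smult_mult_l: "a \<in> carrier A \<Longrightarrow> b \<in> carrier A \<Longrightarrow> (c \<odot> a) \<otimes> b = c \<odot> (a \<otimes> b)"
    and smult_mult_r: "a \<in> carrier A \<Longrightarrow> b \<in> carrier A \<Longrightarrow> a \<otimes> (c \<odot> b) = c \<odot> (a \<otimes> b)"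

lemma calgI:
  fixes A :: "(complex, 'a, 'm) module_scheme" (structure)
  assumes "\<And>a b. a \<in> carrier A \<Longrightarrow> b \<in> carrier A \<Longrightarrow> a \<oplus> b \<in> carrier A"
    and "\<zero> \<in> carrier A"
    and "\<And>a b c. a \<in> carrier A \<Longrightarrow> b \<in> carrier A \<Longrightarrow> c \<in> carrier A \<Longrightarrow> (a \<oplus> b) \<oplus> c = a \<oplus> (b \<oplus> c)"
    and "\<And>a b. a \<in> carrier A \<Longrightarrow> b \<in> carrier A \<Longrightarrow> a \<oplus> b = b \<oplus> a"
    and "\<And>a. a \<in> carrier A \<Longrightarrow> \<zero> \<oplus> a = a"
    and "\<And>a b. a \<in> carrier A \<Longrightarrow> b \<in> carrier A \<Longrightarrow> a \<otimes> b \<in> carrier A"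
    and "\<one> \<in> carrier A"
    and "\<And>a b c. a \<in> carrier A \<Longrightarrow> b \<in> carrier A \<Longrightarrow> c \<in> carrier A \<Longrightarrow> (a \<otimes> b) \<otimes> c = a \<otimes> (b \<otimes> c)"
    and "\<And>a. a \<in> carrier A \<Longrightarrow> \<one> \<otimes> a = a"
    and "\<And>a. a \<in> carrier A \<Longrightarrow> a \<otimes> \<one> = a"
    and "\<And>a b c. a \<in> carrier A \<Longrightarrow> b \<in> carrier A \<Longrightarrow> c \<in> carrier A \<Longrightarrow> (a \<oplus> b) \<otimes> c = a \<otimes> c \<oplus> b \<otimes> c"
    and "\<And>a b c. a \<in> carrier A \<Longrightarrow> b \<in> carrier A \<Longrightarrow> c \<in> carrier A \<Longrightarrow> c \<otimes> (a \<oplus> b) = c \<otimes> a \<oplus> c \<otimes> b"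
    and smult_closed: "\<And>a c. a \<in> carrier A \<Longrightarrow> c \<odot> a \<in> carrier A"
    and smult_l_distr: "\<And>a c d. a \<in> carrier A \<Longrightarrow> (c + d) \<odot> a = c \<odot> a \<oplus> d \<odot> a"
    and "\<And>a b c. a \<in> carrier A \<Longrightarrow> b \<in> carrier A \<Longrightarrow> c \<odot> (a \<oplus> b) = c \<odot> a \<oplus> c \<odot> b"
    and "\<And>a c d. a \<in> carrier A \<Longrightarrow> (c * d) \<odot> a = c \<odot> (d \<odot> a)"
    and smult_one: "\<And>a. a \<in> carrier A \<Longrightarrow> 1 \<odot> a = a"
    and smult_zero: "\<And>a. a \<in> carrier A \<Longrightarrow> 0 \<odot> a = \<zero>"
    and "\<And>a b c. a \<in> carrier A \<Longrightarrow> b \<in> carrier A \<Longrightarrow> (c \<odot> a) \<otimes> b = c \<odot> (a \<otimes> b)"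
    and "\<And>a b c. a \<in> carrier A \<Longrightarrow> b \<in> carrier A \<Longrightarrow> a \<otimes> (c \<odot> b) = c \<odot> (a \<otimes> b)"
  shows "calg A"
proof (intro calg.intro calg_axioms.intro ringI abelian_groupI monoidI)
  show "\<exists>b\<in>carrier A. b \<oplus> a = \<zero>" if "a \<in> carrier A" for a
  proof
    have "(-1) \<odot> a \<oplus> 1 \<odot> a = \<zero>"
      using smult_l_distr[OF that, of "-1" 1] smult_zero[OF that] by simp
    then show "(-1) \<odot> a \<oplus> a = \<zero>" by (simp add: smult_one[OF that])
    show "(-1) \<odot> a \<in> carrier A" by (rule smult_closed[OF that])
  qed
qed (fact assms)+

context calg
begin

lemma smult_zero_l [simp]: "a \<in> carrier A \<Longrightarrow> 0 \<odot> a = \<zero>"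
  using smult_l_distr[of a 0 0] by (simp add: add.l_cancel_one')

lemma smult_zero_r [simp]: "c \<odot> \<zero> = \<zero>"
  using smult_assoc[of \<zero> c 0] by simp

lemma minus_eq_smult: "a \<in> carrier A \<Longrightarrow> \<ominus> a = (-1) \<odot> a"
  using smult_l_distr[of a 1 "-1"] by (simp add: minus_equality add.m_comm)

end

text \<open>
  The linear map that sends the basis vector \<open>u\<close> to \<open>\<phi> u\<close>.  Evaluation of words, the product rule
  of a module algebra, and the expansion in monomials are all of this form.
\<close>

definition lin_ext :: "(complex, 'a, 'm) module_scheme \<Rightarrow> ('u \<Rightarrow> 'a) \<Rightarrow> ('u \<Rightarrow>\<^sub>0 complex) \<Rightarrow> 'a" where
  "lin_ext A \<phi> t = (\<Oplus>\<^bsub>A\<^esub>u \<in> keys t. lookup t u \<odot>\<^bsub>A\<^esub> \<phi> u)"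

context calg
begin

lemma lin_ext_closed [intro, simp]:
  "\<phi> \<in> keys t \<rightarrow> carrier A \<Longrightarrow> lin_ext A \<phi> t \<in> carrier A"
  unfolding lin_ext_def by (rule finsum_closed) auto

lemma lin_ext_superset:
  assumes "finite S" "keys t \<subseteq> S" "\<phi> \<in> S \<rightarrow> carrier A"
  shows "lin_ext A \<phi> t = (\<Oplus>u\<in>S. lookup t u \<odot> \<phi> u)"
  unfolding lin_ext_def using assms
  by (intro add.finprod_mono_neutral_cong_left) (auto simp: in_keys_iff Pi_iff)

lemma lin_ext_zero [simp]: "lin_ext A \<phi> 0 = \<zero>"
  by (simp add: lin_ext_def)

lemma lin_ext_single [simp]:
  "\<phi> u \<in> carrier A \<Longrightarrow> lin_ext A \<phi> (single u c) = c \<odot> \<phi> u"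
  by (subst lin_ext_superset[of "{u}"]) (auto)

lemma lin_ext_add:
  assumes "\<phi> \<in> S \<rightarrow> carrier A" "keys s \<subseteq> S" "keys t \<subseteq> S"
  shows "lin_ext A \<phi> (s + t) = lin_ext A \<phi> s \<oplus> lin_ext A \<phi> t"
proof -
  let ?K = "keys s \<union> keys t"
  have \<phi>: "\<phi> \<in> ?K \<rightarrow> carrier A" using assms by (auto simp: Pi_iff)
  have "lin_ext A \<phi> (s + t) =
      (\<Oplus>u\<in>?K. lookup s u \<odot> \<phi> u \<oplus> lookup t u \<odot> \<phi> u)"
    using \<phi> keys_add[of s t]
    by (subst lin_ext_superset[of ?K])
       (auto simp: lookup_add smult_l_distr Pi_iff simp del: finsum_addf intro!: finsum_cong')
  also have "\<dots> = (\<Oplus>u\<in>?K. lookup s u \<odot> \<phi> u) \<oplus> (\<Oplus>u\<in>?K. lookup t u \<odot> \<phi> u)"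
    using \<phi> by (intro finsum_addf) (auto simp: Pi_iff)
  also have "\<dots> = lin_ext A \<phi> s \<oplus> lin_ext A \<phi> t"
    using \<phi> by (simp add: lin_ext_superset[of ?K])
  finally show ?thesis .
qed

lemma lin_ext_scale:
  assumes "\<phi> \<in> keys t \<rightarrow> carrier A"
  shows "lin_ext A \<phi> (scale c t) = c \<odot> lin_ext A \<phi> t"
  using order_refl[of "keys t"] 
proof (induction t rule: pm_support_induct)
  case (add s t)
  have "\<phi> \<in> keys s \<rightarrow> carrier A" "\<phi> \<in> keys t \<rightarrow> carrier A"
    using add assms by (auto simp: Pi_iff)
  then show ?case using add assms
    by (simp add: scale_add lin_ext_add[OF assms] smult_r_distr keys_scale[THEN subset_trans])
qed (use assms in \<open>auto simp: smult_assoc Pi_iff\<close>)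

lemma lin_ext_diff:
  assumes "\<phi> \<in> S \<rightarrow> carrier A" "keys s \<subseteq> S" "keys t \<subseteq> S"
  shows "lin_ext A \<phi> (s - t) = lin_ext A \<phi> s \<oplus> (-1) \<odot> lin_ext A \<phi> t"
proof -
  have "lin_ext A \<phi> (s + scale (-1) t)
      = lin_ext A \<phi> s \<oplus> lin_ext A \<phi> (scale (-1) t)"
    by (rule lin_ext_add[OF assms(1,2)]) (use assms(3) keys_scale[of "-1" t] in blast)
  moreover have "\<phi> \<in> keys t \<rightarrow> carrier A" using assms by (auto simp: Pi_iff)
  ultimately show ?thesis by (simp only: diff_eq_scale lin_ext_scale)
qed

lemma lin_ext_cong:
  assumes "\<And>u. u \<in> keys t \<Longrightarrow> \<phi> u = \<psi> u" "\<psi> \<in> keys t \<rightarrow> carrier A"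
  shows "lin_ext A \<phi> t = lin_ext A \<psi> t"
  unfolding lin_ext_def using assms by (intro finsum_cong') (auto simp: Pi_iff)

lemma lin_ext_const_zero:
  assumes "\<And>u. u \<in> keys t \<Longrightarrow> \<phi> u = \<zero>"
  shows "lin_ext A \<phi> t = \<zero>"
proof -
  have "lin_ext A \<phi> t = lin_ext A (\<lambda>_. \<zero>) t"
    by (rule lin_ext_cong) (use assms in auto)
  also have "\<dots> = \<zero>" by (simp add: lin_ext_def)
  finally show ?thesis .
qed

lemma lin_ext_const_smult:
  assumes "\<phi> \<in> keys t \<rightarrow> carrier A"
  shows "lin_ext A (\<lambda>u. c \<odot> \<phi> u) t = c \<odot> lin_ext A \<phi> t"
  using order_refl[of "keys t"] 
proof (induction t rule: pm_support_induct)
  case (add s t)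
  have "\<phi> \<in> keys s \<rightarrow> carrier A" "\<phi> \<in> keys t \<rightarrow> carrier A"
    "(\<lambda>u. c \<odot> \<phi> u) \<in> keys s \<union> keys t \<rightarrow> carrier A"
    using add assms by (auto simp: Pi_iff)
  then show ?case using add assms lin_ext_add[of "\<lambda>u. c \<odot> \<phi> u" "keys s \<union> keys t" s t]
    by (simp add: lin_ext_add[OF assms] smult_r_distr)
qed (use assms in \<open>auto simp: smult_assoc[symmetric] Pi_iff mult.commute\<close>)

lemma lin_ext_addf:
  assumes "\<phi> \<in> keys t \<rightarrow> carrier A" "\<psi> \<in> keys t \<rightarrow> carrier A"
  shows "lin_ext A (\<lambda>u. \<phi> u \<oplus> \<psi> u) t = lin_ext A \<phi> t \<oplus> lin_ext A \<psi> t"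
proof -
  have "lin_ext A (\<lambda>u. \<phi> u \<oplus> \<psi> u) t = (\<Oplus>u\<in>keys t.
      lookup t u \<odot> \<phi> u \<oplus> lookup t u \<odot> \<psi> u)"
    unfolding lin_ext_def using assms by (intro finsum_cong') (auto simp: smult_r_distr Pi_iff)
  also have "\<dots> = lin_ext A \<phi> t \<oplus> lin_ext A \<psi> t"
    unfolding lin_ext_def using assms by (intro finsum_addf) (auto simp: Pi_iff)
  finally show ?thesis .
qed

lemma lin_ext_swap:
  assumes "keys s \<subseteq> S" "keys t \<subseteq> T"
    and \<psi>: "\<And>u v. u \<in> S \<Longrightarrow> v \<in> T \<Longrightarrow> \<psi> u v \<in> carrier A"
  shows "lin_ext A (\<lambda>u. lin_ext A (\<psi> u) t) s = lin_ext A (\<lambda>v. lin_ext A (\<lambda>u. \<psi> u v) s) t"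
  using assms(1)
proof (induction s rule: pm_support_induct)
  case zero
  show ?case by (simp add: lin_ext_const_zero)
next
  case (single u c)
  have "lin_ext A (\<lambda>v. lin_ext A (\<lambda>u. \<psi> u v) (single u c)) t = lin_ext A (\<lambda>v. c \<odot> \<psi> u v) t"
    using assms(2) single by (intro lin_ext_cong) (auto simp: \<psi>)
  also have "\<dots> = c \<odot> lin_ext A (\<psi> u) t"
    by (rule lin_ext_const_smult) (use assms(2) single \<psi> in auto)
  also have "\<dots> = lin_ext A (\<lambda>u. lin_ext A (\<psi> u) t) (single u c)"
    by (rule lin_ext_single[symmetric]) (use assms(2) single \<psi> in auto)
  finally show ?case by (rule sym)
next
  case (add s s')
  have *: "lin_ext A (\<lambda>u. \<psi> u v) (s + s') = lin_ext A (\<lambda>u. \<psi> u v) s \<oplus> lin_ext A (\<lambda>u. \<psi> u v) s'"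
    if "v \<in> T" for v
    by (rule lin_ext_add[of _ S]) (use \<psi> that add in auto)
  have "lin_ext A (\<lambda>v. lin_ext A (\<lambda>u. \<psi> u v) (s + s')) t =
      lin_ext A (\<lambda>v. lin_ext A (\<lambda>u. \<psi> u v) s \<oplus> lin_ext A (\<lambda>u. \<psi> u v) s') t"
    using assms(2) add \<psi>
    by (intro lin_ext_cong) (auto simp: * Pi_iff subset_iff)
  also have "\<dots> = lin_ext A (\<lambda>v. lin_ext A (\<lambda>u. \<psi> u v) s) t \<oplus> lin_ext A (\<lambda>v. lin_ext A (\<lambda>u. \<psi> u v) s') t"
    using assms(2) add \<psi> by (intro lin_ext_addf) (auto simp: Pi_iff subset_iff)
  also have "\<dots> = lin_ext A (\<lambda>u. lin_ext A (\<psi> u) t) s \<oplus> lin_ext A (\<lambda>u. lin_ext A (\<psi> u) t) s'"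
    using add by simp
  also have "\<dots> = lin_ext A (\<lambda>u. lin_ext A (\<psi> u) t) (s + s')"
    by (rule lin_ext_add[symmetric, of _ S]) (use assms(2) add \<psi> in \<open>auto simp: Pi_iff subset_iff\<close>)
  finally show ?case by (rule sym)
qed

end

definition lin_map :: "(complex, 'a, 'm) module_scheme \<Rightarrow> (complex, 'b, 'n) module_scheme \<Rightarrow> ('a \<Rightarrow> 'b) \<Rightarrow> bool" where
  "lin_map A B f \<longleftrightarrow> f \<in> carrier A \<rightarrow> carrier B \<and>
     (\<forall>a\<in>carrier A. \<forall>b\<in>carrier A. f (a \<oplus>\<^bsub>A\<^esub> b) = f a \<oplus>\<^bsub>B\<^esub> f b) \<and>
     (\<forall>c. \<forall>a\<in>carrier A. f (c \<odot>\<^bsub>A\<^esub> a) = c \<odot>\<^bsub>B\<^esub> f a)"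

lemma lin_mapI:
  assumes "\<And>a. a \<in> carrier A \<Longrightarrow> f a \<in> carrier B"
    and "\<And>a b. a \<in> carrier A \<Longrightarrow> b \<in> carrier A \<Longrightarrow> f (a \<oplus>\<^bsub>A\<^esub> b) = f a \<oplus>\<^bsub>B\<^esub> f b"
    and "\<And>c a. a \<in> carrier A \<Longrightarrow> f (c \<odot>\<^bsub>A\<^esub> a) = c \<odot>\<^bsub>B\<^esub> f a"
  shows "lin_map A B f"
  unfolding lin_map_def using assms by blast

lemma lin_map_closed: "lin_map A B f \<Longrightarrow> a \<in> carrier A \<Longrightarrow> f a \<in> carrier B"
  unfolding lin_map_def Pi_iff by blast

lemma lin_map_add:
  "lin_map A B f \<Longrightarrow> a \<in> carrier A \<Longrightarrow> b \<in> carrier A \<Longrightarrow> f (a \<oplus>\<^bsub>A\<^esub> b) = f a \<oplus>\<^bsub>B\<^esub> f b"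
  unfolding lin_map_def by blast

lemma lin_map_smult: "lin_map A B f \<Longrightarrow> a \<in> carrier A \<Longrightarrow> f (c \<odot>\<^bsub>A\<^esub> a) = c \<odot>\<^bsub>B\<^esub> f a"
  unfolding lin_map_def by blast

lemmas lin_mapD = lin_map_closed lin_map_add lin_map_smult

lemma lin_map_zero:
  assumes "calg A" "calg B" "lin_map A B f"
  shows "f \<zero>\<^bsub>A\<^esub> = \<zero>\<^bsub>B\<^esub>"
proof -
  interpret A: calg A by fact
  interpret B: calg B by fact
  have "f (0 \<odot>\<^bsub>A\<^esub> \<zero>\<^bsub>A\<^esub>) = 0 \<odot>\<^bsub>B\<^esub> f \<zero>\<^bsub>A\<^esub>" by (rule lin_map_smult[OF assms(3)]) simp
  then show ?thesis using lin_mapD(1)[OF assms(3)] by simp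
qed

lemma lin_map_lin_ext:
  assumes "calg A" "calg B" "lin_map A B f" "\<phi> \<in> keys t \<rightarrow> carrier A"
  shows "f (lin_ext A \<phi> t) = lin_ext B (\<lambda>u. f (\<phi> u)) t"
proof -
  interpret A: calg A by fact
  interpret B: calg B by fact
  note f = lin_mapD[OF assms(3)]
  show ?thesis
    using order_refl[of "keys t"]
  proof (induction t rule: pm_support_induct)
    case (add s t)
    let ?K = "keys s \<union> keys t"
    have B: "(\<lambda>u. f (\<phi> u)) \<in> ?K \<rightarrow> carrier B" and A: "\<phi> \<in> ?K \<rightarrow> carrier A"
      using add assms(4) f by (auto simp: Pi_iff)
    have "f (lin_ext A \<phi> (s + t)) = f (lin_ext A \<phi> s \<oplus>\<^bsub>A\<^esub> lin_ext A \<phi> t)"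
      using A.lin_ext_add[OF A, of s t] by simp
    also have "\<dots> = f (lin_ext A \<phi> s) \<oplus>\<^bsub>B\<^esub> f (lin_ext A \<phi> t)"
      using A by (intro f(2) A.lin_ext_closed) (auto simp: Pi_iff)
    also have "\<dots> = lin_ext B (\<lambda>u. f (\<phi> u)) (s + t)"
      using B.lin_ext_add[OF B, of s t] add by simp
    finally show ?case .
  qed (use f assms(4) in \<open>auto simp: lin_map_zero[OF assms(1-3)] Pi_iff\<close>)
qed

definition alg_map :: "(complex, 'a, 'm) module_scheme \<Rightarrow> (complex, 'b, 'n) module_scheme \<Rightarrow> ('a \<Rightarrow> 'b) \<Rightarrow> bool" where
  "alg_map A B f \<longleftrightarrow> lin_map A B f \<and> f \<one>\<^bsub>A\<^esub> = \<one>\<^bsub>B\<^esub> \<and>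
     (\<forall>a\<in>carrier A. \<forall>b\<in>carrier A. f (a \<otimes>\<^bsub>A\<^esub> b) = f a \<otimes>\<^bsub>B\<^esub> f b)"

lemma alg_hom_iff: "h \<in> alg_hom A B \<longleftrightarrow> alg_map A B h"
  unfolding alg_hom_def alg_map_def lin_map_def ring_hom_def by auto

text \<open>
  The algebra axioms are equations, so they pass to surjective images; this is how quotients
  become algebras.
\<close>

lemma calg_hom_image:
  assumes "calg A" "alg_map A B f" "f ` carrier A = carrier B" "f \<zero>\<^bsub>A\<^esub> = \<zero>\<^bsub>B\<^esub>"
  shows "calg B"
proof -
  interpret A: calg A by fact
  have f: "\<And>a. a \<in> carrier A \<Longrightarrow> f a \<in> carrier B"
    and add: "\<And>a b. a \<in> carrier A \<Longrightarrow> b \<in> carrier A \<Longrightarrow> f a \<oplus>\<^bsub>B\<^esub> f b = f (a \<oplus>\<^bsub>A\<^esub> b)"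
    and mul: "\<And>a b. a \<in> carrier A \<Longrightarrow> b \<in> carrier A \<Longrightarrow> f a \<otimes>\<^bsub>B\<^esub> f b = f (a \<otimes>\<^bsub>A\<^esub> b)"
    and sc: "\<And>a c. a \<in> carrier A \<Longrightarrow> c \<odot>\<^bsub>B\<^esub> f a = f (c \<odot>\<^bsub>A\<^esub> a)"
    and one: "\<one>\<^bsub>B\<^esub> = f \<one>\<^bsub>A\<^esub>"
    using assms(2) by (auto simp: alg_map_def lin_map_def)
  have imE: "Q" if "b \<in> carrier B" "\<And>a. a \<in> carrier A \<Longrightarrow> b = f a \<Longrightarrow> Q" for b Q
    using that assms(3) by blast
  show ?thesis
    by (rule calgI; (elim imE)?; hypsubst?;
        simp add: add mul sc one f assms(4)[symmetric] A.a_ac A.m_assoc A.l_distr A.r_distr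
          A.smult_l_distr A.smult_r_distr A.smult_assoc A.smult_mult_l A.smult_mult_r)
qed

section \<open>Twisted monoid algebras, quotients and endomorphism algebras\<close>

text \<open>
  Inserting a scalar \<open>\<sigma> u v\<close> into the product of monomials covers two cases at once: the constant
  \<open>\<sigma> = 1\<close> is the ordinary monoid algebra, and the plane is the algebra of \<open>\<nat> \<times> \<nat>\<close> twisted
  by powers of \<open>q\<close>.
\<close>

definition tw_mult :: "('u, 'r) monoid_scheme \<Rightarrow> ('u \<Rightarrow> 'u \<Rightarrow> complex) \<Rightarrow>
    ('u \<Rightarrow>\<^sub>0 complex) \<Rightarrow> ('u \<Rightarrow>\<^sub>0 complex) \<Rightarrow> ('u \<Rightarrow>\<^sub>0 complex)" where
  "tw_mult M \<sigma> s t = (\<Sum>u\<in>keys s. \<Sum>v\<in>keys t.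
     single (u \<otimes>\<^bsub>M\<^esub> v) (\<sigma> u v * (lookup s u * lookup t v)))"

definition tw_alg :: "('u, 'r) monoid_scheme \<Rightarrow> ('u \<Rightarrow> 'u \<Rightarrow> complex) \<Rightarrow> (complex, 'u \<Rightarrow>\<^sub>0 complex) module" where
  "tw_alg M \<sigma> = \<lparr>carrier = {t. keys t \<subseteq> carrier M}, mult = tw_mult M \<sigma>,
     one = single \<one>\<^bsub>M\<^esub> 1, zero = 0, add = (+), smult = (\<lambda>c t. scale c t)\<rparr>"

lemma tw_alg_simps [simp]:
  "carrier (tw_alg M \<sigma>) = {t. keys t \<subseteq> carrier M}"
  "mult (tw_alg M \<sigma>) = tw_mult M \<sigma>"
  "one (tw_alg M \<sigma>) = single \<one>\<^bsub>M\<^esub> 1"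
  "zero (tw_alg M \<sigma>) = 0"
  "add (tw_alg M \<sigma>) = (+)"
  "smult (tw_alg M \<sigma>) = (\<lambda>c t. scale c t)"
  by (simp_all add: tw_alg_def)

lemma monoid_alg_eq_tw_alg: "monoid_alg M = tw_alg M (\<lambda>_ _. 1)"
  unfolding monoid_alg_def tw_alg_def tw_mult_def by simp

lemma tw_mult_zero_left [simp]: "tw_mult M \<sigma> 0 t = 0"
  and tw_mult_zero_right [simp]: "tw_mult M \<sigma> s 0 = 0"
  by (simp_all add: tw_mult_def)

lemma tw_mult_single:
  "tw_mult M \<sigma> (single u c) (single v d)
     = single (u \<otimes>\<^bsub>M\<^esub> v) (\<sigma> u v * (c * d))"
  by (simp add: tw_mult_def)

lemma tw_mult_add_left: "tw_mult M \<sigma> (s + s') t = tw_mult M \<sigma> s t + tw_mult M \<sigma> s' t"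
  unfolding tw_mult_def
  by (rule setsum_keys_plus_distrib)
     (simp_all add: distrib_left distrib_right single_add sum.distrib)

lemma tw_mult_add_right: "tw_mult M \<sigma> s (t + t') = tw_mult M \<sigma> s t + tw_mult M \<sigma> s t'"
  unfolding tw_mult_def sum.distrib[symmetric]
  by (intro sum.cong refl setsum_keys_plus_distrib)
     (simp_all add: distrib_left single_add)

lemma tw_mult_scale_left:
  "tw_mult M \<sigma> (scale c s) t = scale c (tw_mult M \<sigma> s t)"
proof (induction s rule: pm_induct)
  case (single u d)
  show ?case
    by (induction t rule: pm_induct) (simp_all add: tw_mult_single tw_mult_add_right scale_add mult.left_commute mult.assoc)
qed (simp_all add: tw_mult_add_left scale_add)

lemma tw_mult_scale_right:
  "tw_mult M \<sigma> s (scale c t) = scale c (tw_mult M \<sigma> s t)"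
proof (induction s rule: pm_induct)
  case (single u d)
  show ?case
    by (induction t rule: pm_induct) (simp_all add: tw_mult_single tw_mult_add_right scale_add mult.left_commute mult.assoc)
qed (simp_all add: tw_mult_add_left scale_add)

locale cocycle = monoid M for M (structure) +
  fixes \<sigma> :: "'a \<Rightarrow> 'a \<Rightarrow> complex"
  assumes cocycle: "u \<in> carrier M \<Longrightarrow> v \<in> carrier M \<Longrightarrow> w \<in> carrier M \<Longrightarrow>
      \<sigma> u v * \<sigma> (u \<otimes> v) w = \<sigma> v w * \<sigma> u (v \<otimes> w)"
    and cocycle_one_left: "u \<in> carrier M \<Longrightarrow> \<sigma> \<one> u = 1"
    and cocycle_one_right: "u \<in> carrier M \<Longrightarrow> \<sigma> u \<one> = 1"
begin

lemma tw_mult_closed: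
  assumes "keys s \<subseteq> carrier M" "keys t \<subseteq> carrier M"
  shows "keys (tw_mult M \<sigma> s t) \<subseteq> carrier M"
  using assms(1)
proof (induction s rule: pm_support_induct)
  case (single u c)
  show ?case using assms(2)
  proof (induction t rule: pm_support_induct)
    case (add s t)
    then show ?case unfolding tw_mult_add_right by (intro subset_trans[OF keys_add] Un_least)
  qed (use single in \<open>auto simp: tw_mult_single\<close>)
next
  case (add s s')
  then show ?case unfolding tw_mult_add_left by (intro subset_trans[OF keys_add] Un_least)
qed simp

lemma tw_mult_one_left:
  "keys t \<subseteq> carrier M \<Longrightarrow> tw_mult M \<sigma> (single \<one> 1) t = t"
  by (induction t rule: pm_support_induct) (simp_all add: tw_mult_single cocycle_one_left tw_mult_add_right)

lemma tw_mult_one_right: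
  "keys t \<subseteq> carrier M \<Longrightarrow> tw_mult M \<sigma> t (single \<one> 1) = t"
  by (induction t rule: pm_support_induct) (simp_all add: tw_mult_single cocycle_one_right tw_mult_add_left)

lemma tw_mult_assoc:
  assumes "keys r \<subseteq> carrier M" "keys s \<subseteq> carrier M" "keys t \<subseteq> carrier M"
  shows "tw_mult M \<sigma> (tw_mult M \<sigma> r s) t = tw_mult M \<sigma> r (tw_mult M \<sigma> s t)"
  using assms(1)
proof (induction r rule: pm_support_induct)
  case (single u c)
  show ?case using assms(2)
  proof (induction s rule: pm_support_induct)
    case (single v d)
    show ?case using assms(3)
    proof (induction t rule: pm_support_induct)
      case (single w e)
      have "\<sigma> u v * \<sigma> (u \<otimes> v) w = \<sigma> v w * \<sigma> u (v \<otimes> w)"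
        using single \<open>u \<in> carrier M\<close> \<open>v \<in> carrier M\<close> by (simp only: cocycle)
      then have "\<sigma> u v * \<sigma> (u \<otimes> v) w * (c * d * e) = \<sigma> v w * \<sigma> u (v \<otimes> w) * (c * d * e)"
        by (rule arg_cong)
      then have "\<sigma> (u \<otimes> v) w * (\<sigma> u v * (c * d) * e) = \<sigma> u (v \<otimes> w) * (c * (\<sigma> v w * (d * e)))"
        by (simp only: mult_ac)
      then show ?case using single \<open>u \<in> carrier M\<close> \<open>v \<in> carrier M\<close>
        by (simp only: tw_mult_single m_assoc)
    qed (simp_all add: tw_mult_add_right)
  qed (simp_all add: tw_mult_add_left tw_mult_add_right)
qed (simp_all add: tw_mult_add_left)

lemma calg_tw_alg: "calg (tw_alg M \<sigma>)"
proof (rule calgI)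
  fix s t assume "s \<in> carrier (tw_alg M \<sigma>)" "t \<in> carrier (tw_alg M \<sigma>)"
  then show "s \<oplus>\<^bsub>tw_alg M \<sigma>\<^esub> t \<in> carrier (tw_alg M \<sigma>)" using keys_add[of s t] by auto
next
  fix s c assume "s \<in> carrier (tw_alg M \<sigma>)"
  then show "c \<odot>\<^bsub>tw_alg M \<sigma>\<^esub> s \<in> carrier (tw_alg M \<sigma>)" using keys_scale[of c s] by auto
qed (simp_all add: tw_mult_closed tw_mult_assoc tw_mult_one_left tw_mult_one_right tw_mult_add_left
    tw_mult_add_right tw_mult_scale_left tw_mult_scale_right scale_add add_ac,
    simp_all add: poly_mapping_eq_iff fun_eq_iff lookup_add algebra_simps)

end

lemma calg_monoid_alg:
  assumes "monoid M"
  shows "calg (monoid_alg M)"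
proof -
  interpret monoid M by fact
  interpret cocycle M "\<lambda>_ _. 1" by unfold_locales simp_all
  show ?thesis unfolding monoid_alg_eq_tw_alg by (rule calg_tw_alg)
qed

text \<open>
  Since a product is the double sum of products of monomials, a linear map on it is an iterated
  linear extension.  Multiplicativity of evaluation maps and the product rule for products in the
  quantum group are read off from this form.
\<close>

lemma (in calg) lin_ext_tw_mult:
  assumes "keys s \<subseteq> carrier M" "keys t \<subseteq> carrier M"
    and M: "cocycle M \<sigma>" and \<phi>: "\<phi> \<in> carrier M \<rightarrow> carrier A"
  shows "lin_ext A \<phi> (tw_mult M \<sigma> s t)
    = lin_ext A (\<lambda>u. lin_ext A (\<lambda>v. \<sigma> u v \<odot> \<phi> (u \<otimes>\<^bsub>M\<^esub> v)) t) s"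
proof -
  interpret M: cocycle M \<sigma> by fact
  have \<phi>': "\<phi> (u \<otimes>\<^bsub>M\<^esub> v) \<in> carrier A" if "u \<in> carrier M" "v \<in> carrier M" for u v
    using that \<phi> by (auto simp: Pi_iff)
  show ?thesis
    using assms(1)
  proof (induction s rule: pm_support_induct)
    case zero
    show ?case by simp
  next
    case (single u c)
    have "lin_ext A \<phi> (tw_mult M \<sigma> (single u c) t)
      = c \<odot> lin_ext A (\<lambda>v. \<sigma> u v \<odot> \<phi> (u \<otimes>\<^bsub>M\<^esub> v)) t"
      using assms(2)
    proof (induction t rule: pm_support_induct)
      case zero
      show ?case by simp
    next
      case (single v d)
      then show ?case using \<open>u \<in> carrier M\<close> \<phi>'[of u v]
        by (simp add: tw_mult_single flip: smult_assoc) (simp add: ac_simps)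
    next
      case (add t t')
      have "lin_ext A \<phi> (tw_mult M \<sigma> (single u c) (t + t'))
        = lin_ext A \<phi> (tw_mult M \<sigma> (single u c) t) \<oplus>
          lin_ext A \<phi> (tw_mult M \<sigma> (single u c) t')"
        unfolding tw_mult_add_right
        by (rule lin_ext_add[OF \<phi>]; rule M.tw_mult_closed) (use add single in auto)
      also have "lin_ext A (\<lambda>v. \<sigma> u v \<odot> \<phi> (u \<otimes>\<^bsub>M\<^esub> v)) (t + t')
        = lin_ext A (\<lambda>v. \<sigma> u v \<odot> \<phi> (u \<otimes>\<^bsub>M\<^esub> v)) t \<oplus> lin_ext A (\<lambda>v. \<sigma> u v \<odot> \<phi> (u \<otimes>\<^bsub>M\<^esub> v)) t'"
        by (rule lin_ext_add[of _ "carrier M"]) (use add single \<phi>' in auto)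
      ultimately show ?case using add single \<phi>'
        by (auto simp: smult_r_distr Pi_iff subset_iff)
    qed
    also have "\<dots> = lin_ext A (\<lambda>u. lin_ext A (\<lambda>v. \<sigma> u v \<odot> \<phi> (u \<otimes>\<^bsub>M\<^esub> v)) t) (single u c)"
      by (rule lin_ext_single[symmetric])
         (use single assms(2) \<phi>' in \<open>auto simp: Pi_iff subset_iff intro!: lin_ext_closed\<close>)
    finally show ?case .
  next
    case (add s s')
    have "lin_ext A \<phi> (tw_mult M \<sigma> (s + s') t)
        = lin_ext A \<phi> (tw_mult M \<sigma> s t) \<oplus> lin_ext A \<phi> (tw_mult M \<sigma> s' t)"
      unfolding tw_mult_add_left
      by (rule lin_ext_add[OF \<phi>]; rule M.tw_mult_closed) (use add assms(2) in auto)
    also have "\<dots> = lin_ext A (\<lambda>u. lin_ext A (\<lambda>v. \<sigma> u v \<odot> \<phi> (u \<otimes>\<^bsub>M\<^esub> v)) t) (s + s')"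
      using add
      by (simp, intro lin_ext_add[symmetric, of _ "carrier M"])
         (use add assms(2) \<phi>' in \<open>auto simp: Pi_iff subset_iff intro!: lin_ext_closed\<close>)
    finally show ?case .
  qed
qed

lemma (in calg) lin_ext_monoid_alg_mult:
  assumes "s \<in> carrier (monoid_alg M)" "t \<in> carrier (monoid_alg M)"
    and "monoid M" and \<phi>: "\<phi> \<in> carrier M \<rightarrow> carrier A"
  shows "lin_ext A \<phi> (s \<otimes>\<^bsub>monoid_alg M\<^esub> t)
    = lin_ext A (\<lambda>u. lin_ext A (\<lambda>v. \<phi> (u \<otimes>\<^bsub>M\<^esub> v)) t) s"
proof -
  interpret monoid M by fact
  interpret cocycle M "\<lambda>_ _. 1" by unfold_locales simp_all
  have "lin_ext A \<phi> (s \<otimes>\<^bsub>monoid_alg M\<^esub> t)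
      = lin_ext A (\<lambda>u. lin_ext A (\<lambda>v. 1 \<odot> \<phi> (u \<otimes>\<^bsub>M\<^esub> v)) t) s"
    using assms unfolding monoid_alg_eq_tw_alg
    by (simp add: lin_ext_tw_mult[OF _ _ cocycle_axioms])
  also have "\<dots> = lin_ext A (\<lambda>u. lin_ext A (\<lambda>v. \<phi> (u \<otimes>\<^bsub>M\<^esub> v)) t) s"
    using assms(1,2) \<phi> unfolding monoid_alg_eq_tw_alg
    by (intro lin_ext_cong) (auto simp: Pi_iff subset_iff)
  finally show ?thesis .
qed

subsection \<open>Quotients\<close>

context
  fixes A :: "(complex, 'a, 'm) module_scheme" and I
  assumes A: "calg A" and I: "ideal I A"
begin

interpretation A: calg A by (rule A)
interpretation I: ideal I A by (rule I)

lemma quot_alg_simps [simp]: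
  "carrier (quot_alg A I) = (\<lambda>a. I +>\<^bsub>A\<^esub> a) ` carrier A"
  "zero (quot_alg A I) = I"
  "one (quot_alg A I) = I +>\<^bsub>A\<^esub> \<one>\<^bsub>A\<^esub>"
  by (auto simp: quot_alg_def ring.defs module.defs FactRing_def A_RCOSETS_def')

lemma coset_eq_iff:
  assumes "a \<in> carrier A" "b \<in> carrier A"
  shows "I +>\<^bsub>A\<^esub> a = I +>\<^bsub>A\<^esub> b \<longleftrightarrow> a \<oplus>\<^bsub>A\<^esub> (-1) \<odot>\<^bsub>A\<^esub> b \<in> I"
  using A.quotient_eq_iff_same_a_r_cos[OF I assms] assms
  by (simp add: a_minus_def A.minus_eq_smult)

lemma ideal_smult: "a \<in> I \<Longrightarrow> c \<odot>\<^bsub>A\<^esub> a \<in> I"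
  using I.I_l_closed[of a "c \<odot>\<^bsub>A\<^esub> \<one>\<^bsub>A\<^esub>"] I.a_Hcarr[of a] by (simp add: A.smult_mult_l)

lemma coset_zero: "I +>\<^bsub>A\<^esub> \<zero>\<^bsub>A\<^esub> = I"
  by (rule I.a_rcos_const) (rule I.zero_closed)

text \<open>
  The scalar multiple of a coset is defined as a union over its elements; the point is that
  all members of this union coincide, because an ideal is closed under scalars.
\<close>

lemma alg_map_coset: "alg_map A (quot_alg A I) (\<lambda>a. I +>\<^bsub>A\<^esub> a)"
  unfolding alg_map_def lin_map_def
proof (intro conjI ballI allI)
  fix c a assume a: "a \<in> carrier A"
  have *: "I +>\<^bsub>A\<^esub> (c \<odot>\<^bsub>A\<^esub> x) = I +>\<^bsub>A\<^esub> (c \<odot>\<^bsub>A\<^esub> a)" if "x \<in> I +>\<^bsub>A\<^esub> a" for x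
  proof -
    have x: "x \<in> carrier A" using that by (rule I.a_elemrcos_carrier[OF a])
    have "I +>\<^bsub>A\<^esub> x = I +>\<^bsub>A\<^esub> a" using I.a_repr_independence'[OF that a] ..
    then have "x \<oplus>\<^bsub>A\<^esub> (-1) \<odot>\<^bsub>A\<^esub> a \<in> I" using coset_eq_iff[OF x a] by simp
    then have "c \<odot>\<^bsub>A\<^esub> (x \<oplus>\<^bsub>A\<^esub> (-1) \<odot>\<^bsub>A\<^esub> a) \<in> I" by (rule ideal_smult)
    then show ?thesis using x a
      by (simp add: coset_eq_iff A.smult_r_distr flip: A.smult_assoc)
  qed
  have "a \<in> I +>\<^bsub>A\<^esub> a" using a by (rule I.a_rcos_self)
  then have "(\<Union>x\<in>I +>\<^bsub>A\<^esub> a. I +>\<^bsub>A\<^esub> (c \<odot>\<^bsub>A\<^esub> x)) = I +>\<^bsub>A\<^esub> (c \<odot>\<^bsub>A\<^esub> a)"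
    using * by blast
  then show "I +>\<^bsub>A\<^esub> (c \<odot>\<^bsub>A\<^esub> a) = c \<odot>\<^bsub>quot_alg A I\<^esub> (I +>\<^bsub>A\<^esub> a)"
    by (simp add: quot_alg_def ring.defs module.defs)
qed (auto simp: quot_alg_def ring.defs module.defs FactRing_def A_RCOSETS_def' I.a_rcos_sum I.rcoset_mult_add)

lemma calg_quot_alg: "calg (quot_alg A I)"
  by (rule calg_hom_image[OF A alg_map_coset]) (simp_all add: coset_zero)

lemma coset_eq_zero_iff: "a \<in> carrier A \<Longrightarrow> I +>\<^bsub>A\<^esub> a = I \<longleftrightarrow> a \<in> I"
  using coset_eq_iff[of a "\<zero>\<^bsub>A\<^esub>"] coset_zero by simp

end

subsection \<open>Endomorphisms and scalars\<close>

lemma calg_complex_alg: "calg complex_alg"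
  by (rule calgI) (auto simp: complex_alg_def algebra_simps)

lemma linear_end_iff:
  "f \<in> linear_end A \<longleftrightarrow> f \<in> extensional (carrier A) \<and> lin_map A A f"
  unfolding linear_end_def lin_map_def by (auto simp: PiE_iff Pi_iff)

lemma end_alg_simps [simp]:
  "carrier (end_alg A) = linear_end A"
  "mult (end_alg A) = (\<lambda>f g. compose (carrier A) f g)"
  "one (end_alg A) = (\<lambda>a \<in> carrier A. a)"
  "zero (end_alg A) = (\<lambda>a \<in> carrier A. \<zero>\<^bsub>A\<^esub>)"
  "add (end_alg A) = (\<lambda>f g. \<lambda>a \<in> carrier A. f a \<oplus>\<^bsub>A\<^esub> g a)"
  "smult (end_alg A) = (\<lambda>c f. \<lambda>a \<in> carrier A. c \<odot>\<^bsub>A\<^esub> f a)"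
  by (simp_all add: end_alg_def)

lemma calg_end_alg:
  assumes "calg A"
  shows "calg (end_alg A)"
proof -
  interpret A: calg A by fact
  have c: "f a \<in> carrier A" if "f \<in> linear_end A" "a \<in> carrier A" for f a
    using that by (auto simp: linear_end_iff intro: lin_map_closed)
  have ad: "f (a \<oplus>\<^bsub>A\<^esub> b) = f a \<oplus>\<^bsub>A\<^esub> f b" if "f \<in> linear_end A" "a \<in> carrier A" "b \<in> carrier A" for f a b
    using that by (auto simp: linear_end_iff intro: lin_map_add)
  have sc: "f (d \<odot>\<^bsub>A\<^esub> a) = d \<odot>\<^bsub>A\<^esub> f a" if "f \<in> linear_end A" "a \<in> carrier A" for f a d
    using that by (auto simp: linear_end_iff intro: lin_map_smult)
  have ext: "f = g" if "f \<in> extensional (carrier A)" "g \<in> extensional (carrier A)"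
    "\<And>a. a \<in> carrier A \<Longrightarrow> f a = g a" for f g
    using that by (rule extensionalityI)
  have E: "f \<in> extensional (carrier A)" if "f \<in> linear_end A" for f
    using that by (simp add: linear_end_iff)
  have lin: "f \<in> linear_end A" if "f \<in> extensional (carrier A)" "\<And>a. a \<in> carrier A \<Longrightarrow> f a \<in> carrier A"
    "\<And>a b. a \<in> carrier A \<Longrightarrow> b \<in> carrier A \<Longrightarrow> f (a \<oplus>\<^bsub>A\<^esub> b) = f a \<oplus>\<^bsub>A\<^esub> f b"
    "\<And>d a. a \<in> carrier A \<Longrightarrow> f (d \<odot>\<^bsub>A\<^esub> a) = d \<odot>\<^bsub>A\<^esub> f a" for f
    using that by (simp add: linear_end_iff lin_mapI)
  note [simp] = c ad sc E A.smult_mult_l A.smult_mult_r A.smult_r_distr A.a_ac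
  show ?thesis
  proof (rule calgI, goal_cases)
    case 1 then show ?case unfolding end_alg_simps by (intro lin) auto
  next
    case 2 then show ?case unfolding end_alg_simps by (intro lin) auto
  next
    case 6 then show ?case unfolding end_alg_simps by (intro lin) (auto simp: compose_def)
  next
    case 7 then show ?case unfolding end_alg_simps by (intro lin) auto
  next
    case 13 then show ?case unfolding end_alg_simps by (intro lin) (auto simp: mult.commute simp flip: A.smult_assoc)
  qed (auto intro!: ext simp: compose_def A.smult_l_distr A.smult_assoc)
qed

section \<open>Algebras given by generators and relations\<close>

lemma monoid_word_monoid: "monoid word_monoid"
  by (rule monoidI) (simp_all add: word_monoid_def)

lemma calg_free_alg: "calg free_alg"
  unfolding free_alg_def by (rule calg_monoid_alg[OF monoid_word_monoid])

lemma free_alg_simps [simp]: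
  "carrier free_alg = UNIV"
  "one free_alg = single [] 1"
  "zero free_alg = 0"
  "add free_alg = (+)"
  "smult free_alg = (\<lambda>c t. scale c t)"
  by (simp_all add: free_alg_def monoid_alg_def word_monoid_def)

lemma free_alg_single_mult:
  "single u c \<otimes>\<^bsub>free_alg\<^esub> single v d = single (u @ v) (c * d)"
  by (simp add: free_alg_def monoid_alg_eq_tw_alg tw_mult_single word_monoid_def)

definition word_val :: "(complex, 'b, 'n) module_scheme \<Rightarrow> ('g \<Rightarrow> 'b) \<Rightarrow> 'g list \<Rightarrow> 'b" where
  "word_val B v w = foldr (\<lambda>g a. v g \<otimes>\<^bsub>B\<^esub> a) w \<one>\<^bsub>B\<^esub>"

lemma word_val_simps [simp]:
  "word_val B v [] = \<one>\<^bsub>B\<^esub>"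
  "word_val B v (g # w) = v g \<otimes>\<^bsub>B\<^esub> word_val B v w"
  by (simp_all add: word_val_def)

abbreviation free_eval :: "(complex, 'b, 'n) module_scheme \<Rightarrow> ('g \<Rightarrow> 'b) \<Rightarrow> ('g list \<Rightarrow>\<^sub>0 complex) \<Rightarrow> 'b" where
  "free_eval B v \<equiv> lin_ext B (word_val B v)"

lemma alg_mapI:
  assumes "lin_map A B f" "f \<one>\<^bsub>A\<^esub> = \<one>\<^bsub>B\<^esub>"
    and "\<And>a b. a \<in> carrier A \<Longrightarrow> b \<in> carrier A \<Longrightarrow> f (a \<otimes>\<^bsub>A\<^esub> b) = f a \<otimes>\<^bsub>B\<^esub> f b"
  shows "alg_map A B f"
  using assms by (simp add: alg_map_def)

lemma alg_map_lin: "alg_map A B f \<Longrightarrow> lin_map A B f"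
  and alg_map_one: "alg_map A B f \<Longrightarrow> f \<one>\<^bsub>A\<^esub> = \<one>\<^bsub>B\<^esub>"
  and alg_map_mult: "alg_map A B f \<Longrightarrow> a \<in> carrier A \<Longrightarrow> b \<in> carrier A \<Longrightarrow> f (a \<otimes>\<^bsub>A\<^esub> b) = f a \<otimes>\<^bsub>B\<^esub> f b"
  by (simp_all add: alg_map_def)

lemmas alg_map_closed = lin_map_closed[OF alg_map_lin]
lemmas alg_map_add = lin_map_add[OF alg_map_lin]
lemmas alg_map_smult = lin_map_smult[OF alg_map_lin]
lemmas alg_mapD = alg_map_closed alg_map_add alg_map_smult alg_map_one alg_map_mult

lemma ideal_kernel:
  assumes A: "calg A" and B: "calg B" and f: "alg_map A B f"
  shows "ideal {a \<in> carrier A. f a = \<zero>\<^bsub>B\<^esub>} A"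
proof -
  interpret A: calg A by fact
  interpret B: calg B by fact
  have "f \<in> ring_hom A B"
    using f unfolding alg_hom_iff[symmetric] alg_hom_def by simp
  then have "ring_hom_ring A B f"
    by (rule ring_hom_ringI2[OF A.ring_axioms B.ring_axioms])
  from ring_hom_ring.kernel_is_ideal[OF this] show ?thesis
    by (simp only: a_kernel_def')
qed

lemma (in calg) word_val_closed:
  "(\<And>g. v g \<in> carrier A) \<Longrightarrow> word_val A v w \<in> carrier A"
  by (induction w) auto

lemma (in calg) word_val_append:
  "(\<And>g. v g \<in> carrier A) \<Longrightarrow> word_val A v (u @ w) = word_val A v u \<otimes> word_val A v w"
  by (induction u) (auto simp: word_val_closed m_assoc)

lemma (in calg) alg_map_free_eval:
  assumes v: "\<And>g. v g \<in> carrier A"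
  shows "alg_map free_alg A (free_eval A v)"
proof -
  have c: "word_val A v \<in> S \<rightarrow> carrier A" for S
    by (auto simp: word_val_closed[OF v])
  show ?thesis
  proof (intro alg_mapI lin_mapI)
    fix s t :: "'b list \<Rightarrow>\<^sub>0 complex"
    have "free_eval A v (s \<otimes>\<^bsub>free_alg\<^esub> t)
        = lin_ext A (\<lambda>u. lin_ext A (\<lambda>w. word_val A v (u \<otimes>\<^bsub>word_monoid\<^esub> w)) t) s"
      unfolding free_alg_def
      by (rule lin_ext_monoid_alg_mult[OF _ _ monoid_word_monoid c])
         (simp_all add: monoid_alg_def word_monoid_def)
    also have "\<dots> = lin_ext A (\<lambda>u. lin_ext A (\<lambda>w. word_val A v u \<otimes> word_val A v w) t) s"
      by (simp add: word_monoid_def word_val_append[OF v])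
    also have "\<dots> = lin_ext A (\<lambda>u. word_val A v u \<otimes> free_eval A v t) s"
    proof (intro lin_ext_cong)
      fix u
      have "lin_map A A (\<lambda>a. word_val A v u \<otimes> a)"
        by (rule lin_mapI) (simp_all add: r_distr smult_mult_r word_val_closed[OF v])
      then show "lin_ext A (\<lambda>w. word_val A v u \<otimes> word_val A v w) t = word_val A v u \<otimes> free_eval A v t"
        by (rule lin_map_lin_ext[OF calg_axioms calg_axioms _ c, symmetric])
    qed (auto simp: word_val_closed[OF v] c)
    also have "\<dots> = free_eval A v s \<otimes> free_eval A v t"
    proof -
      have "lin_map A A (\<lambda>a. a \<otimes> free_eval A v t)"
        by (rule lin_mapI) (simp_all add: l_distr smult_mult_l c)
      then show ?thesis
        by (rule lin_map_lin_ext[OF calg_axioms calg_axioms _ c, symmetric])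
    qed
    finally show "free_eval A v (s \<otimes>\<^bsub>free_alg\<^esub> t) = free_eval A v s \<otimes> free_eval A v t" .
  qed (simp_all add: c lin_ext_add[of _ UNIV] lin_ext_scale)
qed

context
  fixes R :: "('g list \<Rightarrow>\<^sub>0 complex) set"
begin

interpretation F: calg "free_alg :: (complex, 'g list \<Rightarrow>\<^sub>0 complex) module"
  by (rule calg_free_alg)

abbreviation (input) "rel_ideal \<equiv> Idl\<^bsub>free_alg\<^esub> R"

lemma ideal_rel_ideal: "ideal rel_ideal free_alg"
  by (rule F.genideal_ideal) simp

lemma calg_pres_alg: "calg (pres_alg R)"
  unfolding pres_alg_def by (rule calg_quot_alg[OF calg_free_alg ideal_rel_ideal])

interpretation Q: calg "pres_alg R"
  by (rule calg_pres_alg)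

lemma carrier_pres_alg: "carrier (pres_alg R) = range (\<lambda>t. rel_ideal +>\<^bsub>free_alg\<^esub> t)"
  unfolding pres_alg_def by (simp add: quot_alg_simps[OF calg_free_alg ideal_rel_ideal])

lemma alg_map_pres_coset: "alg_map free_alg (pres_alg R) (\<lambda>t. rel_ideal +>\<^bsub>free_alg\<^esub> t)"
  unfolding pres_alg_def by (rule alg_map_coset[OF calg_free_alg ideal_rel_ideal])

lemma pres_gen_closed [simp]: "pres_gen R g \<in> carrier (pres_alg R)"
  by (simp add: carrier_pres_alg pres_gen_def)

text \<open>
  A presented algebra is spanned by the classes of words, so a property stable under the algebra
  operations needs checking on generators only.
\<close>

lemma pres_alg_induct [consumes 1, case_names one gen add mult smult]:
  assumes "a \<in> carrier (pres_alg R)"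
    and one: "P \<one>\<^bsub>pres_alg R\<^esub>"
    and gen: "\<And>g. P (pres_gen R g)"
    and add: "\<And>a b. a \<in> carrier (pres_alg R) \<Longrightarrow> b \<in> carrier (pres_alg R) \<Longrightarrow> P a \<Longrightarrow> P b \<Longrightarrow> P (a \<oplus>\<^bsub>pres_alg R\<^esub> b)"
    and mult: "\<And>a b. a \<in> carrier (pres_alg R) \<Longrightarrow> b \<in> carrier (pres_alg R) \<Longrightarrow> P a \<Longrightarrow> P b \<Longrightarrow> P (a \<otimes>\<^bsub>pres_alg R\<^esub> b)"
    and smult: "\<And>c a. a \<in> carrier (pres_alg R) \<Longrightarrow> P a \<Longrightarrow> P (c \<odot>\<^bsub>pres_alg R\<^esub> a)"
  shows "P a"
proof -
  let ?pr = "\<lambda>t. rel_ideal +>\<^bsub>free_alg\<^esub> t"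
  note pr = alg_mapD[OF alg_map_pres_coset, simplified]
  have w: "P (?pr (single w 1))" for w
  proof (induction w)
    case Nil
    then show ?case using one pr by simp
  next
    case (Cons g w)
    have "?pr (single (g # w) 1) = pres_gen R g \<otimes>\<^bsub>pres_alg R\<^esub> ?pr (single w 1)"
      using pr(5)[of "single [g] 1" "single w 1"]
      by (simp add: pres_gen_def free_alg_single_mult)
    then show ?case using mult[OF _ _ gen Cons] pr by simp
  qed
  have "P (?pr t)" for t
  proof (induction t rule: pm_induct)
    case zero
    have "?pr 0 = 0 \<odot>\<^bsub>pres_alg R\<^esub> \<one>\<^bsub>pres_alg R\<^esub>"
      using lin_map_zero[OF calg_free_alg calg_pres_alg alg_map_lin[OF alg_map_pres_coset]] by simp
    then show ?case using smult[OF _ one, of 0] by simp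
  next
    case (single u c)
    have "?pr (single u c) = c \<odot>\<^bsub>pres_alg R\<^esub> ?pr (single u 1)"
      using pr(3)[of c "single u 1"] by simp
    then show ?case using smult[OF _ w] pr by simp
  next
    case (add s t)
    then show ?case using assms(4) pr by simp
  qed
  then show ?thesis using assms(1) by (auto simp: carrier_pres_alg)
qed

lemma pres_alg_map_eqI:
  assumes B: "calg B" and f: "alg_map (pres_alg R) B f" and g: "alg_map (pres_alg R) B g"
    and eq: "\<And>x. f (pres_gen R x) = g (pres_gen R x)" and a: "a \<in> carrier (pres_alg R)"
  shows "f a = g a"
  using a
  by (induction a rule: pres_alg_induct) (simp_all add: eq alg_mapD[OF f] alg_mapD[OF g])

text \<open>
  The universal property.  The evaluation of the free algebra kills the relators, hence the ideal
  they generate, and so descends to cosets; uniqueness is induction over generators.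
\<close>

lemma pres_hom_eval:
  assumes B: "calg B" and v: "\<And>g. v g \<in> carrier B"
    and rel: "\<And>r. r \<in> R \<Longrightarrow> free_eval B v r = \<zero>\<^bsub>B\<^esub>"
  shows "alg_map (pres_alg R) B (pres_hom R B v)"
    and "pres_hom R B v \<in> extensional (carrier (pres_alg R))"
    and "pres_hom R B v (pres_gen R g) = v g"
proof -
  interpret B: calg B by fact
  let ?pr = "\<lambda>t. rel_ideal +>\<^bsub>free_alg\<^esub> t"
  let ?ev = "free_eval B v"
  note pr = alg_mapD[OF alg_map_pres_coset, simplified]
  have ev: "alg_map free_alg B ?ev" by (rule B.alg_map_free_eval[OF v])
  have kernel: "rel_ideal \<subseteq> {t \<in> carrier free_alg. ?ev t = \<zero>\<^bsub>B\<^esub>}"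
    by (rule F.genideal_minimal[OF ideal_kernel[OF calg_free_alg B ev]]) (auto simp: rel)
  have wd: "?ev s = ?ev t" if "?pr s = ?pr t" for s t
  proof -
    have "s \<oplus>\<^bsub>free_alg\<^esub> (-1) \<odot>\<^bsub>free_alg\<^esub> t \<in> rel_ideal"
      using coset_eq_iff[OF calg_free_alg ideal_rel_ideal, of s t] that by simp
    then have "?ev (s \<oplus>\<^bsub>free_alg\<^esub> (-1) \<odot>\<^bsub>free_alg\<^esub> t) = \<zero>\<^bsub>B\<^esub>" using kernel by blast
    then have "?ev s \<oplus>\<^bsub>B\<^esub> (-1) \<odot>\<^bsub>B\<^esub> ?ev t = \<zero>\<^bsub>B\<^esub>"
      using alg_map_add[OF ev, of s "(-1) \<odot>\<^bsub>free_alg\<^esub> t"] alg_map_smult[OF ev, of t "-1"] by simp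
    then show ?thesis
      using alg_map_closed[OF ev, of s] alg_map_closed[OF ev, of t]
      by (simp flip: B.minus_eq_smult) (metis B.minus_equality B.minus_minus B.add.inv_closed)
  qed
  define h where "h = (\<lambda>X\<in>carrier (pres_alg R). ?ev (SOME t. ?pr t = X))"
  have h: "h (?pr t) = ?ev t" for t
  proof -
    have "?pr (SOME s. ?pr s = ?pr t) = ?pr t" by (rule someI[of _ t]) simp
    from wd[OF this] show ?thesis unfolding h_def by (simp add: carrier_pres_alg)
  qed
  have hom: "alg_map (pres_alg R) B h"
  proof (intro alg_mapI lin_mapI)
    fix a b assume "a \<in> carrier (pres_alg R)" "b \<in> carrier (pres_alg R)"
    then obtain s t where st: "a = ?pr s" "b = ?pr t" by (auto simp: carrier_pres_alg)
    show "h (a \<oplus>\<^bsub>pres_alg R\<^esub> b) = h a \<oplus>\<^bsub>B\<^esub> h b"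
      using alg_map_add[OF ev, of s t] by (simp add: st h flip: pr(2))
    show "h (a \<otimes>\<^bsub>pres_alg R\<^esub> b) = h a \<otimes>\<^bsub>B\<^esub> h b"
      using alg_map_mult[OF ev, of s t] by (simp add: st h flip: pr(5))
  next
    fix a c assume "a \<in> carrier (pres_alg R)"
    then obtain s where st: "a = ?pr s" by (auto simp: carrier_pres_alg)
    show "h (c \<odot>\<^bsub>pres_alg R\<^esub> a) = c \<odot>\<^bsub>B\<^esub> h a"
      using alg_map_smult[OF ev, of s] by (simp add: st h flip: pr(3))
    show "h a \<in> carrier B" using alg_map_closed[OF ev, of s] by (simp add: st h)
  next
    show "h \<one>\<^bsub>pres_alg R\<^esub> = \<one>\<^bsub>B\<^esub>"
      using alg_map_one[OF ev] by (simp add: h flip: pr(4))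
  qed
  have gen: "h (pres_gen R g) = v g" for g
    using v by (simp add: pres_gen_def h)
  have ext: "h \<in> extensional (carrier (pres_alg R))" by (simp add: h_def)
  have "h \<in> alg_hom (pres_alg R) B \<and> h \<in> extensional (carrier (pres_alg R)) \<and> (\<forall>g. h (pres_gen R g) = v g)"
    using hom gen ext by (simp add: alg_hom_iff)
  moreover have "f = h" if "f \<in> alg_hom (pres_alg R) B \<and> f \<in> extensional (carrier (pres_alg R)) \<and> (\<forall>g. f (pres_gen R g) = v g)" for f
  proof (rule extensionalityI[OF _ ext])
    show "f a = h a" if "a \<in> carrier (pres_alg R)" for a
      using \<open>f \<in> _ \<and> _\<close> gen by (intro pres_alg_map_eqI[OF B _ hom _ that]) (simp_all add: alg_hom_iff)
  qed (use that in simp)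
  ultimately have "pres_hom R B v = h"
    unfolding pres_hom_def by (rule the_equality)
  then show "alg_map (pres_alg R) B (pres_hom R B v)"
    "pres_hom R B v \<in> extensional (carrier (pres_alg R))"
    "pres_hom R B v (pres_gen R g) = v g"
    using hom gen ext by simp_all
qed

text \<open>
  The class of any \<open>t\<close> is the value of \<open>t\<close> at the generators, so a relator evaluates to the class of
  an element of the ideal.
\<close>

lemma pres_gen_rel:
  assumes "r \<in> R"
  shows "free_eval (pres_alg R) (pres_gen R) r = \<zero>\<^bsub>pres_alg R\<^esub>"
proof -
  let ?pr = "\<lambda>t. rel_ideal +>\<^bsub>free_alg\<^esub> t"
  note pr = alg_mapD[OF alg_map_pres_coset, simplified]
  have w: "?pr (single w 1) = word_val (pres_alg R) (pres_gen R) w" for w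
  proof (induction w)
    case (Cons g w)
    then show ?case
      using pr(5)[of "single [g] 1" "single w 1"]
      by (simp add: pres_gen_def free_alg_single_mult)
  qed (use pr in simp)
  have c: "word_val (pres_alg R) (pres_gen R) w \<in> carrier (pres_alg R)" for w
    by (rule Q.word_val_closed) simp
  have "?pr t = free_eval (pres_alg R) (pres_gen R) t" for t
  proof (induction t rule: pm_induct)
    case zero
    then show ?case
      using lin_map_zero[OF calg_free_alg calg_pres_alg alg_map_lin[OF alg_map_pres_coset]] by simp
  next
    case (single u d)
    have "?pr (single u d) = d \<odot>\<^bsub>pres_alg R\<^esub> ?pr (single u 1)"
      using pr(3)[of d "single u 1"] by simp
    then show ?case using c w by simp
  next
    case (add s t)
    then show ?case using pr c by (simp add: Q.lin_ext_add[of _ UNIV])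
  qed
  moreover have "r \<in> rel_ideal"
    using F.genideal_self[of R] assms by auto
  then have "?pr r = \<zero>\<^bsub>pres_alg R\<^esub>"
    unfolding pres_alg_def
    by (simp add: quot_alg_simps[OF calg_free_alg ideal_rel_ideal]
        coset_eq_zero_iff[OF calg_free_alg ideal_rel_ideal])
  ultimately show ?thesis by simp
qed

end

section \<open>Tensor products and the coproduct\<close>

lemma (in calg) add_neg_eq_zero_iff:
  assumes "a \<in> carrier A" "b \<in> carrier A"
  shows "a \<oplus> (-1) \<odot> b = \<zero> \<longleftrightarrow> a = b"
proof
  assume "a \<oplus> (-1) \<odot> b = \<zero>"
  then have "a = \<ominus> ((-1) \<odot> b)" using assms by (metis minus_equality smult_closed minus_minus)
  then show "a = b" using assms by (simp flip: minus_eq_smult)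
next
  assume "a = b"
  then show "a \<oplus> (-1) \<odot> b = \<zero>"
    using assms by (simp add: r_neg flip: minus_eq_smult)
qed

context
  fixes A :: "(complex, 'a, 'm) module_scheme" and B :: "(complex, 'b, 'n) module_scheme"
  assumes A: "calg A" and B: "calg B"
begin

interpretation A: calg A by (rule A)
interpretation B: calg B by (rule B)

abbreviation (input) "pair_alg \<equiv> monoid_alg (A \<times>\<times> B)"
abbreviation (input) "bilin_ideal \<equiv> Idl\<^bsub>monoid_alg (A \<times>\<times> B)\<^esub> (tensor_rels A B)"

lemma calg_pair_alg: "calg pair_alg"
  by (intro calg_monoid_alg DirProd_monoid A.monoid_axioms B.monoid_axioms)

interpretation P: calg pair_alg by (rule calg_pair_alg)

lemma pair_alg_simps:
  "carrier pair_alg = {t. keys t \<subseteq> carrier A \<times> carrier B}"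
  "one pair_alg = single (\<one>\<^bsub>A\<^esub>, \<one>\<^bsub>B\<^esub>) 1"
  "zero pair_alg = 0"
  "add pair_alg = (+)"
  "smult pair_alg = (\<lambda>c t. scale c t)"
  by (simp_all add: monoid_alg_def DirProd_def)

lemma pair_single_mult:
  "single (a, b) c \<otimes>\<^bsub>pair_alg\<^esub> single (a', b') d
    = single (a \<otimes>\<^bsub>A\<^esub> a', b \<otimes>\<^bsub>B\<^esub> b') (c * d)"
  by (simp add: monoid_alg_eq_tw_alg tw_mult_single DirProd_def)

lemma tensor_rels_closed: "tensor_rels A B \<subseteq> carrier pair_alg"
proof -
  have "keys (s - t) \<subseteq> carrier A \<times> carrier B"
    if "keys s \<subseteq> carrier A \<times> carrier B" "keys t \<subseteq> carrier A \<times> carrier B"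
    for s t :: "('a \<times> 'b) \<Rightarrow>\<^sub>0 complex"
    using that keys_diff[of s t] by blast
  note diff = this
  show ?thesis
    unfolding tensor_rels_def pair_alg_simps
    by (intro Un_least; rule subsetI; rule CollectI; elim CollectE exE conjE; hypsubst; intro diff)
       simp_all
qed

lemma ideal_bilin_ideal: "ideal bilin_ideal pair_alg"
  by (rule P.genideal_ideal[OF tensor_rels_closed])

lemma calg_tensor_alg: "calg (tensor_alg A B)"
  unfolding tensor_alg_def by (rule calg_quot_alg[OF calg_pair_alg ideal_bilin_ideal])

lemma alg_map_tensor_coset: "alg_map pair_alg (tensor_alg A B) (\<lambda>t. bilin_ideal +>\<^bsub>pair_alg\<^esub> t)"
  unfolding tensor_alg_def by (rule alg_map_coset[OF calg_pair_alg ideal_bilin_ideal])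

lemma single_in_pair_alg:
  "a \<in> carrier A \<Longrightarrow> b \<in> carrier B \<Longrightarrow> single (a, b) c \<in> carrier pair_alg"
  by (simp add: pair_alg_simps)

lemma pure_tensor_closed:
  "a \<in> carrier A \<Longrightarrow> b \<in> carrier B \<Longrightarrow> pure_tensor A B a b \<in> carrier (tensor_alg A B)"
  unfolding pure_tensor_def
  by (rule alg_map_closed[OF alg_map_tensor_coset single_in_pair_alg])

lemma pure_tensor_one: "\<one>\<^bsub>tensor_alg A B\<^esub> = pure_tensor A B \<one>\<^bsub>A\<^esub> \<one>\<^bsub>B\<^esub>"
  using alg_map_one[OF alg_map_tensor_coset] unfolding pure_tensor_def pair_alg_simps by simp

lemma pure_tensor_mult:
  assumes "a \<in> carrier A" "b \<in> carrier B" "a' \<in> carrier A" "b' \<in> carrier B"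
  shows "pure_tensor A B a b \<otimes>\<^bsub>tensor_alg A B\<^esub> pure_tensor A B a' b'
    = pure_tensor A B (a \<otimes>\<^bsub>A\<^esub> a') (b \<otimes>\<^bsub>B\<^esub> b')"
  using alg_map_mult[OF alg_map_tensor_coset, of "single (a, b) 1" "single (a', b') 1"] assms
  unfolding pure_tensor_def by (simp add: pair_single_mult single_in_pair_alg)

lemma tensor_rel_coset:
  assumes "s - t \<in> tensor_rels A B" "s \<in> carrier pair_alg" "t \<in> carrier pair_alg"
  shows "bilin_ideal +>\<^bsub>pair_alg\<^esub> s = bilin_ideal +>\<^bsub>pair_alg\<^esub> t"
proof -
  have "s - t \<in> bilin_ideal"
    using P.genideal_self[OF tensor_rels_closed] assms(1) by blast
  then show ?thesis
    using coset_eq_iff[OF calg_pair_alg ideal_bilin_ideal assms(2,3)]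
    by (simp add: pair_alg_simps diff_eq_scale)
qed

lemma pure_tensor_add_left:
  assumes "a \<in> carrier A" "a' \<in> carrier A" "b \<in> carrier B"
  shows "pure_tensor A B (a \<oplus>\<^bsub>A\<^esub> a') b
    = pure_tensor A B a b \<oplus>\<^bsub>tensor_alg A B\<^esub> pure_tensor A B a' b"
proof -
  have "bilin_ideal +>\<^bsub>pair_alg\<^esub> single (a \<oplus>\<^bsub>A\<^esub> a', b) 1
      = bilin_ideal +>\<^bsub>pair_alg\<^esub> (single (a, b) 1 \<oplus>\<^bsub>pair_alg\<^esub> single (a', b) 1)"
    using assms by (intro tensor_rel_coset P.a_closed single_in_pair_alg)
      (auto simp: tensor_rels_def pair_alg_simps diff_diff_eq)
  then show ?thesis unfolding pure_tensor_def
    using assms by (simp add: alg_map_add[OF alg_map_tensor_coset] single_in_pair_alg)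
qed

lemma pure_tensor_add_right:
  assumes "a \<in> carrier A" "b \<in> carrier B" "b' \<in> carrier B"
  shows "pure_tensor A B a (b \<oplus>\<^bsub>B\<^esub> b')
    = pure_tensor A B a b \<oplus>\<^bsub>tensor_alg A B\<^esub> pure_tensor A B a b'"
proof -
  have "bilin_ideal +>\<^bsub>pair_alg\<^esub> single (a, b \<oplus>\<^bsub>B\<^esub> b') 1
      = bilin_ideal +>\<^bsub>pair_alg\<^esub> (single (a, b) 1 \<oplus>\<^bsub>pair_alg\<^esub> single (a, b') 1)"
    using assms by (intro tensor_rel_coset P.a_closed single_in_pair_alg)
      (auto simp: tensor_rels_def pair_alg_simps diff_diff_eq)
  then show ?thesis unfolding pure_tensor_def
    using assms by (simp add: alg_map_add[OF alg_map_tensor_coset] single_in_pair_alg)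
qed

lemma pure_tensor_smult_left:
  assumes "a \<in> carrier A" "b \<in> carrier B"
  shows "pure_tensor A B (c \<odot>\<^bsub>A\<^esub> a) b = c \<odot>\<^bsub>tensor_alg A B\<^esub> pure_tensor A B a b"
proof -
  have "bilin_ideal +>\<^bsub>pair_alg\<^esub> single (c \<odot>\<^bsub>A\<^esub> a, b) 1
      = bilin_ideal +>\<^bsub>pair_alg\<^esub> (c \<odot>\<^bsub>pair_alg\<^esub> single (a, b) 1)"
    using assms by (intro tensor_rel_coset P.smult_closed single_in_pair_alg)
      (auto simp: tensor_rels_def pair_alg_simps)
  then show ?thesis unfolding pure_tensor_def
    using assms by (simp add: alg_map_smult[OF alg_map_tensor_coset] single_in_pair_alg)
qed

lemma pure_tensor_smult_right:
  assumes "a \<in> carrier A" "b \<in> carrier B"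
  shows "pure_tensor A B a (c \<odot>\<^bsub>B\<^esub> b) = c \<odot>\<^bsub>tensor_alg A B\<^esub> pure_tensor A B a b"
proof -
  have "bilin_ideal +>\<^bsub>pair_alg\<^esub> single (a, c \<odot>\<^bsub>B\<^esub> b) 1
      = bilin_ideal +>\<^bsub>pair_alg\<^esub> (c \<odot>\<^bsub>pair_alg\<^esub> single (a, b) 1)"
    using assms by (intro tensor_rel_coset P.smult_closed single_in_pair_alg)
      (auto simp: tensor_rels_def pair_alg_simps)
  then show ?thesis unfolding pure_tensor_def
    using assms by (simp add: alg_map_smult[OF alg_map_tensor_coset] single_in_pair_alg)
qed

end

text \<open>
  Four elements of an algebra satisfying the defining relations of the quantum group.  The
  commutator relation is written without subtraction, which lets it be used in any algebra record
  by plain rewriting.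
\<close>

definition uq_relations ::
  "complex \<Rightarrow> (complex, 'a, 'm) module_scheme \<Rightarrow> 'a \<Rightarrow> 'a \<Rightarrow> 'a \<Rightarrow> 'a \<Rightarrow> bool" where
  "uq_relations q A k k' e f \<longleftrightarrow> k \<in> carrier A \<and> k' \<in> carrier A \<and> e \<in> carrier A \<and> f \<in> carrier A \<and>
     k' \<otimes>\<^bsub>A\<^esub> k = \<one>\<^bsub>A\<^esub> \<and> k \<otimes>\<^bsub>A\<^esub> k' = \<one>\<^bsub>A\<^esub> \<and>
     k \<otimes>\<^bsub>A\<^esub> e = (q ^ 2) \<odot>\<^bsub>A\<^esub> (e \<otimes>\<^bsub>A\<^esub> k) \<and> k \<otimes>\<^bsub>A\<^esub> f = inverse (q ^ 2) \<odot>\<^bsub>A\<^esub> (f \<otimes>\<^bsub>A\<^esub> k) \<and>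
     e \<otimes>\<^bsub>A\<^esub> f = f \<otimes>\<^bsub>A\<^esub> e \<oplus>\<^bsub>A\<^esub> ((1 / (q - inverse q)) \<odot>\<^bsub>A\<^esub> k \<oplus>\<^bsub>A\<^esub> (- (1 / (q - inverse q))) \<odot>\<^bsub>A\<^esub> k')"

lemma uq_relations_iff_eval:
  assumes B: "calg B" and v: "\<And>g. v g \<in> carrier B"
  shows "(\<forall>r\<in>uq_rels q. free_eval B v r = \<zero>\<^bsub>B\<^esub>) \<longleftrightarrow> uq_relations q B (v Gk) (v Gkinv) (v Ge) (v Gf)"
proof -
  interpret B: calg B by fact
  define \<kappa> where "\<kappa> = 1 / (q - inverse q)"
  have c: "word_val B v \<in> UNIV \<rightarrow> carrier B"
    by (auto simp: B.word_val_closed[OF v])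
  note d = B.lin_ext_diff[OF c subset_UNIV subset_UNIV]
  have s: "free_eval B v (single w a) = a \<odot>\<^bsub>B\<^esub> word_val B v w" for w a
    by (simp add: B.word_val_closed[OF v])
  have "v Ge \<otimes>\<^bsub>B\<^esub> v Gf \<oplus>\<^bsub>B\<^esub> (-1) \<odot>\<^bsub>B\<^esub> (v Gf \<otimes>\<^bsub>B\<^esub> v Ge)
        \<oplus>\<^bsub>B\<^esub> (-1) \<odot>\<^bsub>B\<^esub> (\<kappa> \<odot>\<^bsub>B\<^esub> v Gk \<oplus>\<^bsub>B\<^esub> (-1) \<odot>\<^bsub>B\<^esub> (\<kappa> \<odot>\<^bsub>B\<^esub> v Gkinv)) = \<zero>\<^bsub>B\<^esub> \<longleftrightarrow>
      v Ge \<otimes>\<^bsub>B\<^esub> v Gf \<oplus>\<^bsub>B\<^esub> (-1) \<odot>\<^bsub>B\<^esub> (v Gf \<otimes>\<^bsub>B\<^esub> v Ge \<oplus>\<^bsub>B\<^esub> (\<kappa> \<odot>\<^bsub>B\<^esub> v Gk \<oplus>\<^bsub>B\<^esub> (- \<kappa>) \<odot>\<^bsub>B\<^esub> v Gkinv)) = \<zero>\<^bsub>B\<^esub>"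
    using v by (simp add: B.smult_r_distr B.a_assoc flip: B.smult_assoc)
  also have "\<dots> \<longleftrightarrow> v Ge \<otimes>\<^bsub>B\<^esub> v Gf = v Gf \<otimes>\<^bsub>B\<^esub> v Ge \<oplus>\<^bsub>B\<^esub> (\<kappa> \<odot>\<^bsub>B\<^esub> v Gk \<oplus>\<^bsub>B\<^esub> (- \<kappa>) \<odot>\<^bsub>B\<^esub> v Gkinv)"
    using v by (intro B.add_neg_eq_zero_iff) auto
  finally show ?thesis
    using v unfolding uq_rels_def uq_relations_def \<kappa>_def[symmetric]
    by (simp add: d s B.add_neg_eq_zero_iff del: B.lin_ext_single)
qed

lemma calg_uq_alg: "calg (uq_alg q)"
  unfolding uq_alg_def by (rule calg_pres_alg)

lemmas uq_gen_defs = uq_k_def uq_kinv_def uq_e_def uq_f_def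

lemma uq_relations_uq_alg: "uq_relations q (uq_alg q) (uq_k q) (uq_kinv q) (uq_e q) (uq_f q)"
  unfolding uq_alg_def uq_gen_defs
  by (subst uq_relations_iff_eval[OF calg_pres_alg, symmetric]) (simp_all add: pres_gen_rel)

text \<open>
  This is what makes the coproduct exist.  In the commutator of the images of \<open>e\<close> and \<open>f\<close> the mixed
  terms \<open>ek' \<otimes> kf\<close> and \<open>k'e \<otimes> fk\<close> agree since the powers of \<open>q\<close> gained by commuting \<open>k\<close> past
  \<open>e\<close> and \<open>f\<close> cancel; the two remaining commutators contribute multiples of \<open>k' \<otimes> k\<close> that
  cancel, leaving multiples of \<open>k \<otimes> k\<close> and \<open>k' \<otimes> k'\<close>.
\<close>

lemma uq_relations_tensor:
  assumes A: "calg A" and q: "q \<noteq> 0" and rel: "uq_relations q A k k' e f"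
  shows "uq_relations q (tensor_alg A A) (pure_tensor A A k k) (pure_tensor A A k' k')
     (pure_tensor A A \<one>\<^bsub>A\<^esub> e \<oplus>\<^bsub>tensor_alg A A\<^esub> pure_tensor A A e k)
     (pure_tensor A A f \<one>\<^bsub>A\<^esub> \<oplus>\<^bsub>tensor_alg A A\<^esub> pure_tensor A A k' f)"
proof -
  interpret A: calg A by fact
  interpret T: calg "tensor_alg A A" by (rule calg_tensor_alg[OF A A])
  note pt = pure_tensor_mult[OF A A] pure_tensor_add_left[OF A A] pure_tensor_add_right[OF A A]
    pure_tensor_smult_left[OF A A] pure_tensor_smult_right[OF A A]
  define \<kappa> where "\<kappa> = 1 / (q - inverse q)"
  have c [simp]: "k \<in> carrier A" "k' \<in> carrier A" "e \<in> carrier A" "f \<in> carrier A"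
    and k'k: "k' \<otimes>\<^bsub>A\<^esub> k = \<one>\<^bsub>A\<^esub>" and kk': "k \<otimes>\<^bsub>A\<^esub> k' = \<one>\<^bsub>A\<^esub>"
    and ke: "k \<otimes>\<^bsub>A\<^esub> e = (q ^ 2) \<odot>\<^bsub>A\<^esub> (e \<otimes>\<^bsub>A\<^esub> k)"
    and kf: "k \<otimes>\<^bsub>A\<^esub> f = inverse (q ^ 2) \<odot>\<^bsub>A\<^esub> (f \<otimes>\<^bsub>A\<^esub> k)"
    and ef: "e \<otimes>\<^bsub>A\<^esub> f = f \<otimes>\<^bsub>A\<^esub> e \<oplus>\<^bsub>A\<^esub> (\<kappa> \<odot>\<^bsub>A\<^esub> k \<oplus>\<^bsub>A\<^esub> (- \<kappa>) \<odot>\<^bsub>A\<^esub> k')"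
    using rel unfolding uq_relations_def \<kappa>_def by simp_all
  have [simp]: "pure_tensor A A a b \<in> carrier (tensor_alg A A)" if "a \<in> carrier A" "b \<in> carrier A" for a b
    using that by (rule pure_tensor_closed[OF A A])
  have ek': "e \<otimes>\<^bsub>A\<^esub> k' = (q ^ 2) \<odot>\<^bsub>A\<^esub> (k' \<otimes>\<^bsub>A\<^esub> e)"
  proof -
    have "e \<otimes>\<^bsub>A\<^esub> k' = k' \<otimes>\<^bsub>A\<^esub> (k \<otimes>\<^bsub>A\<^esub> e) \<otimes>\<^bsub>A\<^esub> k'"
      by (simp add: k'k flip: A.m_assoc)
    also have "\<dots> = (q ^ 2) \<odot>\<^bsub>A\<^esub> (k' \<otimes>\<^bsub>A\<^esub> e \<otimes>\<^bsub>A\<^esub> (k \<otimes>\<^bsub>A\<^esub> k'))"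
      by (simp add: ke A.smult_mult_l A.smult_mult_r A.m_assoc)
    finally show ?thesis by (simp add: kk')
  qed
  have k'f: "k \<otimes>\<^bsub>A\<^esub> k' = k' \<otimes>\<^bsub>A\<^esub> k" by (simp add: k'k kk')
  have cancel: "\<kappa> \<odot>\<^bsub>tensor_alg A A\<^esub> t \<oplus>\<^bsub>tensor_alg A A\<^esub> (- \<kappa>) \<odot>\<^bsub>tensor_alg A A\<^esub> t = \<zero>\<^bsub>tensor_alg A A\<^esub>"
    if "t \<in> carrier (tensor_alg A A)" for t
    using T.smult_l_distr[OF that, of \<kappa> "-\<kappa>"] that by simp
  let ?T = "tensor_alg A A" and ?p = "pure_tensor A A"
  let ?r = "?p f e \<oplus>\<^bsub>?T\<^esub> (?p (f \<otimes>\<^bsub>A\<^esub> e) k \<oplus>\<^bsub>?T\<^esub> (?p k' (f \<otimes>\<^bsub>A\<^esub> e) \<oplus>\<^bsub>?T\<^esub> ?p (k' \<otimes>\<^bsub>A\<^esub> e) (f \<otimes>\<^bsub>A\<^esub> k)))"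
  have fe: "(?p f \<one>\<^bsub>A\<^esub> \<oplus>\<^bsub>?T\<^esub> ?p k' f) \<otimes>\<^bsub>?T\<^esub> (?p \<one>\<^bsub>A\<^esub> e \<oplus>\<^bsub>?T\<^esub> ?p e k) = ?r"
    by (simp add: pt T.l_distr T.r_distr T.a_ac)
  have mixed: "?p (e \<otimes>\<^bsub>A\<^esub> k') (k \<otimes>\<^bsub>A\<^esub> f) = ?p (k' \<otimes>\<^bsub>A\<^esub> e) (f \<otimes>\<^bsub>A\<^esub> k)"
    using q by (simp add: ek' kf pt flip: T.smult_assoc)
  have "(?p \<one>\<^bsub>A\<^esub> e \<oplus>\<^bsub>?T\<^esub> ?p e k) \<otimes>\<^bsub>?T\<^esub> (?p f \<one>\<^bsub>A\<^esub> \<oplus>\<^bsub>?T\<^esub> ?p k' f)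
      = ?p f e \<oplus>\<^bsub>?T\<^esub> (?p (e \<otimes>\<^bsub>A\<^esub> f) k \<oplus>\<^bsub>?T\<^esub> (?p k' (e \<otimes>\<^bsub>A\<^esub> f) \<oplus>\<^bsub>?T\<^esub> ?p (k' \<otimes>\<^bsub>A\<^esub> e) (f \<otimes>\<^bsub>A\<^esub> k)))"
    by (simp add: pt(1) mixed T.l_distr T.r_distr T.a_ac)
  also have "\<dots> = ?r \<oplus>\<^bsub>?T\<^esub> (\<kappa> \<odot>\<^bsub>?T\<^esub> ?p k k \<oplus>\<^bsub>?T\<^esub> (- \<kappa>) \<odot>\<^bsub>?T\<^esub> ?p k' k')
      \<oplus>\<^bsub>?T\<^esub> (\<kappa> \<odot>\<^bsub>?T\<^esub> ?p k' k \<oplus>\<^bsub>?T\<^esub> (- \<kappa>) \<odot>\<^bsub>?T\<^esub> ?p k' k)"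
    by (simp add: ef pt T.a_ac)
  also have "\<dots> = ?r \<oplus>\<^bsub>?T\<^esub> (\<kappa> \<odot>\<^bsub>?T\<^esub> ?p k k \<oplus>\<^bsub>?T\<^esub> (- \<kappa>) \<odot>\<^bsub>?T\<^esub> ?p k' k')"
    by (simp add: cancel)
  finally have comm: "(?p \<one>\<^bsub>A\<^esub> e \<oplus>\<^bsub>?T\<^esub> ?p e k) \<otimes>\<^bsub>?T\<^esub> (?p f \<one>\<^bsub>A\<^esub> \<oplus>\<^bsub>?T\<^esub> ?p k' f)
      = (?p f \<one>\<^bsub>A\<^esub> \<oplus>\<^bsub>?T\<^esub> ?p k' f) \<otimes>\<^bsub>?T\<^esub> (?p \<one>\<^bsub>A\<^esub> e \<oplus>\<^bsub>?T\<^esub> ?p e k)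
        \<oplus>\<^bsub>?T\<^esub> (\<kappa> \<odot>\<^bsub>?T\<^esub> ?p k k \<oplus>\<^bsub>?T\<^esub> (- \<kappa>) \<odot>\<^bsub>?T\<^esub> ?p k' k')"
    unfolding fe .
  show ?thesis
    unfolding uq_relations_def \<kappa>_def[symmetric]
    by (intro conjI comm)
       (simp_all add: pure_tensor_one[OF A A] k'k kk' ke kf pt T.l_distr T.r_distr T.smult_r_distr k'f)
qed

lemma uq_comult_values:
  assumes q: "q \<noteq> 0"
  defines "U \<equiv> uq_alg q"
  defines "T \<equiv> tensor_alg U U"
  shows "alg_map U T (uq_comult q)"
    and "uq_comult q (uq_k q) = pure_tensor U U (uq_k q) (uq_k q)"
    and "uq_comult q (uq_kinv q) = pure_tensor U U (uq_kinv q) (uq_kinv q)"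
    and "uq_comult q (uq_e q) = pure_tensor U U \<one>\<^bsub>U\<^esub> (uq_e q) \<oplus>\<^bsub>T\<^esub> pure_tensor U U (uq_e q) (uq_k q)"
    and "uq_comult q (uq_f q) = pure_tensor U U (uq_f q) \<one>\<^bsub>U\<^esub> \<oplus>\<^bsub>T\<^esub> pure_tensor U U (uq_kinv q) (uq_f q)"
proof -
  define v where "v = (\<lambda>g. case g of
         Gk \<Rightarrow> pure_tensor U U (uq_k q) (uq_k q)
       | Gkinv \<Rightarrow> pure_tensor U U (uq_kinv q) (uq_kinv q)
       | Ge \<Rightarrow> pure_tensor U U \<one>\<^bsub>U\<^esub> (uq_e q) \<oplus>\<^bsub>T\<^esub> pure_tensor U U (uq_e q) (uq_k q)
       | Gf \<Rightarrow> pure_tensor U U (uq_f q) \<one>\<^bsub>U\<^esub> \<oplus>\<^bsub>T\<^esub> pure_tensor U U (uq_kinv q) (uq_f q))"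
  have U: "calg U" unfolding U_def by (rule calg_uq_alg)
  have T: "calg T" unfolding T_def by (rule calg_tensor_alg[OF U U])
  have rel: "uq_relations q T (v Gk) (v Gkinv) (v Ge) (v Gf)"
    using uq_relations_tensor[OF U q] uq_relations_uq_alg unfolding v_def U_def T_def by simp
  then have v: "v g \<in> carrier T" for g
    by (cases g) (simp_all add: uq_relations_def)
  have eq: "uq_comult q = pres_hom (uq_rels q) T v"
    unfolding uq_comult_def v_def U_def T_def Let_def ..
  have "\<forall>r\<in>uq_rels q. free_eval T v r = \<zero>\<^bsub>T\<^esub>"
    using rel by (simp only: uq_relations_iff_eval[OF T v])
  note hom = pres_hom_eval[OF T v bspec[OF this]]
  show "alg_map U T (uq_comult q)"
    unfolding eq U_def uq_alg_def by (rule hom(1))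
  show "uq_comult q (uq_k q) = pure_tensor U U (uq_k q) (uq_k q)"
    and "uq_comult q (uq_kinv q) = pure_tensor U U (uq_kinv q) (uq_kinv q)"
    and "uq_comult q (uq_e q) = pure_tensor U U \<one>\<^bsub>U\<^esub> (uq_e q) \<oplus>\<^bsub>T\<^esub> pure_tensor U U (uq_e q) (uq_k q)"
    and "uq_comult q (uq_f q) = pure_tensor U U (uq_f q) \<one>\<^bsub>U\<^esub> \<oplus>\<^bsub>T\<^esub> pure_tensor U U (uq_kinv q) (uq_f q)"
    unfolding eq by (simp_all add: uq_gen_defs hom(3)) (simp_all add: v_def uq_gen_defs)
qed

lemma uq_counit_values:
  "alg_map (uq_alg q) complex_alg (uq_counit q)"
  "uq_counit q (uq_k q) = 1" "uq_counit q (uq_kinv q) = 1"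
  "uq_counit q (uq_e q) = 0" "uq_counit q (uq_f q) = 0"
proof -
  define v :: "uq_gen \<Rightarrow> complex" where "v = (\<lambda>g. case g of Gk \<Rightarrow> 1 | Gkinv \<Rightarrow> 1 | Ge \<Rightarrow> 0 | Gf \<Rightarrow> 0)"
  have v: "v g \<in> carrier complex_alg" for g by (simp add: complex_alg_def)
  have "\<forall>r\<in>uq_rels q. free_eval complex_alg v r = \<zero>\<^bsub>complex_alg\<^esub>"
    unfolding uq_relations_iff_eval[OF calg_complex_alg v]
    by (simp add: uq_relations_def complex_alg_def v_def)
  note hom = pres_hom_eval[OF calg_complex_alg v bspec[OF this]]
  have eq: "uq_counit q = pres_hom (uq_rels q) complex_alg v"
    unfolding uq_counit_def v_def ..
  show "alg_map (uq_alg q) complex_alg (uq_counit q)"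
    unfolding eq uq_alg_def by (rule hom(1))
  show "uq_counit q (uq_k q) = 1" "uq_counit q (uq_kinv q) = 1"
    "uq_counit q (uq_e q) = 0" "uq_counit q (uq_f q) = 0"
    unfolding eq by (simp_all add: uq_gen_defs hom(3)) (simp_all add: v_def)
qed

section \<open>Module algebra structures as quadruples of operators\<close>

lemma uq_sl2_simps [simp]:
  "carrier (uq_sl2 q) = carrier (uq_alg q)"
  "mult (uq_sl2 q) = mult (uq_alg q)"
  "one (uq_sl2 q) = one (uq_alg q)"
  "zero (uq_sl2 q) = zero (uq_alg q)"
  "add (uq_sl2 q) = add (uq_alg q)"
  "smult (uq_sl2 q) = smult (uq_alg q)"
  "comult (uq_sl2 q) = uq_comult q"
  "counit (uq_sl2 q) = uq_counit q"
  by (simp_all add: uq_sl2_def module.defs hopf.defs)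

lemma alg_map_uq_sl2: "alg_map (uq_sl2 q) B h \<longleftrightarrow> alg_map (uq_alg q) B h"
  by (simp add: alg_map_def lin_map_def)

locale alg_rep = U: calg U + A: calg A
  for U :: "(complex, 'u, 'k) module_scheme" and A :: "(complex, 'a, 'm) module_scheme" and \<pi> +
  assumes hom: "alg_map U (end_alg A) \<pi>"
begin

lemma act_linear: "h \<in> carrier U \<Longrightarrow> lin_map A A (\<pi> h)"
  using alg_map_closed[OF hom] by (simp add: linear_end_iff)

lemma act_closed [simp]: "h \<in> carrier U \<Longrightarrow> a \<in> carrier A \<Longrightarrow> \<pi> h a \<in> carrier A"
  using lin_map_closed[OF act_linear] .

lemma act_add: "h \<in> carrier U \<Longrightarrow> a \<in> carrier A \<Longrightarrow> b \<in> carrier A \<Longrightarrow> \<pi> h (a \<oplus>\<^bsub>A\<^esub> b) = \<pi> h a \<oplus>\<^bsub>A\<^esub> \<pi> h b"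
  using lin_map_add[OF act_linear] .

lemma act_smult: "h \<in> carrier U \<Longrightarrow> a \<in> carrier A \<Longrightarrow> \<pi> h (c \<odot>\<^bsub>A\<^esub> a) = c \<odot>\<^bsub>A\<^esub> \<pi> h a"
  using lin_map_smult[OF act_linear] .

lemma act_one_left: "a \<in> carrier A \<Longrightarrow> \<pi> \<one>\<^bsub>U\<^esub> a = a"
  by (simp add: alg_map_one[OF hom])

lemma act_add_left:
  "h \<in> carrier U \<Longrightarrow> g \<in> carrier U \<Longrightarrow> a \<in> carrier A \<Longrightarrow> \<pi> (h \<oplus>\<^bsub>U\<^esub> g) a = \<pi> h a \<oplus>\<^bsub>A\<^esub> \<pi> g a"
  by (simp add: alg_map_add[OF hom])

lemma act_smult_left: "h \<in> carrier U \<Longrightarrow> a \<in> carrier A \<Longrightarrow> \<pi> (c \<odot>\<^bsub>U\<^esub> h) a = c \<odot>\<^bsub>A\<^esub> \<pi> h a"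
  by (simp add: alg_map_smult[OF hom])

lemma act_mult_left:
  "h \<in> carrier U \<Longrightarrow> g \<in> carrier U \<Longrightarrow> a \<in> carrier A \<Longrightarrow> \<pi> (h \<otimes>\<^bsub>U\<^esub> g) a = \<pi> h (\<pi> g a)"
  by (simp add: alg_map_mult[OF hom] compose_def)

definition bilinear :: "('a \<Rightarrow> 'a \<Rightarrow> 'a) \<Rightarrow> bool" where
  "bilinear \<beta> \<longleftrightarrow> (\<forall>a\<in>carrier A. lin_map A A (\<beta> a)) \<and> (\<forall>b\<in>carrier A. lin_map A A (\<lambda>a. \<beta> a b))"

abbreviation tensor_val :: "('a \<Rightarrow> 'a \<Rightarrow> 'a) \<Rightarrow> 'a \<Rightarrow> 'a \<Rightarrow> 'u \<times> 'u \<Rightarrow> 'a" where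
  "tensor_val \<beta> a b \<equiv> (\<lambda>w. \<beta> (\<pi> (fst w) a) (\<pi> (snd w) b))"

lemma bilinearD:
  assumes "bilinear \<beta>"
  shows "a \<in> carrier A \<Longrightarrow> b \<in> carrier A \<Longrightarrow> \<beta> a b \<in> carrier A"
    and "a \<in> carrier A \<Longrightarrow> a' \<in> carrier A \<Longrightarrow> b \<in> carrier A \<Longrightarrow> \<beta> (a \<oplus>\<^bsub>A\<^esub> a') b = \<beta> a b \<oplus>\<^bsub>A\<^esub> \<beta> a' b"
    and "a \<in> carrier A \<Longrightarrow> b \<in> carrier A \<Longrightarrow> b' \<in> carrier A \<Longrightarrow> \<beta> a (b \<oplus>\<^bsub>A\<^esub> b') = \<beta> a b \<oplus>\<^bsub>A\<^esub> \<beta> a b'"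
    and "a \<in> carrier A \<Longrightarrow> b \<in> carrier A \<Longrightarrow> \<beta> (c \<odot>\<^bsub>A\<^esub> a) b = c \<odot>\<^bsub>A\<^esub> \<beta> a b"
    and "a \<in> carrier A \<Longrightarrow> b \<in> carrier A \<Longrightarrow> \<beta> a (c \<odot>\<^bsub>A\<^esub> b) = c \<odot>\<^bsub>A\<^esub> \<beta> a b"
proof -
  have l: "lin_map A A (\<lambda>a. \<beta> a b)" if "b \<in> carrier A" for b using assms that by (simp add: bilinear_def)
  have r: "lin_map A A (\<beta> a)" if "a \<in> carrier A" for a using assms that by (simp add: bilinear_def)
  show "a \<in> carrier A \<Longrightarrow> b \<in> carrier A \<Longrightarrow> \<beta> a b \<in> carrier A"
    by (rule lin_map_closed[OF r])
  show "a \<in> carrier A \<Longrightarrow> a' \<in> carrier A \<Longrightarrow> b \<in> carrier A \<Longrightarrow> \<beta> (a \<oplus>\<^bsub>A\<^esub> a') b = \<beta> a b \<oplus>\<^bsub>A\<^esub> \<beta> a' b"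
    using lin_map_add[OF l] by simp
  show "a \<in> carrier A \<Longrightarrow> b \<in> carrier A \<Longrightarrow> b' \<in> carrier A \<Longrightarrow> \<beta> a (b \<oplus>\<^bsub>A\<^esub> b') = \<beta> a b \<oplus>\<^bsub>A\<^esub> \<beta> a b'"
    using lin_map_add[OF r] by simp
  show "a \<in> carrier A \<Longrightarrow> b \<in> carrier A \<Longrightarrow> \<beta> (c \<odot>\<^bsub>A\<^esub> a) b = c \<odot>\<^bsub>A\<^esub> \<beta> a b"
    using lin_map_smult[OF l] by simp
  show "a \<in> carrier A \<Longrightarrow> b \<in> carrier A \<Longrightarrow> \<beta> a (c \<odot>\<^bsub>A\<^esub> b) = c \<odot>\<^bsub>A\<^esub> \<beta> a b"
    using lin_map_smult[OF r] by simp
qed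

lemma bilinear_mult: "bilinear (\<lambda>a b. a \<otimes>\<^bsub>A\<^esub> b)"
  by (simp add: bilinear_def lin_mapI A.l_distr A.r_distr A.smult_mult_l A.smult_mult_r)

lemma bilinear_act:
  assumes \<beta>: "bilinear \<beta>" and u: "u \<in> carrier U" "v \<in> carrier U"
  shows "bilinear (\<lambda>a b. \<beta> (\<pi> u a) (\<pi> v b))"
  unfolding bilinear_def
  by (intro conjI ballI lin_mapI) (use u in \<open>simp_all add: bilinearD[OF \<beta>] act_add act_smult\<close>)

abbreviation (input) "UU \<equiv> monoid_alg (U \<times>\<times> U)"

lemma tensor_val_closed:
  assumes "bilinear \<beta>" "a \<in> carrier A" "b \<in> carrier A" "S \<subseteq> carrier U \<times> carrier U"
  shows "tensor_val \<beta> a b \<in> S \<rightarrow> carrier A"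
  using assms by (force intro!: bilinearD(1)[OF assms(1)])

lemma lin_ext_tensor_val_mult:
  assumes \<beta>: "bilinear \<beta>" and s: "s \<in> carrier UU" and t: "t \<in> carrier UU"
    and ab: "a \<in> carrier A" "b \<in> carrier A"
  shows "lin_ext A (tensor_val \<beta> a b) (s \<otimes>\<^bsub>UU\<^esub> t)
    = lin_ext A (\<lambda>u. lin_ext A (tensor_val (\<lambda>c d. \<beta> (\<pi> (fst u) c) (\<pi> (snd u) d)) a b) t) s"
proof -
  have st: "keys s \<subseteq> carrier U \<times> carrier U" "keys t \<subseteq> carrier U \<times> carrier U"
    using s t by (simp_all add: pair_alg_simps[OF U.calg_axioms U.calg_axioms])
  have "lin_ext A (tensor_val \<beta> a b) (s \<otimes>\<^bsub>UU\<^esub> t)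
      = lin_ext A (\<lambda>u. lin_ext A (\<lambda>v. tensor_val \<beta> a b (u \<otimes>\<^bsub>U \<times>\<times> U\<^esub> v)) t) s"
    by (rule A.lin_ext_monoid_alg_mult[OF s t DirProd_monoid[OF U.monoid_axioms U.monoid_axioms]])
       (rule tensor_val_closed[OF \<beta> ab], simp add: DirProd_def)
  also have "\<dots> = lin_ext A (\<lambda>u. lin_ext A (tensor_val (\<lambda>c d. \<beta> (\<pi> (fst u) c) (\<pi> (snd u) d)) a b) t) s"
  proof (rule A.lin_ext_cong)
    fix u assume "u \<in> keys s"
    then have u: "fst u \<in> carrier U" "snd u \<in> carrier U" using st(1) by auto
    have c: "tensor_val (\<lambda>c d. \<beta> (\<pi> (fst u) c) (\<pi> (snd u) d)) a b \<in> keys t \<rightarrow> carrier A"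
      by (rule tensor_val_closed[OF bilinear_act[OF \<beta> u] ab st(2)])
    show "lin_ext A (\<lambda>v. tensor_val \<beta> a b (u \<otimes>\<^bsub>U \<times>\<times> U\<^esub> v)) t
        = lin_ext A (tensor_val (\<lambda>c d. \<beta> (\<pi> (fst u) c) (\<pi> (snd u) d)) a b) t"
    proof (rule A.lin_ext_cong[OF _ c])
      fix v assume "v \<in> keys t"
      then have v: "fst v \<in> carrier U" "snd v \<in> carrier U" using st(2) by auto
      show "tensor_val \<beta> a b (u \<otimes>\<^bsub>U \<times>\<times> U\<^esub> v) = tensor_val (\<lambda>c d. \<beta> (\<pi> (fst u) c) (\<pi> (snd u) d)) a b v"
        using u v ab by (simp add: DirProd_def case_prod_beta act_mult_left)
    qed
  next
    show "(\<lambda>u. lin_ext A (tensor_val (\<lambda>c d. \<beta> (\<pi> (fst u) c) (\<pi> (snd u) d)) a b) t)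
        \<in> keys s \<rightarrow> carrier A"
    proof (rule Pi_I)
      fix u assume "u \<in> keys s"
      then have u: "fst u \<in> carrier U" "snd u \<in> carrier U" using st(1) by auto
      show "lin_ext A (tensor_val (\<lambda>c d. \<beta> (\<pi> (fst u) c) (\<pi> (snd u) d)) a b) t \<in> carrier A"
        by (rule A.lin_ext_closed[OF tensor_val_closed[OF bilinear_act[OF \<beta> u] ab st(2)]])
    qed
  qed
  finally show ?thesis .
qed

lemma lin_ext_tensor_val_mult':
  assumes \<beta>: "bilinear \<beta>" and s: "s \<in> carrier UU" and t: "t \<in> carrier UU"
    and ab: "a \<in> carrier A" "b \<in> carrier A"
  shows "lin_ext A (tensor_val \<beta> a b) (s \<otimes>\<^bsub>UU\<^esub> t)
    = lin_ext A (\<lambda>v. lin_ext A (tensor_val \<beta> (\<pi> (fst v) a) (\<pi> (snd v) b)) s) t"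
proof -
  have st: "keys s \<subseteq> carrier U \<times> carrier U" "keys t \<subseteq> carrier U \<times> carrier U"
    using s t by (simp_all add: pair_alg_simps[OF U.calg_axioms U.calg_axioms])
  show ?thesis
    unfolding lin_ext_tensor_val_mult[OF assms]
    by (rule A.lin_ext_swap[OF st]) (use ab in \<open>auto intro!: bilinearD(1)[OF \<beta>]\<close>)
qed

text \<open>
  The elements of the algebra of pairs that every bilinear map, evaluated through the action,
  sends to zero.  Quantifying over all bilinear maps instead of the multiplication alone makes this
  set a left ideal: multiplying from the left by \<open>(u, v)\<close> replaces \<open>\<beta>(a, b)\<close> by
  \<open>\<beta>(ua, vb)\<close>, which is bilinear but no longer the multiplication.
\<close>

definition tensor_null :: "(('u \<times> 'u) \<Rightarrow>\<^sub>0 complex) set" where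
  "tensor_null = {t \<in> carrier UU. \<forall>\<beta> a b. bilinear \<beta> \<longrightarrow> a \<in> carrier A \<longrightarrow> b \<in> carrier A \<longrightarrow>
     lin_ext A (tensor_val \<beta> a b) t = \<zero>\<^bsub>A\<^esub>}"

lemma ideal_tensor_null: "ideal tensor_null UU"
proof -
  interpret P: calg UU by (rule calg_pair_alg[OF U.calg_axioms U.calg_axioms])
  note P = pair_alg_simps[OF U.calg_axioms U.calg_axioms]
  have add: "lin_ext A (tensor_val \<beta> a b) (s + t)
      = lin_ext A (tensor_val \<beta> a b) s \<oplus>\<^bsub>A\<^esub> lin_ext A (tensor_val \<beta> a b) t"
    if "s \<in> carrier UU" "t \<in> carrier UU" "bilinear \<beta>" "a \<in> carrier A" "b \<in> carrier A" for s t \<beta> a b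
    using that by (intro A.lin_ext_add[OF tensor_val_closed[OF _ _ _ order_refl]]) (simp_all add: P)
  have scale: "lin_ext A (tensor_val \<beta> a b) (scale c s)
      = c \<odot>\<^bsub>A\<^esub> lin_ext A (tensor_val \<beta> a b) s"
    if "s \<in> carrier UU" "bilinear \<beta>" "a \<in> carrier A" "b \<in> carrier A" for s \<beta> a b c
    using that by (intro A.lin_ext_scale tensor_val_closed) (simp_all add: P)
  show ?thesis
  proof (rule idealI[OF P.ring_axioms])
    show "subgroup tensor_null (add_monoid UU)"
    proof (rule P.add.subgroupI)
      show "tensor_null \<subseteq> carrier UU" by (auto simp: tensor_null_def)
      have "\<zero>\<^bsub>UU\<^esub> \<in> tensor_null" using P.zero_closed by (simp add: tensor_null_def P)
      then show "tensor_null \<noteq> {}" by blast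
    next
      fix s assume s: "s \<in> tensor_null"
      then have c: "s \<in> carrier UU" by (simp add: tensor_null_def)
      have "(-1) \<odot>\<^bsub>UU\<^esub> s \<in> tensor_null"
        using s P.smult_closed[OF c, of "-1"] by (simp add: tensor_null_def P(5) scale[OF c])
      then show "\<ominus>\<^bsub>UU\<^esub> s \<in> tensor_null" using P.minus_eq_smult[OF c] by simp
    next
      fix s t assume st: "s \<in> tensor_null" "t \<in> tensor_null"
      then have c: "s \<in> carrier UU" "t \<in> carrier UU" by (simp_all add: tensor_null_def)
      show "s \<oplus>\<^bsub>UU\<^esub> t \<in> tensor_null"
        using st P.a_closed[OF c] by (simp add: tensor_null_def P(4) add[OF c])
    qed
  next
    fix s t assume t: "t \<in> tensor_null" and s: "s \<in> carrier UU"
    have tc: "t \<in> carrier UU" using t by (simp add: tensor_null_def)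
    show "s \<otimes>\<^bsub>UU\<^esub> t \<in> tensor_null"
      unfolding tensor_null_def
    proof (intro CollectI conjI allI impI P.m_closed s tc)
      fix \<beta> a b assume \<beta>: "bilinear \<beta>" and ab: "a \<in> carrier A" "b \<in> carrier A"
      show "lin_ext A (tensor_val \<beta> a b) (s \<otimes>\<^bsub>UU\<^esub> t) = \<zero>\<^bsub>A\<^esub>"
        unfolding lin_ext_tensor_val_mult[OF \<beta> s tc ab]
      proof (rule A.lin_ext_const_zero)
        fix u assume "u \<in> keys s"
        then have "fst u \<in> carrier U" "snd u \<in> carrier U" using s by (auto simp: P)
        then show "lin_ext A (tensor_val (\<lambda>c d. \<beta> (\<pi> (fst u) c) (\<pi> (snd u) d)) a b) t = \<zero>\<^bsub>A\<^esub>"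
          using t bilinear_act[OF \<beta>] ab unfolding tensor_null_def by blast
      qed
    qed
    show "t \<otimes>\<^bsub>UU\<^esub> s \<in> tensor_null"
      unfolding tensor_null_def
    proof (intro CollectI conjI allI impI P.m_closed s tc)
      fix \<beta> a b assume \<beta>: "bilinear \<beta>" and ab: "a \<in> carrier A" "b \<in> carrier A"
      show "lin_ext A (tensor_val \<beta> a b) (t \<otimes>\<^bsub>UU\<^esub> s) = \<zero>\<^bsub>A\<^esub>"
        unfolding lin_ext_tensor_val_mult'[OF \<beta> tc s ab]
      proof (rule A.lin_ext_const_zero)
        fix v assume "v \<in> keys s"
        then have "\<pi> (fst v) a \<in> carrier A" "\<pi> (snd v) b \<in> carrier A" using s ab by (auto simp: P)
        then show "lin_ext A (tensor_val \<beta> (\<pi> (fst v) a) (\<pi> (snd v) b)) t = \<zero>\<^bsub>A\<^esub>"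
          using t \<beta> unfolding tensor_null_def by blast
      qed
    qed
  qed
qed

lemma tensor_rels_null: "tensor_rels U U \<subseteq> tensor_null"
proof
  fix r assume r: "r \<in> tensor_rels U U"
  then have rc: "r \<in> carrier UU" using tensor_rels_closed[OF U.calg_axioms U.calg_axioms] by blast
  show "r \<in> tensor_null"
    unfolding tensor_null_def
  proof (intro CollectI conjI allI impI rc)
    fix \<beta> a b assume \<beta>: "bilinear \<beta>" and ab: "a \<in> carrier A" "b \<in> carrier A"
    note diff = A.lin_ext_diff[OF tensor_val_closed[OF \<beta> ab order_refl]]
    have keys: "keys (single u (1::complex) - single v 1)
        \<subseteq> carrier U \<times> carrier U" if "u \<in> carrier U \<times> carrier U" "v \<in> carrier U \<times> carrier U" for u v
      using that keys_diff[of "single u (1::complex)" "single v 1"] by auto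
    have s: "lin_ext A (tensor_val \<beta> a b) (single (u, v) c) = c \<odot>\<^bsub>A\<^esub> \<beta> (\<pi> u a) (\<pi> v b)"
      if "u \<in> carrier U" "v \<in> carrier U" for u v c
      using that ab by (simp add: bilinearD(1)[OF \<beta>])
    have [simp]: "\<beta> (\<pi> u a) (\<pi> v b) \<in> carrier A" if "u \<in> carrier U" "v \<in> carrier U" for u v
      using that ab by (simp add: bilinearD(1)[OF \<beta>])
    have cancel: "x \<oplus>\<^bsub>A\<^esub> y \<oplus>\<^bsub>A\<^esub> (-1) \<odot>\<^bsub>A\<^esub> x \<oplus>\<^bsub>A\<^esub> (-1) \<odot>\<^bsub>A\<^esub> y = \<zero>\<^bsub>A\<^esub>"
      if "x \<in> carrier A" "y \<in> carrier A" for x y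
      using that A.add_neg_eq_zero_iff[of "x \<oplus>\<^bsub>A\<^esub> y" "x \<oplus>\<^bsub>A\<^esub> y"]
      by (simp add: A.smult_r_distr A.a_assoc)
    from r show "lin_ext A (tensor_val \<beta> a b) r = \<zero>\<^bsub>A\<^esub>"
      unfolding tensor_rels_def
    proof (elim UnE CollectE exE conjE)
      fix u u' v assume "r = single (u \<oplus>\<^bsub>U\<^esub> u', v) 1 - single (u, v) 1
        - single (u', v) 1" and c: "u \<in> carrier U" "u' \<in> carrier U" "v \<in> carrier U"
      then show ?thesis using ab
        by (simp add: diff keys s act_add_left bilinearD[OF \<beta>] cancel del: A.lin_ext_single)
    next
      fix u v v' assume "r = single (u, v \<oplus>\<^bsub>U\<^esub> v') 1 - single (u, v) 1
        - single (u, v') 1" and c: "u \<in> carrier U" "v \<in> carrier U" "v' \<in> carrier U"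
      then show ?thesis using ab
        by (simp add: diff keys s act_add_left bilinearD[OF \<beta>] cancel del: A.lin_ext_single)
    next
      fix c u v assume "r = single (c \<odot>\<^bsub>U\<^esub> u, v) 1 - single (u, v) c"
        and "u \<in> carrier U" "v \<in> carrier U"
      then show ?thesis using ab
        by (simp add: diff keys s act_smult_left bilinearD[OF \<beta>] A.add_neg_eq_zero_iff del: A.lin_ext_single)
    next
      fix c u v assume "r = single (u, c \<odot>\<^bsub>U\<^esub> v) 1 - single (u, v) c"
        and "u \<in> carrier U" "v \<in> carrier U"
      then show ?thesis using ab
        by (simp add: diff keys s act_smult_left bilinearD[OF \<beta>] A.add_neg_eq_zero_iff del: A.lin_ext_single)
    qed
  qed
qed

abbreviation (input) "coset t \<equiv> Idl\<^bsub>UU\<^esub> (tensor_rels U U) +>\<^bsub>UU\<^esub> t"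

abbreviation "mult_val \<equiv> tensor_val (\<lambda>a b. a \<otimes>\<^bsub>A\<^esub> b)"

text \<open>
  The product rule quantifies over all representatives of \<open>\<Delta>(h)\<close>; this allows checking it on one.
\<close>

lemma mult_val_coset:
  assumes s: "s \<in> carrier UU" and t: "t \<in> carrier UU" and eq: "coset s = coset t"
    and ab: "a \<in> carrier A" "b \<in> carrier A"
  shows "lin_ext A (mult_val a b) s = lin_ext A (mult_val a b) t"
proof -
  interpret P: calg UU by (rule calg_pair_alg[OF U.calg_axioms U.calg_axioms])
  note P = pair_alg_simps[OF U.calg_axioms U.calg_axioms]
  have keys: "keys s \<subseteq> carrier U \<times> carrier U" "keys t \<subseteq> carrier U \<times> carrier U"
    using s t by (simp_all add: P)
  have "s \<oplus>\<^bsub>UU\<^esub> (-1) \<odot>\<^bsub>UU\<^esub> t \<in> Idl\<^bsub>UU\<^esub> (tensor_rels U U)"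
    using coset_eq_iff[OF P.calg_axioms ideal_bilin_ideal[OF U.calg_axioms U.calg_axioms] s t] eq by simp
  also have "\<dots> \<subseteq> tensor_null"
    by (rule P.genideal_minimal[OF ideal_tensor_null tensor_rels_null])
  finally have "s - t \<in> tensor_null" by (simp add: P diff_eq_scale)
  then have "lin_ext A (mult_val a b) (s - t) = \<zero>\<^bsub>A\<^esub>"
    using bilinear_mult ab unfolding tensor_null_def by blast
  moreover have "lin_ext A (mult_val a b) (s - t)
      = lin_ext A (mult_val a b) s \<oplus>\<^bsub>A\<^esub> (-1) \<odot>\<^bsub>A\<^esub> lin_ext A (mult_val a b) t"
    by (rule A.lin_ext_diff[OF tensor_val_closed[OF bilinear_mult ab order_refl] keys])
  ultimately show ?thesis
    using A.add_neg_eq_zero_iff[OF A.lin_ext_closed[OF tensor_val_closed[OF bilinear_mult ab keys(1)]]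
        A.lin_ext_closed[OF tensor_val_closed[OF bilinear_mult ab keys(2)]]] by simp
qed

end

text \<open>
  What a module algebra structure amounts to on the generators \<open>k\<close>, \<open>k\<^sup>-\<^sup>1\<close>, \<open>e\<close> and \<open>f\<close>.
\<close>

locale sl2_action = calg A for A (structure) +
  fixes q :: complex and K K' E F
  assumes linear: "lin_map A A K" "lin_map A A K'" "lin_map A A E" "lin_map A A F"
    and K'K: "a \<in> carrier A \<Longrightarrow> K' (K a) = a"
    and KK': "a \<in> carrier A \<Longrightarrow> K (K' a) = a"
    and KE: "a \<in> carrier A \<Longrightarrow> K (E a) = (q ^ 2) \<odot> E (K a)"
    and KF: "a \<in> carrier A \<Longrightarrow> K (F a) = inverse (q ^ 2) \<odot> F (K a)"
    and EF: "a \<in> carrier A \<Longrightarrow> E (F a) =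
      F (E a) \<oplus> ((1 / (q - inverse q)) \<odot> K a \<oplus> (- (1 / (q - inverse q))) \<odot> K' a)"
    and K_mult: "a \<in> carrier A \<Longrightarrow> b \<in> carrier A \<Longrightarrow> K (a \<otimes> b) = K a \<otimes> K b"
    and K'_mult: "a \<in> carrier A \<Longrightarrow> b \<in> carrier A \<Longrightarrow> K' (a \<otimes> b) = K' a \<otimes> K' b"
    and E_mult: "a \<in> carrier A \<Longrightarrow> b \<in> carrier A \<Longrightarrow> E (a \<otimes> b) = a \<otimes> E b \<oplus> E a \<otimes> K b"
    and F_mult: "a \<in> carrier A \<Longrightarrow> b \<in> carrier A \<Longrightarrow> F (a \<otimes> b) = F a \<otimes> b \<oplus> K' a \<otimes> F b"
    and K_one: "K \<one> = \<one>" and K'_one: "K' \<one> = \<one>" and E_one: "E \<one> = \<zero>" and F_one: "F \<one> = \<zero>"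

lemma comult_rep:
  assumes q: "q \<noteq> 0" and h: "h \<in> carrier (uq_alg q)"
  defines "U \<equiv> uq_alg q"
  shows "t \<in> uq_comult q h \<longleftrightarrow> t \<in> carrier (monoid_alg (U \<times>\<times> U)) \<and>
     uq_comult q h = Idl\<^bsub>monoid_alg (U \<times>\<times> U)\<^esub> (tensor_rels U U) +>\<^bsub>monoid_alg (U \<times>\<times> U)\<^esub> t"
proof -
  have U: "calg U" unfolding U_def by (rule calg_uq_alg)
  interpret P: calg "monoid_alg (U \<times>\<times> U)" by (rule calg_pair_alg[OF U U])
  interpret I: ideal "Idl\<^bsub>monoid_alg (U \<times>\<times> U)\<^esub> (tensor_rels U U)" "monoid_alg (U \<times>\<times> U)"
    by (rule ideal_bilin_ideal[OF U U])
  have "uq_comult q h \<in> carrier (tensor_alg U U)"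
    using alg_map_closed[OF uq_comult_values(1)[OF q] h] by (simp add: U_def)
  then obtain s where s: "s \<in> carrier (monoid_alg (U \<times>\<times> U))"
    "uq_comult q h = Idl\<^bsub>monoid_alg (U \<times>\<times> U)\<^esub> (tensor_rels U U) +>\<^bsub>monoid_alg (U \<times>\<times> U)\<^esub> s"
    unfolding tensor_alg_def by (auto simp: quot_alg_simps[OF P.calg_axioms I.ideal_axioms])
  show ?thesis
    using I.a_repr_independence'[OF _ s(1), of t] I.a_elemrcos_carrier[OF s(1), of t] I.a_rcos_self[of t] s(2)
    by auto
qed

lemma module_alg_structuresD:
  assumes A: "calg A" and q: "q \<noteq> 0" and \<pi>: "\<pi> \<in> module_alg_structures (uq_sl2 q) A"
  shows "alg_rep (uq_alg q) A \<pi>"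
    and "sl2_action A q (\<pi> (uq_k q)) (\<pi> (uq_kinv q)) (\<pi> (uq_e q)) (\<pi> (uq_f q))"
proof -
  interpret A: calg A by fact
  show rep: "alg_rep (uq_alg q) A \<pi>"
    using \<pi> by (intro alg_rep.intro A calg_uq_alg alg_rep_axioms.intro)
      (simp add: module_alg_structures_def alg_hom_iff alg_map_uq_sl2)
  interpret alg_rep "uq_alg q" A \<pi> by (rule rep)
  let ?U = "uq_alg q"
  let ?UU = "monoid_alg (?U \<times>\<times> ?U)"
  interpret P: calg ?UU by (rule calg_pair_alg[OF calg_uq_alg calg_uq_alg])
  interpret I: ideal "Idl\<^bsub>?UU\<^esub> (tensor_rels ?U ?U)" ?UU
    by (rule ideal_bilin_ideal[OF calg_uq_alg calg_uq_alg])
  note P = pair_alg_simps[OF calg_uq_alg[of q] calg_uq_alg[of q]]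
  have c [simp]: "uq_k q \<in> carrier ?U" "uq_kinv q \<in> carrier ?U" "uq_e q \<in> carrier ?U" "uq_f q \<in> carrier ?U"
    and rel: "uq_kinv q \<otimes>\<^bsub>?U\<^esub> uq_k q = \<one>\<^bsub>?U\<^esub>" "uq_k q \<otimes>\<^bsub>?U\<^esub> uq_kinv q = \<one>\<^bsub>?U\<^esub>"
      "uq_k q \<otimes>\<^bsub>?U\<^esub> uq_e q = (q ^ 2) \<odot>\<^bsub>?U\<^esub> (uq_e q \<otimes>\<^bsub>?U\<^esub> uq_k q)"
      "uq_k q \<otimes>\<^bsub>?U\<^esub> uq_f q = inverse (q ^ 2) \<odot>\<^bsub>?U\<^esub> (uq_f q \<otimes>\<^bsub>?U\<^esub> uq_k q)"
      "uq_e q \<otimes>\<^bsub>?U\<^esub> uq_f q = uq_f q \<otimes>\<^bsub>?U\<^esub> uq_e q \<oplus>\<^bsub>?U\<^esub>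
        ((1 / (q - inverse q)) \<odot>\<^bsub>?U\<^esub> uq_k q \<oplus>\<^bsub>?U\<^esub> (- (1 / (q - inverse q))) \<odot>\<^bsub>?U\<^esub> uq_kinv q)"
    using uq_relations_uq_alg[of q] unfolding uq_relations_def by simp_all
  have counit: "\<pi> h \<one>\<^bsub>A\<^esub> = uq_counit q h \<odot>\<^bsub>A\<^esub> \<one>\<^bsub>A\<^esub>" if "h \<in> carrier ?U" for h
    using \<pi> that by (simp add: module_alg_structures_def)
  have prod: "\<pi> h (a \<otimes>\<^bsub>A\<^esub> b) = lin_ext A (mult_val a b) t"
    if "h \<in> carrier ?U" "t \<in> uq_comult q h" "a \<in> carrier A" "b \<in> carrier A" for h t a b
    using \<pi> that unfolding module_alg_structures_def lin_ext_def by simp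
  have rep1: "single (u, v) 1 \<in> pure_tensor ?U ?U u v"
    if "u \<in> carrier ?U" "v \<in> carrier ?U" for u v
    unfolding pure_tensor_def using that by (intro I.a_rcos_self) (simp add: P)
  have rep2: "single (u, v) 1 + single (u', v') 1
      \<in> pure_tensor ?U ?U u v \<oplus>\<^bsub>tensor_alg ?U ?U\<^esub> pure_tensor ?U ?U u' v'"
    if "u \<in> carrier ?U" "v \<in> carrier ?U" "u' \<in> carrier ?U" "v' \<in> carrier ?U" for u v u' v'
  proof -
    let ?s = "single (u, v) (1::complex)" and ?t = "single (u', v') (1::complex)"
    have st: "?s \<in> carrier ?UU" "?t \<in> carrier ?UU" using that by (simp_all add: P)
    have "pure_tensor ?U ?U u v \<oplus>\<^bsub>tensor_alg ?U ?U\<^esub> pure_tensor ?U ?U u' v'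
        = coset (?s \<oplus>\<^bsub>?UU\<^esub> ?t)"
      unfolding pure_tensor_def
      by (rule alg_map_add[OF alg_map_tensor_coset[OF calg_uq_alg calg_uq_alg] st, symmetric])
    then show ?thesis using I.a_rcos_self[OF P.a_closed[OF st]] by (simp add: P)
  qed
  have val2: "lin_ext A (mult_val a b) (single (u, v) 1 + single (u', v') 1)
      = \<pi> u a \<otimes>\<^bsub>A\<^esub> \<pi> v b \<oplus>\<^bsub>A\<^esub> \<pi> u' a \<otimes>\<^bsub>A\<^esub> \<pi> v' b"
    if "u \<in> carrier ?U" "v \<in> carrier ?U" "u' \<in> carrier ?U" "v' \<in> carrier ?U" "a \<in> carrier A" "b \<in> carrier A"
    for u v u' v' a b
    using that by (subst A.lin_ext_add[OF tensor_val_closed[OF bilinear_mult _ _ order_refl]]) simp_all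
  note \<Delta> = uq_comult_values[OF q]
  show "sl2_action A q (\<pi> (uq_k q)) (\<pi> (uq_kinv q)) (\<pi> (uq_e q)) (\<pi> (uq_f q))"
  proof (intro sl2_action.intro A sl2_action_axioms.intro)
    fix a assume a: "a \<in> carrier A"
    show "\<pi> (uq_kinv q) (\<pi> (uq_k q) a) = a" "\<pi> (uq_k q) (\<pi> (uq_kinv q) a) = a"
      using a by (simp_all add: rel act_one_left flip: act_mult_left)
    show "\<pi> (uq_k q) (\<pi> (uq_e q) a) = (q ^ 2) \<odot>\<^bsub>A\<^esub> \<pi> (uq_e q) (\<pi> (uq_k q) a)"
      "\<pi> (uq_k q) (\<pi> (uq_f q) a) = inverse (q ^ 2) \<odot>\<^bsub>A\<^esub> \<pi> (uq_f q) (\<pi> (uq_k q) a)"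
      using a act_smult_left[of "uq_e q \<otimes>\<^bsub>?U\<^esub> uq_k q" a] act_smult_left[of "uq_f q \<otimes>\<^bsub>?U\<^esub> uq_k q" a]
      by (simp_all add: rel flip: act_mult_left)
    show "\<pi> (uq_e q) (\<pi> (uq_f q) a) = \<pi> (uq_f q) (\<pi> (uq_e q) a) \<oplus>\<^bsub>A\<^esub>
        ((1 / (q - inverse q)) \<odot>\<^bsub>A\<^esub> \<pi> (uq_k q) a \<oplus>\<^bsub>A\<^esub> (- (1 / (q - inverse q))) \<odot>\<^bsub>A\<^esub> \<pi> (uq_kinv q) a)"
      using a arg_cong[OF rel(5), of "\<lambda>h. \<pi> h a"]
      by (simp add: act_mult_left act_add_left act_smult_left)
  next
    fix a b assume ab: "a \<in> carrier A" "b \<in> carrier A"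
    show "\<pi> (uq_k q) (a \<otimes>\<^bsub>A\<^esub> b) = \<pi> (uq_k q) a \<otimes>\<^bsub>A\<^esub> \<pi> (uq_k q) b"
      using prod[OF _ rep1[of "uq_k q" "uq_k q", folded \<Delta>(2)] ab] ab by simp
    show "\<pi> (uq_kinv q) (a \<otimes>\<^bsub>A\<^esub> b) = \<pi> (uq_kinv q) a \<otimes>\<^bsub>A\<^esub> \<pi> (uq_kinv q) b"
      using prod[OF _ rep1[of "uq_kinv q" "uq_kinv q", folded \<Delta>(3)] ab] ab by simp
    show "\<pi> (uq_e q) (a \<otimes>\<^bsub>A\<^esub> b) = a \<otimes>\<^bsub>A\<^esub> \<pi> (uq_e q) b \<oplus>\<^bsub>A\<^esub> \<pi> (uq_e q) a \<otimes>\<^bsub>A\<^esub> \<pi> (uq_k q) b"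
      using prod[OF _ rep2[of "\<one>\<^bsub>?U\<^esub>" "uq_e q" "uq_e q" "uq_k q", folded \<Delta>(4)] ab] ab
      by (simp add: val2 act_one_left)
    show "\<pi> (uq_f q) (a \<otimes>\<^bsub>A\<^esub> b) = \<pi> (uq_f q) a \<otimes>\<^bsub>A\<^esub> b \<oplus>\<^bsub>A\<^esub> \<pi> (uq_kinv q) a \<otimes>\<^bsub>A\<^esub> \<pi> (uq_f q) b"
      using prod[OF _ rep2[of "uq_f q" "\<one>\<^bsub>?U\<^esub>" "uq_kinv q" "uq_f q", folded \<Delta>(5)] ab] ab
      by (simp add: val2 act_one_left)
  qed (simp_all add: act_linear counit uq_counit_values)
qed

text \<open>
  The four operators satisfy the defining relations in the endomorphism algebra and thus extend to
  an action.  The elements of the quantum group that obey the product rule form a subalgebra,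
  because the coproduct is multiplicative, and this subalgebra contains the generators.
\<close>

lemma (in sl2_action) structure_exists:
  assumes q: "q \<noteq> 0"
  shows "\<exists>\<pi>\<in>module_alg_structures (uq_sl2 q) A. \<forall>a\<in>carrier A.
    \<pi> (uq_k q) a = K a \<and> \<pi> (uq_kinv q) a = K' a \<and> \<pi> (uq_e q) a = E a \<and> \<pi> (uq_f q) a = F a"
proof -
  let ?U = "uq_alg q" and ?r = "\<lambda>G. restrict G (carrier A)"
  let ?UU = "monoid_alg (?U \<times>\<times> ?U)"
  define v where "v = (\<lambda>g. case g of Gk \<Rightarrow> ?r K | Gkinv \<Rightarrow> ?r K' | Ge \<Rightarrow> ?r E | Gf \<Rightarrow> ?r F)"
  note closed [simp] = linear[THEN lin_map_closed]
  have v: "v g \<in> carrier (end_alg A)" for g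
    using linear by (cases g) (auto simp: v_def linear_end_iff lin_map_def)
  have "uq_relations q (end_alg A) (?r K) (?r K') (?r E) (?r F)"
    using v[of Gk] v[of Gkinv] v[of Ge] v[of Gf] unfolding uq_relations_def
    by (auto simp: v_def compose_def K'K KK' KE KF EF intro!: restrict_ext)
  then have "\<forall>r\<in>uq_rels q. free_eval (end_alg A) v r = \<zero>\<^bsub>end_alg A\<^esub>"
    unfolding uq_relations_iff_eval[OF calg_end_alg[OF calg_axioms] v] by (simp add: v_def)
  note hom = pres_hom_eval[OF calg_end_alg[OF calg_axioms] v bspec[OF this]]
  define \<pi> where "\<pi> = pres_hom (uq_rels q) (end_alg A) v"
  have \<pi>1: "alg_map ?U (end_alg A) \<pi>"
    unfolding \<pi>_def uq_alg_def by (rule hom(1))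
  have \<pi>2: "\<pi> \<in> extensional (carrier ?U)"
    unfolding \<pi>_def uq_alg_def by (rule hom(2))
  have gens: "\<pi> (uq_k q) = ?r K" "\<pi> (uq_kinv q) = ?r K'" "\<pi> (uq_e q) = ?r E" "\<pi> (uq_f q) = ?r F"
    by (simp_all add: uq_gen_defs \<pi>_def hom(3)) (simp_all add: v_def)
  interpret U: calg ?U by (rule calg_uq_alg)
  interpret alg_rep ?U A \<pi>
    by (intro alg_rep.intro calg_axioms calg_uq_alg alg_rep_axioms.intro \<pi>1)
  have c [simp]: "uq_k q \<in> carrier ?U" "uq_kinv q \<in> carrier ?U" "uq_e q \<in> carrier ?U" "uq_f q \<in> carrier ?U"
    using uq_relations_uq_alg[of q] unfolding uq_relations_def by simp_all
  have \<epsilon>: "alg_map ?U complex_alg (uq_counit q)" by (rule uq_counit_values)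
  note uq_induct = pres_alg_induct[of _ "uq_rels q", folded uq_alg_def, consumes 1, case_names one gen add mult smult]
  have gen_cases: "P (pres_gen (uq_rels q) g)" if "P (uq_k q)" "P (uq_kinv q)" "P (uq_e q)" "P (uq_f q)" for P g
    using that by (cases g) (simp_all add: uq_gen_defs)
  have counit: "\<pi> h \<one> = uq_counit q h \<odot> \<one>" if "h \<in> carrier ?U" for h
    using that
  proof (induction h rule: uq_induct)
    case one
    show ?case using alg_map_one[OF \<epsilon>] by (simp add: act_one_left complex_alg_def)
  next
    case (gen g)
    show ?case
      by (rule gen_cases[of "\<lambda>h. \<pi> h \<one> = uq_counit q h \<odot> \<one>"])
         (simp_all add: gens uq_counit_values K_one K'_one E_one F_one)
  next
    case (add h g)
    then show ?case using alg_map_add[OF \<epsilon>, of h g] by (simp add: act_add_left smult_l_distr complex_alg_def)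
  next
    case (mult h g)
    then show ?case using alg_map_mult[OF \<epsilon>, of h g]
      by (simp add: act_mult_left act_smult complex_alg_def mult.commute flip: smult_assoc)
  next
    case (smult d h)
    then show ?case using alg_map_smult[OF \<epsilon>, of h d]
      by (simp add: act_smult_left complex_alg_def flip: smult_assoc)
  qed
  interpret P: calg ?UU by (rule calg_pair_alg[OF calg_uq_alg calg_uq_alg])
  interpret I: ideal "Idl\<^bsub>?UU\<^esub> (tensor_rels ?U ?U)" ?UU
    by (rule ideal_bilin_ideal[OF calg_uq_alg calg_uq_alg])
  note P = pair_alg_simps[OF calg_uq_alg[of q] calg_uq_alg[of q]]
  note T = alg_mapD[OF alg_map_tensor_coset[OF calg_uq_alg[of q] calg_uq_alg[of q]]]
  note \<Delta> = uq_comult_values[OF q]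
  note \<Delta>m = alg_mapD[OF \<Delta>(1)]
  let ?ok = "\<lambda>h t. t \<in> carrier ?UU \<and> uq_comult q h = coset t \<and>
      (\<forall>a\<in>carrier A. \<forall>b\<in>carrier A. \<pi> h (a \<otimes> b) = lin_ext A (mult_val a b) t)"
  have vs: "mult_val a b \<in> carrier ?U \<times> carrier ?U \<rightarrow> carrier A" if "a \<in> carrier A" "b \<in> carrier A" for a b
    by (rule tensor_val_closed[OF bilinear_mult that order_refl])
  have ladd: "lin_ext A (mult_val a b) (s + t) = lin_ext A (mult_val a b) s \<oplus> lin_ext A (mult_val a b) t"
    if "a \<in> carrier A" "b \<in> carrier A" "s \<in> carrier ?UU" "t \<in> carrier ?UU" for a b s t
    by (rule lin_ext_add[OF vs]) (use that in \<open>simp_all add: P\<close>)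
  have lclosed: "mult_val a b \<in> keys s \<rightarrow> carrier A"
    if "a \<in> carrier A" "b \<in> carrier A" "s \<in> carrier ?UU" for a b s
    by (rule tensor_val_closed[OF bilinear_mult]) (use that in \<open>simp_all add: P\<close>)
  have rep: "\<exists>t. ?ok h t" if "h \<in> carrier ?U" for h
    using that
  proof (induction h rule: uq_induct)
    case one
    have "?ok \<one>\<^bsub>?U\<^esub> (single (\<one>\<^bsub>?U\<^esub>, \<one>\<^bsub>?U\<^esub>) 1)"
      using T(4) \<Delta>m(4) by (simp add: P act_one_left)
    then show ?case ..
  next
    case (gen g)
    have k: "?ok (uq_k q) (single (uq_k q, uq_k q) 1)"
      by (simp add: P \<Delta> pure_tensor_def gens K_mult)
    have k': "?ok (uq_kinv q) (single (uq_kinv q, uq_kinv q) 1)"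
      by (simp add: P \<Delta> pure_tensor_def gens K'_mult)
    let ?s1 = "single (\<one>\<^bsub>?U\<^esub>, uq_e q) (1::complex)" and ?s2 = "single (uq_e q, uq_k q) (1::complex)"
    let ?t1 = "single (uq_f q, \<one>\<^bsub>?U\<^esub>) (1::complex)" and ?t2 = "single (uq_kinv q, uq_f q) (1::complex)"
    have st: "?s1 \<in> carrier ?UU" "?s2 \<in> carrier ?UU" "?t1 \<in> carrier ?UU" "?t2 \<in> carrier ?UU"
      by (simp_all add: P)
    have "?s1 + ?s2 \<in> carrier ?UU" "?t1 + ?t2 \<in> carrier ?UU"
      using P.a_closed[OF st(1,2)] P.a_closed[OF st(3,4)] by (simp_all add: P(4))
    moreover have "uq_comult q (uq_e q) = coset (?s1 + ?s2)" "uq_comult q (uq_f q) = coset (?t1 + ?t2)"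
      using T(2)[OF st(1,2)] T(2)[OF st(3,4)] by (simp_all add: \<Delta> pure_tensor_def P(4))
    ultimately have ef: "?ok (uq_e q) (?s1 + ?s2)" "?ok (uq_f q) (?t1 + ?t2)"
      by (simp_all add: ladd[OF _ _ st(1,2)] ladd[OF _ _ st(3,4)])
         (simp_all add: gens act_one_left E_mult F_mult)
    show ?case
      by (rule gen_cases[of "\<lambda>h. \<exists>t. ?ok h t"]) (use k k' ef in blast)+
  next
    case (add h g)
    then obtain s t where st: "?ok h s" "?ok g t" by blast
    then have c: "s \<in> carrier ?UU" "t \<in> carrier ?UU" by simp_all
    have "?ok (h \<oplus>\<^bsub>?U\<^esub> g) (s + t)"
      using st P.a_closed[OF c] T(2)[OF c] \<Delta>m(2)[OF add.hyps(1,2)] add.hyps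
      by (simp add: P(4) ladd act_add_left)
    then show ?case by blast
  next
    case (mult h g)
    then obtain s t where st: "?ok h s" "?ok g t" by blast
    then have c: "s \<in> carrier ?UU" "t \<in> carrier ?UU" by simp_all
    \<comment> \<open>Summing over the representative of the left factor first turns the inner sum into the product rule for that factor.\<close>
    have "\<pi> (h \<otimes>\<^bsub>?U\<^esub> g) (a \<otimes> b) = lin_ext A (mult_val a b) (s \<otimes>\<^bsub>?UU\<^esub> t)"
      if ab: "a \<in> carrier A" "b \<in> carrier A" for a b
    proof -
      have "lin_ext A (mult_val a b) (s \<otimes>\<^bsub>?UU\<^esub> t)
          = lin_ext A (\<lambda>w. lin_ext A (mult_val (\<pi> (fst w) a) (\<pi> (snd w) b)) s) t"
        by (rule lin_ext_tensor_val_mult'[OF bilinear_mult c ab])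
      also have "\<dots> = lin_ext A (\<lambda>w. \<pi> h (mult_val a b w)) t"
      proof (rule lin_ext_cong)
        fix w assume "w \<in> keys t"
        then have w: "fst w \<in> carrier ?U" "snd w \<in> carrier ?U" using c(2) by (auto simp: P)
        show "lin_ext A (mult_val (\<pi> (fst w) a) (\<pi> (snd w) b)) s = \<pi> h (mult_val a b w)"
          using st(1) w ab by simp
      next
        show "(\<lambda>w. \<pi> h (mult_val a b w)) \<in> keys t \<rightarrow> carrier A"
          using lclosed[OF ab c(2)] mult.hyps(1) by (auto simp: Pi_iff)
      qed
      also have "\<dots> = \<pi> h (lin_ext A (mult_val a b) t)"
        by (rule lin_map_lin_ext[OF calg_axioms calg_axioms act_linear lclosed[OF ab c(2)], symmetric])
           (rule mult.hyps(1))
      also have "\<dots> = \<pi> (h \<otimes>\<^bsub>?U\<^esub> g) (a \<otimes> b)"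
        using st(2) ab mult.hyps by (simp add: act_mult_left)
      finally show ?thesis ..
    qed
    then have "?ok (h \<otimes>\<^bsub>?U\<^esub> g) (s \<otimes>\<^bsub>?UU\<^esub> t)"
      using st P.m_closed[OF c] T(5)[OF c] \<Delta>m(5)[OF mult.hyps(1,2)] by simp
    then show ?case by blast
  next
    case (smult d h)
    then obtain s where s: "?ok h s" by blast
    then have c: "s \<in> carrier ?UU" by simp
    have "?ok (d \<odot>\<^bsub>?U\<^esub> h) (scale d s)"
      using s P.smult_closed[OF c, of d] T(3)[OF c, of d] \<Delta>m(3)[OF smult.hyps(1), of d] smult.hyps
      by (simp add: P(5) act_smult_left lin_ext_scale lclosed)
    then show ?case by blast
  qed
  have prod: "\<pi> h (a \<otimes> b) = lin_ext A (mult_val a b) t"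
    if "h \<in> carrier ?U" "t \<in> uq_comult q h" "a \<in> carrier A" "b \<in> carrier A" for h t a b
  proof -
    obtain s where s: "?ok h s" using rep[OF \<open>h \<in> carrier ?U\<close>] by blast
    have t: "t \<in> carrier ?UU" "uq_comult q h = coset t"
      using that(2) comult_rep[OF q that(1), of t] by simp_all
    have "\<pi> h (a \<otimes> b) = lin_ext A (mult_val a b) s" using s that by simp
    also have "\<dots> = lin_ext A (mult_val a b) t"
      using s t that by (intro mult_val_coset) simp_all
    finally show ?thesis .
  qed
  have "\<pi> \<in> module_alg_structures (uq_sl2 q) A"
    using \<pi>1 \<pi>2 counit prod unfolding module_alg_structures_def lin_ext_def
    by (simp add: alg_hom_iff alg_map_uq_sl2)
  then show ?thesis using gens by (intro bexI[of _ \<pi>]) simp_all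
qed

section \<open>The quantum torus\<close>

type_synonym laurent = "(int \<times> int) \<Rightarrow>\<^sub>0 complex"

definition lattice :: "(int \<times> int) set \<Rightarrow> (int \<times> int) monoid" where
  "lattice S = \<lparr>carrier = S, mult = (+), one = 0\<rparr>"

lemma lattice_simps [simp]:
  "carrier (lattice S) = S" "mult (lattice S) = (+)" "one (lattice S) = 0"
  by (simp_all add: lattice_def)

text \<open>
  Moving \<open>x\<^sup>r\<close> to the left across \<open>y\<^sup>n\<close> in \<open>x\<^sup>my\<^sup>n \<sqdot> x\<^sup>ry\<^sup>s\<close> costs the factor \<open>q\<^sup>n\<^sup>r\<close>.
\<close>

definition twist :: "complex \<Rightarrow> int \<times> int \<Rightarrow> int \<times> int \<Rightarrow> complex" where
  "twist q u v = q powi (snd u * fst v)"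

definition tmul :: "complex \<Rightarrow> laurent \<Rightarrow> laurent \<Rightarrow> laurent" where
  "tmul q = tw_mult (lattice UNIV) (twist q)"

lemma tw_mult_lattice: "tw_mult (lattice S) (twist q) = tmul q"
  unfolding tmul_def tw_mult_def by simp

abbreviation mon :: "int \<Rightarrow> int \<Rightarrow> laurent" where
  "mon i j \<equiv> single (i, j) 1"

text \<open>
  The same type carries the torus and the plane; the plane consists of the elements supported in
  the quadrant.
\<close>

definition quadrant :: "(int \<times> int) set" where
  "quadrant = {u. 0 \<le> fst u \<and> 0 \<le> snd u}"

definition plane :: "laurent set" where
  "plane = {p. keys p \<subseteq> quadrant}"

definition qp_model :: "complex \<Rightarrow> (complex, laurent) module" where
  "qp_model q = tw_alg (lattice quadrant) (twist q)"

lemma qp_model_simps [simp]: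
  "carrier (qp_model q) = plane"
  "mult (qp_model q) = tmul q"
  "one (qp_model q) = mon 0 0"
  "zero (qp_model q) = 0"
  "add (qp_model q) = (+)"
  "smult (qp_model q) = scale"
  by (simp_all add: qp_model_def tw_mult_lattice plane_def zero_prod_def)

lemma cocycle_lattice:
  assumes "q \<noteq> 0" "0 \<in> S" "\<And>u v. u \<in> S \<Longrightarrow> v \<in> S \<Longrightarrow> u + v \<in> S"
  shows "cocycle (lattice S) (twist q)"
proof -
  interpret monoid "lattice S"
    by (rule monoidI) (use assms in \<open>simp_all add: add.assoc\<close>)
  show ?thesis
    using assms(1)
    by unfold_locales (simp_all add: twist_def algebra_simps flip: power_int_add)
qed

lemma quadrant_add: "u \<in> quadrant \<Longrightarrow> v \<in> quadrant \<Longrightarrow> u + v \<in> quadrant"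
  and quadrant_zero: "0 \<in> quadrant"
  by (simp_all add: quadrant_def)

lemma calg_qp_model: "q \<noteq> 0 \<Longrightarrow> calg (qp_model q)"
  unfolding qp_model_def
  by (intro cocycle.calg_tw_alg cocycle_lattice quadrant_add quadrant_zero)

lemma plane_iff: "p \<in> plane \<longleftrightarrow> (\<forall>i j. lookup p (i, j) \<noteq> 0 \<longrightarrow> 0 \<le> i \<and> 0 \<le> j)"
  by (auto simp: plane_def quadrant_def subset_iff in_keys_iff)

lemma plane_intros [simp, intro]:
  "0 \<in> plane" "p \<in> plane \<Longrightarrow> r \<in> plane \<Longrightarrow> p + r \<in> plane" "p \<in> plane \<Longrightarrow> scale c p \<in> plane"
  "0 \<le> i \<Longrightarrow> 0 \<le> j \<Longrightarrow> single (i, j) c \<in> plane"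
  "p \<in> plane \<Longrightarrow> r \<in> plane \<Longrightarrow> p - r \<in> plane"
proof -
  show "p \<in> plane \<Longrightarrow> r \<in> plane \<Longrightarrow> p + r \<in> plane"
    unfolding plane_iff by (metis lookup_add add.right_neutral)
  show "p \<in> plane \<Longrightarrow> r \<in> plane \<Longrightarrow> p - r \<in> plane"
    unfolding plane_iff by (metis lookup_minus diff_zero)
qed (auto simp: plane_iff lookup_single when_def split: if_splits)

lemma lookup_tmul:
  "lookup (tmul q p r) t = (\<Sum>u\<in>keys p. \<Sum>v\<in>keys r.
     (twist q u v * (lookup p u * lookup r v)) when u + v = t)"
  by (simp add: tmul_def tw_mult_def lookup_sum lookup_single)

lemma tmul_single:
  "tmul q (single u c) (single v d)
    = single (u + v) (twist q u v * (c * d))"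
  by (simp add: tmul_def tw_mult_single)

lemma tmul_add_left: "tmul q (p + r) s = tmul q p s + tmul q r s"
  and tmul_add_right: "tmul q s (p + r) = tmul q s p + tmul q s r"
  and tmul_scale_left: "tmul q (scale c p) s = scale c (tmul q p s)"
  and tmul_scale_right: "tmul q s (scale c p) = scale c (tmul q s p)"
  and tmul_zero_left [simp]: "tmul q 0 p = 0"
  and tmul_zero_right [simp]: "tmul q p 0 = 0"
  by (simp_all add: tmul_def tw_mult_add_left tw_mult_add_right tw_mult_scale_left tw_mult_scale_right)

lemma tmul_diff_left: "tmul q (p - r) s = tmul q p s - tmul q r s"
  and tmul_diff_right: "tmul q s (p - r) = tmul q s p - tmul q s r"
  by (simp_all add: diff_eq_scale tmul_add_left tmul_add_right tmul_scale_left tmul_scale_right)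

lemma lookup_tmul_mon:
  "lookup (tmul q (mon i j) p) (m, n) = q powi (j * (m - i)) * lookup p (m - i, n - j)"
  "lookup (tmul q p (mon i j)) (m, n) = q powi ((n - j) * i) * lookup p (m - i, n - j)"
proof -
  show "lookup (tmul q (mon i j) p) (m, n)
      = q powi (j * (m - i)) * lookup p (m - i, n - j)"
    by (induction p rule: pm_induct)
       (auto simp: tmul_single tmul_add_right lookup_add lookup_single when_def twist_def algebra_simps split: if_splits)
  show "lookup (tmul q p (mon i j)) (m, n)
      = q powi ((n - j) * i) * lookup p (m - i, n - j)"
    by (induction p rule: pm_induct)
       (auto simp: tmul_single tmul_add_left lookup_add lookup_single when_def twist_def algebra_simps split: if_splits)
qed

lemma keys_tmul:
  assumes "t \<in> keys (tmul q p r)"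
  obtains u v where "u \<in> keys p" "v \<in> keys r" "t = u + v"
proof -
  have "\<exists>u\<in>keys p. \<exists>v\<in>keys r. u + v = t"
  proof (rule ccontr)
    assume "\<not> ?thesis"
    then have "lookup (tmul q p r) t = 0"
      unfolding lookup_tmul by (intro sum.neutral ballI) (auto simp: when_def)
    then show False using assms by (simp add: in_keys_iff)
  qed
  then show thesis using that by blast
qed

lemma tmul_plane [simp]: "p \<in> plane \<Longrightarrow> r \<in> plane \<Longrightarrow> tmul q p r \<in> plane"
  unfolding plane_def by (blast elim: keys_tmul intro: quadrant_add)

text \<open>
  The diagonal automorphism \<open>x \<mapsto> cx\<close>, \<open>y \<mapsto> c\<^sup>-\<^sup>1y\<close>; the action of \<open>k\<close> is the case \<open>c = q\<close>.
\<close>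

definition torus_k :: "complex \<Rightarrow> laurent \<Rightarrow> laurent" where
  "torus_k c p = Poly_Mapping.mapp (\<lambda>u a. c powi (fst u - snd u) * a) p"

lemma lookup_torus_k:
  "lookup (torus_k c p) (i, j) = c powi (i - j) * lookup p (i, j)"
  by (simp add: torus_k_def lookup_mapp when_def in_keys_iff)

lemma torus_k_zero [simp]: "torus_k c 0 = 0"
  and torus_k_add: "torus_k c (p + r) = torus_k c p + torus_k c r"
  and torus_k_diff: "torus_k c (p - r) = torus_k c p - torus_k c r"
  and torus_k_scale: "torus_k c (scale d p) = scale d (torus_k c p)"
  and torus_k_single: "torus_k c (single (i, j) d) = single (i, j) (c powi (i - j) * d)"
  by (auto intro!: poly_mapping_eqI simp: lookup_torus_k lookup_add lookup_minus lookup_single when_def algebra_simps)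

lemma torus_k_plane [simp]: "p \<in> plane \<Longrightarrow> torus_k c p \<in> plane"
  by (auto simp: plane_iff lookup_torus_k)

lemma torus_k_tmul: "c \<noteq> 0 \<Longrightarrow> torus_k c (tmul q p r) = tmul q (torus_k c p) (torus_k c r)"
proof (induction p rule: pm_induct)
  case (single u a)
  show ?case
  proof (induction r rule: pm_induct)
    case (single v b)
    show ?case using \<open>c \<noteq> 0\<close>
      by (cases u; cases v)
         (simp add: tmul_single torus_k_single twist_def power_int_diff power_int_add field_simps)
  qed (simp_all add: tmul_add_right torus_k_add)
qed (simp_all add: tmul_add_left torus_k_add)

lemma torus_k_inverse:
  assumes "c \<noteq> 0"
  shows "torus_k (inverse c) (torus_k c p) = p" "torus_k c (torus_k (inverse c) p) = p"
  using assms by (auto intro!: poly_mapping_eqI simp: lookup_torus_k power_int_inverse)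

lemma torus_k_homogeneous:
  assumes "\<And>i j. lookup p (i, j) \<noteq> 0 \<Longrightarrow> i - j = d"
  shows "torus_k c p = scale (c powi d) p"
proof (rule poly_mapping_eqI)
  fix u
  show "lookup (torus_k c p) u = lookup (scale (c powi d) p) u"
    using assms[of "fst u" "snd u"]
    by (cases u; cases "lookup p u = 0") (simp_all add: lookup_torus_k)
qed

text \<open>
  Any \<open>z\<close> makes \<open>p \<mapsto> z k(p) - p z\<close> obey the product rule of \<open>e\<close>, since the middle terms of
  \<open>z k(a) k(b) - a z k(b) + a z k(b) - a b z\<close> cancel; likewise for \<open>f\<close>.
\<close>

definition inner_e :: "complex \<Rightarrow> laurent \<Rightarrow> laurent \<Rightarrow> laurent" where
  "inner_e q z p = tmul q z (torus_k q p) - tmul q p z"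

definition inner_f :: "complex \<Rightarrow> laurent \<Rightarrow> laurent \<Rightarrow> laurent" where
  "inner_f q w p = tmul q w p - tmul q (torus_k (inverse q) p) w"

lemma inner_linear:
  "inner_e q z (p + r) = inner_e q z p + inner_e q z r"
  "inner_e q z (scale c p) = scale c (inner_e q z p)"
  "inner_f q z (p + r) = inner_f q z p + inner_f q z r"
  "inner_f q z (scale c p) = scale c (inner_f q z p)"
  by (simp_all add: inner_e_def inner_f_def torus_k_add torus_k_scale tmul_add_left tmul_add_right
      tmul_scale_left tmul_scale_right scale_diff)

text \<open>
  Descent: an even \<open>a\<close> is twice some \<open>c\<close>, and \<open>(b, c)\<close> is a smaller solution.
\<close>

lemma sqrt2_descent: "a ^ 2 = 2 * b ^ 2 \<Longrightarrow> b = 0" for a b :: nat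
proof (induction a arbitrary: b rule: less_induct)
  case (less a)
  show ?case
  proof (rule ccontr)
    assume b: "b \<noteq> 0"
    have "even (a ^ 2)" using less.prems by simp
    then obtain c where c: "a = 2 * c" by (auto elim: evenE)
    then have "b ^ 2 = 2 * c ^ 2" using less.prems by (simp add: power_mult_distrib)
    moreover have "b ^ 2 < a ^ 2" using b less.prems by simp
    then have "b < a" by (rule power_less_imp_less_base) simp
    ultimately have "c = 0" using less.IH by blast
    then show False using c less.prems b by simp
  qed
qed

locale generic_q =
  fixes q :: complex
  assumes q_nonzero [simp]: "q \<noteq> 0" and q_not_root: "n > 0 \<Longrightarrow> q ^ n \<noteq> 1"
begin

abbreviation tm (infixl "\<star>" 70) where "p \<star> r \<equiv> tmul q p r"

lemma powi_eq_one_iff: "q powi n = 1 \<longleftrightarrow> n = 0"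
proof (cases n "0 :: int" rule: linorder_cases)
  case less
  then have "q ^ nat (- n) \<noteq> 1" by (intro q_not_root) simp
  then show ?thesis using less by (simp add: power_int_def power_inverse)
next
  case greater
  then have "q ^ nat n \<noteq> 1" by (intro q_not_root) simp
  then show ?thesis using greater by (simp add: power_int_def)
qed simp

lemma powi_eq_iff: "q powi m = q powi n \<longleftrightarrow> m = n"
  using powi_eq_one_iff[of "m - n"] by (auto simp: power_int_diff)

lemma q_minus_inverse: "q - inverse q \<noteq> 0"
  using powi_eq_iff[of 1 "-1"] by (simp add: power_int_minus)

lemma tmul_assoc: "(p \<star> r) \<star> s = p \<star> (r \<star> s)"
  unfolding tmul_def
  by (rule cocycle.tw_mult_assoc[OF cocycle_lattice]) simp_all

lemma tmul_one [simp]: "mon 0 0 \<star> p = p" "p \<star> mon 0 0 = p"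
  by (rule poly_mapping_eqI, simp add: lookup_tmul_mon split_paired_all)+

lemmas tmul_linear = tmul_add_left tmul_add_right tmul_diff_left tmul_diff_right
  tmul_scale_left tmul_scale_right

lemma inner_e_mult: "inner_e q z (p \<star> r) = p \<star> inner_e q z r + inner_e q z p \<star> torus_k q r"
  by (simp add: inner_e_def torus_k_tmul tmul_linear tmul_assoc)

lemma inner_f_mult: "inner_f q w (p \<star> r) = inner_f q w p \<star> r + torus_k (inverse q) p \<star> inner_f q w r"
  by (simp add: inner_f_def torus_k_tmul tmul_linear tmul_assoc)

text \<open>
  For inner operators the commutator \<open>ef - fe\<close> is again governed by a single element \<open>c\<close>: the terms
  with \<open>p\<close> between \<open>z\<close> and \<open>w\<close> are the same in both products and drop out of the difference.
\<close>

lemma inner_commutator: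
  assumes z: "torus_k q z = scale (q ^ 2) z" and w: "torus_k q w = scale (inverse (q ^ 2)) w"
  defines "c \<equiv> scale (inverse (q ^ 2)) (z \<star> w) - w \<star> z"
  shows "inner_e q z (inner_f q w p) - inner_f q w (inner_e q z p)
    = c \<star> torus_k q p - torus_k (inverse q) p \<star> c"
proof -
  have z': "torus_k (inverse q) z = scale (inverse (q ^ 2)) z"
  proof -
    have "z = torus_k (inverse q) (scale (q ^ 2) z)" using torus_k_inverse(1)[of q z] z by simp
    then have "scale (inverse (q ^ 2)) z = scale (inverse (q ^ 2)) (scale (q ^ 2) (torus_k (inverse q) z))"
      by (simp add: torus_k_scale)
    then show ?thesis by (simp add: scale_scale)
  qed
  have "torus_k (inverse q) (torus_k q p) = p" "torus_k q (torus_k (inverse q) p) = p"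
    by (simp_all add: torus_k_inverse)
  then show ?thesis
    by (simp add: inner_e_def inner_f_def c_def torus_k_tmul torus_k_diff z' w tmul_linear
        scale_diff tmul_assoc)
qed

lemma plane_induct [consumes 1, case_names one x y add scale mult]:
  assumes "p \<in> plane" and one: "P (mon 0 0)" and x: "P (mon 1 0)" and y: "P (mon 0 1)"
    and add: "\<And>p r. p \<in> plane \<Longrightarrow> r \<in> plane \<Longrightarrow> P p \<Longrightarrow> P r \<Longrightarrow> P (p + r)"
    and sc: "\<And>c p. p \<in> plane \<Longrightarrow> P p \<Longrightarrow> P (scale c p)"
    and mult: "\<And>p r. p \<in> plane \<Longrightarrow> r \<in> plane \<Longrightarrow> P p \<Longrightarrow> P r \<Longrightarrow> P (p \<star> r)"
  shows "P p"
proof -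
  have yn: "P (mon 0 (int n))" for n
  proof (induction n)
    case (Suc n)
    have "mon 0 (int (Suc n)) = mon 0 1 \<star> mon 0 (int n)" by (simp add: tmul_single twist_def)
    then show ?case using mult[OF _ _ y Suc] by simp
  qed (simp add: one)
  have xy: "P (mon (int m) (int n))" for m n
  proof (induction m)
    case (Suc m)
    have "mon (int (Suc m)) (int n) = mon 1 0 \<star> mon (int m) (int n)" by (simp add: tmul_single twist_def)
    then show ?case using mult[OF _ _ x Suc] by simp
  qed (simp add: yn)
  have single: "P (single u c)" if "u \<in> quadrant" for u c
  proof -
    have u: "u = (int (nat (fst u)), int (nat (snd u)))"
      using that by (simp add: quadrant_def prod_eq_iff)
    show ?thesis
      using sc[OF _ xy, of "nat (fst u)" "nat (snd u)" c] that
      by (subst u) (simp add: quadrant_def)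
  qed
  have "keys p \<subseteq> quadrant" using assms(1) by (simp add: plane_def)
  then show ?thesis
  proof (induction p rule: pm_support_induct)
    case zero
    show ?case using sc[OF _ one, of 0] by simp
  qed (auto intro: single add simp: plane_def)
qed

subsection \<open>Leading exponents\<close>

text \<open>
  Additive and, because \<open>\<surd>2\<close> is irrational, injective.  Hence products of leading terms do not
  cancel, and leading exponents add under multiplication.
\<close>

definition weight :: "int \<times> int \<Rightarrow> real" where
  "weight u = real_of_int (fst u) + sqrt 2 * real_of_int (snd u)"

lemma weight_add: "weight (u + v) = weight u + weight v"
  by (simp add: weight_def algebra_simps)

lemma weight_inj: "weight u = weight v \<longleftrightarrow> u = v"
proof
  assume eq: "weight u = weight v"
  define a b where "a = fst u - fst v" and "b = snd v - snd u"
  have "real_of_int a = sqrt 2 * real_of_int b"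
    using eq by (simp add: weight_def a_def b_def algebra_simps)
  then have "(real_of_int a)\<^sup>2 = 2 * (real_of_int b)\<^sup>2" by (simp add: power_mult_distrib)
  then have ab: "a ^ 2 = 2 * b ^ 2"
    by (metis of_int_eq_iff of_int_mult of_int_numeral of_int_power)
  have "nat \<bar>b\<bar> = 0"
  proof (rule sqrt2_descent)
    have "int ((nat \<bar>a\<bar>) ^ 2) = int (2 * (nat \<bar>b\<bar>) ^ 2)" using ab by simp
    then show "(nat \<bar>a\<bar>) ^ 2 = 2 * (nat \<bar>b\<bar>) ^ 2" by (simp only: of_nat_eq_iff)
  qed
  then have "b = 0" by simp
  then show "u = v" using ab by (simp add: a_def b_def prod_eq_iff)
qed simp

definition is_lead :: "laurent \<Rightarrow> int \<times> int \<Rightarrow> bool" where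
  "is_lead p u \<longleftrightarrow> u \<in> keys p \<and> (\<forall>v\<in>keys p. weight v \<le> weight u)"

lemma ex_lead:
  assumes "p \<noteq> 0"
  obtains u where "is_lead p u"
proof -
  have "keys p \<noteq> {}" using assms by simp
  then obtain u where "u \<in> keys p" "weight u = Max (weight ` keys p)"
    using Max_in[of "weight ` keys p"] by fastforce
  then have "is_lead p u" by (simp add: is_lead_def)
  then show thesis by (rule that)
qed

lemma lookup_lead_tmul:
  assumes "is_lead p u" "is_lead r v"
  shows "lookup (p \<star> r) (u + v)
    = twist q u v * (lookup p u * lookup r v)"
proof -
  have eq: "u' + v' = u + v \<longleftrightarrow> u' = u \<and> v' = v"
    if "u' \<in> keys p" "v' \<in> keys r" for u' v'
  proof
    assume *: "u' + v' = u + v"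
    have "weight u' + weight v' = weight u + weight v"
      using * by (metis weight_add)
    moreover have "weight u' \<le> weight u" "weight v' \<le> weight v"
      using assms that by (auto simp: is_lead_def)
    ultimately have "weight u' = weight u" "weight v' = weight v" by linarith+
    then show "u' = u \<and> v' = v" by (simp add: weight_inj)
  qed simp
  have uv: "u \<in> keys p" "v \<in> keys r"
    using assms by (auto simp: is_lead_def)
  have "lookup (p \<star> r) (u + v) = (\<Sum>u'\<in>keys p. \<Sum>v'\<in>keys r.
     if v' = v then (if u' = u then twist q u v * (lookup p u * lookup r v) else 0) else 0)"
    unfolding lookup_tmul by (intro sum.cong refl) (auto simp: eq when_def)
  also have "\<dots> = twist q u v * (lookup p u * lookup r v)"
    using uv by (simp add: sum.delta)
  finally show ?thesis .
qed

lemma is_lead_tmul: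
  assumes "is_lead p u" "is_lead r v"
  shows "is_lead (p \<star> r) (u + v)"
proof -
  have "lookup p u \<noteq> 0" "lookup r v \<noteq> 0"
    using assms by (auto simp: is_lead_def in_keys_iff)
  then have "u + v \<in> keys (p \<star> r)"
    by (simp add: in_keys_iff lookup_lead_tmul[OF assms] twist_def)
  moreover have "weight t \<le> weight (u + v)" if "t \<in> keys (p \<star> r)" for t
    using keys_tmul[OF that] assms by (metis weight_add add_mono is_lead_def)
  ultimately show ?thesis by (simp add: is_lead_def)
qed

end

section \<open>Actions on the model of the quantum plane\<close>

context generic_q
begin

text \<open>
  The factor vanishes at \<open>j = -1\<close>, which is why \<open>e\<close> does not lead out of the plane although \<open>z\<close>
  contains a negative power of \<open>y\<close>.
\<close>

lemma inner_e_single: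
  "lookup (inner_e q (single (1, -1) l) p) (i, j)
    = l * (q powi (- (j + 1)) - q powi (j + 1)) * lookup p (i - 1, j + 1)"
proof -
  have z: "single (1, -1) l = scale l (mon 1 (-1))" by simp
  have "q powi (- (i - 1)) * q powi (i - 1 - (j + 1)) = q powi (- (j + 1))"
    by (simp flip: power_int_add) (rule arg_cong[of _ _ "power_int q"], simp)
  then show ?thesis
    unfolding inner_e_def z
    by (simp add: tmul_scale_left tmul_scale_right lookup_minus lookup_tmul_mon lookup_torus_k
        algebra_simps del: map_single)
qed

lemma inner_f_single:
  "lookup (inner_f q (single (-1, 1) l) p) (i, j)
    = l * (q powi (i + 1) - q powi (- (i + 1))) * lookup p (i + 1, j - 1)"
proof -
  have w: "single (-1, 1) l = scale l (mon (-1) 1)" by simp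
  have "q powi (- (j - 1)) * inverse q powi (i + 1 - (j - 1)) = q powi (- (i + 1))"
    by (simp add: power_int_inverse flip: power_int_minus power_int_add)
       (rule arg_cong[of _ _ "power_int q"], simp)
  then show ?thesis
    unfolding inner_f_def w
    by (simp add: tmul_scale_left tmul_scale_right lookup_minus lookup_tmul_mon lookup_torus_k
        algebra_simps del: map_single)
qed

lemma inner_single_values:
  "inner_e q (single (1, -1) l) (mon 1 0) = 0"
  "inner_e q (single (1, -1) l) (mon 0 1) = single (1, 0) (l * (inverse q - q))"
  "inner_f q (single (-1, 1) l) (mon 1 0) = single (0, 1) (l * (q - inverse q))"
  "inner_f q (single (-1, 1) l) (mon 0 1) = 0"
  by (auto intro!: poly_mapping_eqI simp: inner_e_single inner_f_single lookup_single when_def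
      power_int_minus eq_neg_iff_add_eq_0[symmetric] split: if_splits)

lemma torus_k_inner_e:
  assumes "torus_k q z = scale (q ^ 2) z"
  shows "torus_k q (inner_e q z p) = scale (q ^ 2) (inner_e q z (torus_k q p))"
  by (simp add: inner_e_def torus_k_diff torus_k_tmul assms tmul_linear scale_diff)

lemma torus_k_inner_f:
  assumes "torus_k q w = scale (inverse (q ^ 2)) w"
  shows "torus_k q (inner_f q w p) = scale (inverse (q ^ 2)) (inner_f q w (torus_k q p))"
  by (simp add: inner_f_def torus_k_diff torus_k_tmul assms tmul_linear scale_diff torus_k_inverse)

text \<open>
  With \<open>z = \<lambda>xy\<^sup>-\<^sup>1\<close> and \<open>w = \<mu>x\<^sup>-\<^sup>1y\<close> the element \<open>c\<close> is \<open>\<lambda>\<mu>(q\<^sup>-\<^sup>1 - q)\<close>, and the constants are chosen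
  to make it \<open>1 / (q - q\<^sup>-\<^sup>1)\<close> and to give \<open>e(y) = \<tau>x\<close>.
\<close>

lemma sl2_action_model:
  assumes \<tau>: "\<tau> \<noteq> 0"
  defines "z \<equiv> single (1, -1) (\<tau> / (inverse q - q))"
    and "w \<equiv> single (-1, 1) (1 / (\<tau> * (q - inverse q)))"
  shows "sl2_action (qp_model q) q (torus_k q) (torus_k (inverse q)) (inner_e q z) (inner_f q w)"
    and "inner_e q z (mon 1 0) = 0" and "inner_e q z (mon 0 1) = scale \<tau> (mon 1 0)"
    and "inner_f q w (mon 1 0) = scale (inverse \<tau>) (mon 0 1)" and "inner_f q w (mon 0 1) = 0"
proof -
  define \<kappa> where "\<kappa> = 1 / (q - inverse q)"
  have ne: "q - inverse q \<noteq> 0" "inverse q - q \<noteq> 0"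
    using q_minus_inverse by auto
  have zw: "torus_k q z = scale (q ^ 2) z" "torus_k q w = scale (inverse (q ^ 2)) w"
    by (simp_all add: z_def w_def torus_k_single power_int_minus)
  have c: "scale (inverse (q ^ 2)) (z \<star> w) - w \<star> z = scale \<kappa> (mon 0 0)"
  proof -
    have "inverse (q ^ 2) * (q * (l * m)) - q * (m * l) = (inverse q - q) * (l * m)" for l m
      by (simp add: power2_eq_square field_simps)
    then have "inverse (q ^ 2) * (q * (\<tau> / (inverse q - q) * (1 / (\<tau> * (q - inverse q)))))
        - q * (1 / (\<tau> * (q - inverse q)) * (\<tau> / (inverse q - q)))
        = (inverse q - q) * (\<tau> / (inverse q - q) * (1 / (\<tau> * (q - inverse q))))" .
    also have "\<dots> = \<kappa>" using \<tau> ne by (simp add: \<kappa>_def)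
    finally show ?thesis
      by (simp add: z_def w_def tmul_single twist_def single_diff[symmetric] zero_prod_def)
  qed
  have plane_e: "inner_e q z p \<in> plane" if "p \<in> plane" for p
    unfolding plane_iff
  proof (intro allI impI)
    fix i j assume "lookup (inner_e q z p) (i, j) \<noteq> 0"
    then have "q powi (- (j + 1)) \<noteq> q powi (j + 1)" "lookup p (i - 1, j + 1) \<noteq> 0"
      unfolding z_def inner_e_single by auto
    then have "- (j + 1) \<noteq> j + 1" "0 \<le> i - 1 \<and> 0 \<le> j + 1"
      using that unfolding plane_iff powi_eq_iff by blast+
    then show "0 \<le> i \<and> 0 \<le> j" by simp
  qed
  have plane_f: "inner_f q w p \<in> plane" if "p \<in> plane" for p
    unfolding plane_iff
  proof (intro allI impI)
    fix i j assume "lookup (inner_f q w p) (i, j) \<noteq> 0"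
    then have "q powi (i + 1) \<noteq> q powi (- (i + 1))" "lookup p (i + 1, j - 1) \<noteq> 0"
      unfolding w_def inner_f_single by auto
    then have "i + 1 \<noteq> - (i + 1)" "0 \<le> i + 1 \<and> 0 \<le> j - 1"
      using that unfolding plane_iff powi_eq_iff by blast+
    then show "0 \<le> i \<and> 0 \<le> j" by simp
  qed
  have EF: "inner_e q z (inner_f q w p) = inner_f q w (inner_e q z p)
      + (scale \<kappa> (torus_k q p) + scale (- \<kappa>) (torus_k (inverse q) p))" for p
  proof -
    have "inner_e q z (inner_f q w p) - inner_f q w (inner_e q z p)
        = scale \<kappa> (torus_k q p) - scale \<kappa> (torus_k (inverse q) p)"
      using inner_commutator[OF zw, of p] unfolding c by (simp add: tmul_linear del: map_single)
    moreover have "scale (- \<kappa>) (torus_k (inverse q) p) = - scale \<kappa> (torus_k (inverse q) p)"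
      by (rule poly_mapping_eqI) simp
    ultimately show ?thesis by (simp add: algebra_simps)
  qed
  show "sl2_action (qp_model q) q (torus_k q) (torus_k (inverse q)) (inner_e q z) (inner_f q w)"
  proof (intro sl2_action.intro calg_qp_model sl2_action_axioms.intro)
    show "inner_e q z (\<one>\<^bsub>qp_model q\<^esub>) = \<zero>\<^bsub>qp_model q\<^esub>" "inner_f q w (\<one>\<^bsub>qp_model q\<^esub>) = \<zero>\<^bsub>qp_model q\<^esub>"
      by (simp_all add: inner_e_def inner_f_def torus_k_single)
  qed (auto intro!: lin_mapI plane_e plane_f
      simp: torus_k_add torus_k_scale inner_linear torus_k_inverse torus_k_inner_e[OF zw(1)]
        torus_k_inner_f[OF zw(2)] EF[unfolded \<kappa>_def] torus_k_tmul inner_e_mult inner_f_mult torus_k_single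
      simp del: map_single)

    have "\<tau> / (inverse q - q) * (inverse q - q) = \<tau>" using ne(2) by (rule nonzero_eq_divide_eq[THEN iffD1]) simp
    moreover have "1 / (\<tau> * (q - inverse q)) * (q - inverse q) = inverse \<tau>"
      using ne(1) \<tau> by (simp add: inverse_eq_divide)
    ultimately show "inner_e q z (mon 1 0) = 0" "inner_e q z (mon 0 1) = scale \<tau> (mon 1 0)"
      "inner_f q w (mon 1 0) = scale (inverse \<tau>) (mon 0 1)" "inner_f q w (mon 0 1) = 0"
      by (simp_all only: z_def w_def inner_single_values) simp_all
qed

end

locale plane_action = generic_q q + sl2_action "qp_model q" q K K' E F for q K K' E F
begin

lemma closed [simp]:
  "p \<in> plane \<Longrightarrow> K p \<in> plane" "p \<in> plane \<Longrightarrow> K' p \<in> plane" "p \<in> plane \<Longrightarrow> E p \<in> plane" "p \<in> plane \<Longrightarrow> F p \<in> plane"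
  using linear[THEN lin_map_closed] by simp_all

lemma add:
  assumes "p \<in> plane" "r \<in> plane"
  shows "K (p + r) = K p + K r" "K' (p + r) = K' p + K' r" "E (p + r) = E p + E r" "F (p + r) = F p + F r"
  using assms linear[THEN lin_map_add, of p r] by simp_all

lemma scale:
  assumes "p \<in> plane"
  shows "K (scale c p) = scale c (K p)" "K' (scale c p) = scale c (K' p)"
    "E (scale c p) = scale c (E p)" "F (scale c p) = scale c (F p)"
  using assms linear[THEN lin_map_smult, of p c] by simp_all

lemmas mult = K_mult[simplified] K'_mult[simplified] E_mult[simplified] F_mult[simplified]

lemma K_zero: "K 0 = 0"
  using scale(1)[of 0 0] by simp

lemma K_inj: "p \<in> plane \<Longrightarrow> K p = 0 \<Longrightarrow> p = 0"
proof -
  assume p: "p \<in> plane" "K p = 0"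
  then have "p = K' 0" using K'K[of p] by simp
  then show "p = 0" using scale(2)[of 0 0] by simp
qed

lemma y_x: "mon 0 1 \<star> mon 1 0 = scale q (mon 1 0 \<star> mon 0 1)"
  by (simp add: tmul_single twist_def)

lemma K_expand:
  assumes "p \<in> plane"
  shows "lookup (K p) t = (\<Sum>u\<in>keys p.
    lookup p u * lookup (K (single u 1)) t)"
proof -
  have "keys p \<subseteq> quadrant" using assms by (simp add: plane_def)
  then show ?thesis
  proof (induction p rule: pm_support_induct)
    case zero
    show ?case by (simp add: K_zero)
  next
    case (single u c)
    have "K (single u c) = scale c (K (single u 1))"
      using scale(1)[of "single u 1" c] single by (simp add: plane_def)
    then show ?case by simp
  next
    case (add s r)
    let ?f = "\<lambda>u c. c * lookup (K (single u 1)) t"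
    have "(\<Sum>u\<in>keys (s + r). ?f u (lookup (s + r) u))
        = (\<Sum>u\<in>keys s. ?f u (lookup s u))
        + (\<Sum>u\<in>keys r. ?f u (lookup r u))"
      by (rule setsum_keys_plus_distrib) (simp_all add: algebra_simps)
    then show ?case using add by (simp add: plane_action.add[OF plane_action_axioms] plane_def lookup_add)
  qed
qed

text \<open>
  Write \<open>X\<close> and \<open>Y\<close> for the images of \<open>x\<close> and \<open>y\<close>.  Comparing leading coefficients in \<open>YX = qXY\<close>
  shows that their leading exponents \<open>u\<close> and \<open>v\<close> have determinant one, so the products
  \<open>X\<^sup>iY\<^sup>j\<close> have distinct leading exponents \<open>iu + jv\<close> and the heaviest of these never cancels.  As
  \<open>x\<close> and \<open>y\<close> are combinations of such products, \<open>(1, 0)\<close> and \<open>(0, 1)\<close> are nonnegative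
  combinations of \<open>u\<close> and \<open>v\<close>, which leaves only \<open>u = (1, 0)\<close> and \<open>v = (0, 1)\<close>.  The few lower
  terms that remain possible are excluded by the relation \<open>YX = qXY\<close>.
\<close>

lemma K_diagonal:
  obtains \<alpha> \<beta> where "K (mon 1 0) = scale \<alpha> (mon 1 0)" "K (mon 0 1) = scale \<beta> (mon 0 1)" "\<alpha> \<noteq> 0" "\<beta> \<noteq> 0"
proof -
  define X where "X = K (mon 1 0)"
  define Y where "Y = K (mon 0 1)"
  have XY: "X \<in> plane" "Y \<in> plane" by (simp_all add: X_def Y_def)
  have "X \<noteq> 0" "Y \<noteq> 0"
    using K_inj[of "mon 1 0"] K_inj[of "mon 0 1"] by (auto simp: X_def Y_def)
  then obtain u v where u: "is_lead X u" and v: "is_lead Y v" by (meson ex_lead)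
  have q_comm: "Y \<star> X = scale q (X \<star> Y)"
    using y_x by (simp add: X_def Y_def scale flip: mult del: map_single)
  have nonneg: "0 \<le> fst u" "0 \<le> snd u" "0 \<le> fst v" "0 \<le> snd v"
    using u v XY by (auto simp: is_lead_def plane_def quadrant_def)
  have coeff: "lookup X u \<noteq> 0" "lookup Y v \<noteq> 0"
    using u v by (auto simp: is_lead_def in_keys_iff)
  have det: "snd v * fst u = 1 + snd u * fst v"
  proof -
    have "twist q v u = q * twist q u v"
      using arg_cong[OF q_comm, of "\<lambda>p. lookup p (u + v)"] coeff
        lookup_lead_tmul[OF u v] lookup_lead_tmul[OF v u] by (auto simp: add.commute)
    then have "q powi (snd v * fst u) = q powi (1 + snd u * fst v)"
      by (simp add: twist_def power_int_add)
    then show ?thesis by (simp only: powi_eq_iff)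
  qed
  \<comment> \<open>The leading exponent of the image of a monomial.\<close>
  define L where "L = (\<lambda>t. (fst t * fst u + snd t * fst v, fst t * snd u + snd t * snd v))"
  have L_inj: "s = t" if "L s = L t" for s t
  proof -
    define a b where "a = fst s - fst t" and "b = snd s - snd t"
    have 1: "a * fst u + b * fst v = 0" and 2: "a * snd u + b * snd v = 0"
      using that by (simp_all add: L_def a_def b_def algebra_simps)
    have "a * (snd v * fst u - snd u * fst v) = (a * fst u + b * fst v) * snd v - (a * snd u + b * snd v) * fst v"
      by (simp add: algebra_simps)
    then have "a = 0" using det by (simp add: 1 2)
    have "b * (snd v * fst u - snd u * fst v) = (a * snd u + b * snd v) * fst u - (a * fst u + b * fst v) * snd u"
      by (simp add: algebra_simps)
    then have "b = 0" using det by (simp add: 1 2)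
    show "s = t" using \<open>a = 0\<close> \<open>b = 0\<close> by (simp add: a_def b_def prod_eq_iff)
  qed
  have L_add: "L (1, 0) = u" "L (0, 1) = v" "L (0, 0) = 0" "L (s + t) = L s + L t" for s t
    by (simp_all add: L_def prod_eq_iff algebra_simps)
  have lead_y: "is_lead (K (mon 0 (int n))) (L (0, int n))" for n
  proof (induction n)
    case 0
    show ?case using K_one by (simp add: L_add is_lead_def zero_prod_def)
  next
    case (Suc n)
    have "mon 0 (int (Suc n)) = mon 0 1 \<star> mon 0 (int n)" by (simp add: tmul_single twist_def)
    then have "K (mon 0 (int (Suc n))) = Y \<star> K (mon 0 (int n))" by (simp add: mult Y_def)
    moreover have "L (0, int (Suc n)) = v + L (0, int n)" using L_add(4)[of "(0, 1)" "(0, int n)"] by (simp add: L_add)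
    ultimately show ?case using is_lead_tmul[OF v Suc] by simp
  qed
  have lead: "is_lead (K (mon (int m) (int n))) (L (int m, int n))" for m n
  proof (induction m)
    case (Suc m)
    have "mon (int (Suc m)) (int n) = mon 1 0 \<star> mon (int m) (int n)" by (simp add: tmul_single twist_def)
    then have "K (mon (int (Suc m)) (int n)) = X \<star> K (mon (int m) (int n))" by (simp add: mult X_def)
    moreover have "L (int (Suc m), int n) = u + L (int m, int n)"
      using L_add(4)[of "(1, 0)" "(int m, int n)"] by (simp add: L_add)
    ultimately show ?case using is_lead_tmul[OF u Suc] by simp
  qed (simp add: lead_y)
  have attained: "\<exists>t\<in>quadrant. lookup (K r) (L t) \<noteq> 0" if r: "r \<in> plane" "r \<noteq> 0" for r
  proof -
    have fin: "finite (keys r)" "keys r \<noteq> {}" using r by simp_all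
    then obtain t where t: "t \<in> keys r"
      "weight (L t) = Max ((\<lambda>t. weight (L t)) ` keys r)"
      using Max_in[of "(\<lambda>t. weight (L t)) ` keys r"] by fastforce
    then have max: "weight (L s) \<le> weight (L t)" if "s \<in> keys r" for s
      using that by simp
    have lead': "is_lead (K (single s 1)) (L s)" if "s \<in> keys r" for s
    proof -
      have "s = (int (nat (fst s)), int (nat (snd s)))"
        using that r by (auto simp: plane_def quadrant_def prod_eq_iff)
      then show ?thesis using lead[of "nat (fst s)" "nat (snd s)"] by metis
    qed
    have "lookup (K (single s 1)) (L t) = 0"
      if s: "s \<in> keys r" "s \<noteq> t" for s
    proof (rule ccontr)
      assume "\<not> ?thesis"
      then have "weight (L t) \<le> weight (L s)" using lead'[OF s(1)] by (simp add: is_lead_def in_keys_iff)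
      then have "weight (L t) = weight (L s)" using max[OF s(1)] by simp
      then show False using s(2) L_inj by (auto simp: weight_inj)
    qed
    then have "lookup (K r) (L t) = (\<Sum>s\<in>keys r.
        if s = t then lookup r t * lookup (K (single t 1)) (L t) else 0)"
      unfolding K_expand[OF r(1)] by (intro sum.cong) auto
    also have "\<dots> = lookup r t * lookup (K (single t 1)) (L t)"
      using t fin by (simp add: sum.delta)
    finally have "lookup (K r) (L t) \<noteq> 0"
      using lead'[OF t(1)] t(1) by (simp add: is_lead_def in_keys_iff)
    moreover have "t \<in> quadrant" using t(1) r(1) by (auto simp: plane_def)
    ultimately show ?thesis by blast
  qed
  \<comment> \<open>The monomial with exponent s is the image of some nonzero element, and such an image has an exponent of the form L t.\<close>
  have hit: "\<exists>t\<in>quadrant. L t = s" if "s \<in> quadrant" for s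
  proof -
    let ?m = "single s (1::complex)"
    have m: "?m \<in> plane" using that by (simp add: plane_def)
    have "K' ?m \<noteq> 0" using KK'[of ?m] m K_zero by auto
    then obtain t where "t \<in> quadrant" "lookup (K (K' ?m)) (L t) \<noteq> 0"
      using attained[of "K' ?m"] m by auto
    then show ?thesis using KK'[of ?m] m by (auto simp: lookup_single when_def split: if_splits)
  qed
  obtain i j where ij: "0 \<le> i" "0 \<le> j" "i * fst u + j * fst v = 1" "i * snd u + j * snd v = 0"
    using hit[of "(1, 0)"] by (auto simp: quadrant_def L_def)
  obtain k l where kl: "0 \<le> k" "0 \<le> l" "k * fst u + l * fst v = 0" "k * snd u + l * snd v = 1"
    using hit[of "(0, 1)"] by (auto simp: quadrant_def L_def)
  have "0 < snd v * fst u" using det nonneg mult_nonneg_nonneg[of "snd u" "fst v"] by linarith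
  then have pos: "0 < fst u" "0 < snd v" using nonneg by (auto simp: zero_less_mult_iff)
  have "j * snd v = 0" "i * snd u = 0"
    using ij nonneg by (metis add_nonneg_eq_0_iff mult_nonneg_nonneg)+
  then have "j = 0" using pos by simp
  then have "i * fst u = 1" using ij by simp
  then have u1: "fst u = 1" "i = 1" using pos ij by (auto simp: pos_zmult_eq_1_iff zmult_eq_1_iff)
  have "k * fst u = 0" using kl nonneg by (metis add_nonneg_eq_0_iff mult_nonneg_nonneg)
  then have "l * snd v = 1" "l * fst v = 0" using kl pos by simp_all
  then have v1: "snd v = 1" "l = 1" using pos kl by (auto simp: pos_zmult_eq_1_iff zmult_eq_1_iff)
  have uv: "u = (1, 0)" "v = (0, 1)"
    using u1 v1 \<open>i * snd u = 0\<close> \<open>l * fst v = 0\<close> by (simp_all add: prod_eq_iff)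
  have sqrt2: "1 < sqrt 2" "sqrt 2 < 2" by (simp_all add: real_less_lsqrt)
  have X_keys: "t = (0, 0) \<or> t = (1, 0)" if "t \<in> keys X" for t
  proof -
    have t: "0 \<le> fst t" "0 \<le> snd t" using that XY by (auto simp: plane_def quadrant_def)
    have le: "real_of_int (fst t) + sqrt 2 * real_of_int (snd t) \<le> 1"
      using u that by (auto simp: is_lead_def weight_def uv)
    have "snd t = 0"
    proof (rule ccontr)
      assume "snd t \<noteq> 0"
      then have "1 \<le> real_of_int (snd t)" using t by simp
      then have "sqrt 2 * 1 \<le> sqrt 2 * real_of_int (snd t)" by (intro mult_left_mono) simp_all
      moreover have "0 \<le> real_of_int (fst t)" using t by simp
      ultimately show False using le sqrt2 by linarith
    qed
    then show ?thesis using le t by (auto simp: prod_eq_iff)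
  qed
  have Y_keys: "t = (0, 0) \<or> t = (1, 0) \<or> t = (0, 1)" if "t \<in> keys Y" for t
  proof -
    have t: "0 \<le> fst t" "0 \<le> snd t" using that XY by (auto simp: plane_def quadrant_def)
    have le: "real_of_int (fst t) + sqrt 2 * real_of_int (snd t) \<le> sqrt 2"
      using v that by (auto simp: is_lead_def weight_def uv)
    have "snd t \<le> 1"
    proof (rule ccontr)
      assume "\<not> snd t \<le> 1"
      then have "2 \<le> real_of_int (snd t)" by simp
      then have "sqrt 2 * 2 \<le> sqrt 2 * real_of_int (snd t)" by (intro mult_left_mono) simp_all
      moreover have "0 \<le> real_of_int (fst t)" using t by simp
      ultimately show False using le sqrt2 by linarith
    qed
    then consider "snd t = 0" | "snd t = 1" using t by linarith
    then show ?thesis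
    proof cases
      case 1
      then have "real_of_int (fst t) < 2" using le sqrt2 by simp
      then show ?thesis using 1 t by (auto simp: prod_eq_iff)
    next
      case 2
      then have "real_of_int (fst t) \<le> 0" using le by simp
      then show ?thesis using 2 t by (auto simp: prod_eq_iff)
    qed
  qed
  let ?s = "single"
  define a c where "a = lookup X (1, 0)" and "c = lookup X (0, 0)"
  define d b c' where "d = lookup Y (0, 1)" and "b = lookup Y (1, 0)"
    and "c' = lookup Y (0, 0)"
  have X: "X = ?s (1, 0) a + ?s (0, 0) c"
    by (subst sum_singles_superset[of "{(1, 0), (0, 0)}" X])
       (use X_keys in \<open>auto simp only: a_def c_def sum.insert\<close>, simp_all)
  have Y: "Y = ?s (0, 1) d + ?s (1, 0) b + ?s (0, 0) c'"
    by (subst sum_singles_superset[of "{(0, 1), (1, 0), (0, 0)}" Y])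
       (use Y_keys in \<open>auto simp only: d_def b_def c'_def sum.insert\<close>, simp_all)
  have ad: "a \<noteq> 0" "d \<noteq> 0" using coeff by (simp_all add: uv a_def d_def)
  have q1: "q \<noteq> 1" using powi_eq_one_iff[of 1] by simp
  have eq: "lookup (Y \<star> X) t = q * lookup (X \<star> Y) t" for t
    using q_comm by simp
  note expand = X Y tmul_add_left tmul_add_right tmul_single lookup_add lookup_single twist_def
  have "d * c = q * (c * d)" using eq[of "(0, 1)"] unfolding expand by simp
  then have c: "c = 0" using ad q1 by simp
  have "b * a = q * (a * b)" using eq[of "(2, 0)"] unfolding expand by simp
  then have b: "b = 0" using ad q1 by simp
  have "c' * a = q * (a * c')" using eq[of "(1, 0)"] unfolding expand by (simp add: b c)
  then have c': "c' = 0" using ad q1 by simp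
  show thesis
    by (rule that[of a d]) (use X Y ad in \<open>simp_all add: X_def Y_def b c c'\<close>)
qed

end

section \<open>Classification on the model\<close>

locale linear_action = plane_action +
  assumes E_y_linear: "lookup (E (mon 0 1)) (1, 0) \<noteq> 0 \<or> lookup (E (mon 0 1)) (0, 1) \<noteq> 0"
begin

lemma plane_lookup: "p \<in> plane \<Longrightarrow> i < 0 \<or> j < 0 \<Longrightarrow> lookup p (i, j) = 0"
  unfolding plane_iff by (metis not_le)

lemma KE': "p \<in> plane \<Longrightarrow> K (E p) = scale (q ^ 2) (E (K p))"
  and KF': "p \<in> plane \<Longrightarrow> K (F p) = scale (inverse (q ^ 2)) (F (K p))"
  using KE KF by simp_all

text \<open>
  Let \<open>k(x) = \<alpha>x\<close> and \<open>k(y) = \<beta>y\<close>.  An \<open>x\<close>-term in \<open>e(y)\<close> forces \<open>\<alpha> = q\<^sup>2\<beta>\<close>, while a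
  \<open>y\<close>-term would give \<open>q\<^sup>2 = 1\<close>.  The coefficient of \<open>x\<^sup>2\<close> in \<open>e(yx) = q e(xy)\<close> then yields \<open>\<alpha> = q\<close>.
\<close>

lemma K_gens: "K (mon 1 0) = scale q (mon 1 0)"
    "K (mon 0 1) = scale (inverse q) (mon 0 1)"
  and K_eq_torus_k: "p \<in> plane \<Longrightarrow> K p = torus_k q p"
proof -
  obtain \<alpha> \<beta> where Kx: "K (mon 1 0) = scale \<alpha> (mon 1 0)"
    and Ky: "K (mon 0 1) = scale \<beta> (mon 0 1)" and ne: "\<alpha> \<noteq> 0" "\<beta> \<noteq> 0"
    by (rule K_diagonal)
  have y: "K (mon 0 (int n)) = single (0, int n) (\<beta> ^ n)" for n
  proof (induction n)
    case (Suc n)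
    have "mon 0 (int (Suc n)) = mon 0 1 \<star> mon 0 (int n)" by (simp add: tmul_single twist_def)
    then have "K (mon 0 (int (Suc n))) = K (mon 0 1) \<star> K (mon 0 (int n))" by (simp add: mult)
    then show ?case by (simp add: Suc Ky tmul_single twist_def)
  qed (use K_one in simp)
  have xy: "K (mon (int m) (int n)) = single (int m, int n) (\<alpha> ^ m * \<beta> ^ n)" for m n
  proof (induction m)
    case (Suc m)
    have "mon (int (Suc m)) (int n) = mon 1 0 \<star> mon (int m) (int n)" by (simp add: tmul_single twist_def)
    then have "K (mon (int (Suc m)) (int n)) = K (mon 1 0) \<star> K (mon (int m) (int n))" by (simp add: mult)
    then show ?case by (simp add: Suc Kx tmul_single twist_def mult.assoc)
  qed (simp add: y)
  have K: "lookup (K p) (i, j) = \<alpha> powi i * \<beta> powi j * lookup p (i, j)"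
    if "p \<in> plane" for p i j
  proof -
    have "lookup (K p) (i, j) = (\<Sum>u\<in>keys p.
        if u = (i, j) then \<alpha> powi i * \<beta> powi j * lookup p (i, j) else 0)"
      unfolding K_expand[OF that]
    proof (rule sum.cong[OF refl])
      fix u assume "u \<in> keys p"
      then have "u \<in> quadrant" using that by (auto simp: plane_def)
      then obtain m n where u: "u = (int m, int n)"
        by (cases u) (metis quadrant_def mem_Collect_eq fst_conv snd_conv nonneg_int_cases)
      show "lookup p u * lookup (K (single u 1)) (i, j)
          = (if u = (i, j) then \<alpha> powi i * \<beta> powi j * lookup p (i, j) else 0)"
        by (auto simp: u xy lookup_single when_def)
    qed
    also have "\<dots> = \<alpha> powi i * \<beta> powi j * lookup p (i, j)"
      by (simp add: sum.delta in_keys_iff)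
    finally show ?thesis .
  qed
  have wt_E: "\<alpha> powi i * \<beta> powi j = q ^ 2 * c"
    if "p \<in> plane" "K p = scale c p" "lookup (E p) (i, j) \<noteq> 0" for p c i j
    using arg_cong[OF KE'[OF that(1)], of "\<lambda>r. lookup r (i, j)"] that by (simp add: K scale)
  have wt_F: "\<alpha> powi i * \<beta> powi j = inverse (q ^ 2) * c"
    if "p \<in> plane" "K p = scale c p" "lookup (F p) (i, j) \<noteq> 0" for p c i j
    using arg_cong[OF KF'[OF that(1)], of "\<lambda>r. lookup r (i, j)"] that by (simp add: K scale)
  have q2: "q ^ 2 \<noteq> 1" using powi_eq_one_iff[of 2] by simp
  have "lookup (E (mon 0 1)) (0, 1) = 0"
    using wt_E[OF _ Ky, of 0 1] ne q2 by auto
  then have \<tau>: "lookup (E (mon 0 1)) (1, 0) \<noteq> 0" using E_y_linear by simp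
  then have \<alpha>\<beta>: "\<alpha> = q ^ 2 * \<beta>" using wt_E[OF _ Ky, of 1 0] by simp
  have rel: "mon 0 1 \<star> E (mon 1 0) + E (mon 0 1) \<star> scale \<alpha> (mon 1 0)
      = scale q (mon 1 0 \<star> E (mon 0 1) + E (mon 1 0) \<star> scale \<beta> (mon 0 1))"
  proof -
    have "E (mon 0 1 \<star> mon 1 0) = scale q (E (mon 1 0 \<star> mon 0 1))"
      unfolding y_x by (rule scale) simp
    then show ?thesis by (simp add: mult Kx Ky del: map_single)
  qed
  have "lookup (E (mon 0 1)) (1, 0) * \<alpha> = q * lookup (E (mon 0 1)) (1, 0)"
    using arg_cong[OF rel, of "\<lambda>p. lookup p (2, 0)"]
    by (simp add: tmul_linear lookup_add lookup_tmul_mon plane_lookup mult.commute del: map_single)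
  then have \<alpha>: "\<alpha> = q" using \<tau> by simp
  then have \<beta>: "\<beta> = inverse q" using \<alpha>\<beta> by (simp add: power2_eq_square field_simps)
  show "K (mon 1 0) = scale q (mon 1 0)"
    "K (mon 0 1) = scale (inverse q) (mon 0 1)"
    using Kx Ky by (simp_all add: \<alpha> \<beta>)
  show "K p = torus_k q p" if "p \<in> plane"
  proof (rule poly_mapping_eqI)
    fix u
    show "lookup (K p) u = lookup (torus_k q p) u"
      by (cases u) (simp add: K[OF that] lookup_torus_k \<alpha> \<beta> power_int_inverse power_int_diff divide_inverse)
  qed
qed

lemma K'_eq_torus_k: "p \<in> plane \<Longrightarrow> K' p = torus_k (inverse q) p"
  using KK'[of p] torus_k_inverse(1)[of q "K' p"] by (simp add: K_eq_torus_k)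

lemma weight_E:
  assumes "p \<in> plane" "K p = scale (q powi d) p" "lookup (E p) (i, j) \<noteq> 0"
  shows "i - j = d + 2"
proof -
  have "q powi (i - j) = q powi (d + 2)"
    using arg_cong[OF KE'[OF assms(1)], of "\<lambda>r. lookup r (i, j)"] assms
    by (simp add: scale K_eq_torus_k[of "E p"] lookup_torus_k power_int_add)
  then show ?thesis by (simp only: powi_eq_iff)
qed

lemma weight_F:
  assumes "p \<in> plane" "K p = scale (q powi d) p" "lookup (F p) (i, j) \<noteq> 0"
  shows "i - j = d - 2"
proof -
  have "q powi (i - j) = q powi (d - 2)"
    using arg_cong[OF KF'[OF assms(1)], of "\<lambda>r. lookup r (i, j)"] assms
    by (simp add: scale K_eq_torus_k[of "F p"] lookup_torus_k power_int_diff divide_inverse)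
  then show ?thesis by (simp only: powi_eq_iff)
qed

lemma K_gens_powi: "K (mon 1 0) = scale (q powi 1) (mon 1 0)"
  "K (mon 0 1) = scale (q powi (-1)) (mon 0 1)"
  using K_gens by (simp_all add: power_int_minus)

lemma support_E_x: "lookup (E (mon 1 0)) (i, j) \<noteq> 0 \<Longrightarrow> i - j = 3"
  and support_E_y: "lookup (E (mon 0 1)) (i, j) \<noteq> 0 \<Longrightarrow> i - j = 1"
  and support_F_x: "lookup (F (mon 1 0)) (i, j) \<noteq> 0 \<Longrightarrow> i - j = -1"
  and support_F_y: "lookup (F (mon 0 1)) (i, j) \<noteq> 0 \<Longrightarrow> i - j = -3"
  using weight_E[OF _ K_gens_powi(1), of i j] weight_E[OF _ K_gens_powi(2), of i j]
    weight_F[OF _ K_gens_powi(1), of i j] weight_F[OF _ K_gens_powi(2), of i j] by simp_all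

text \<open>
  Dividing the coefficients of \<open>e(y)\<close> by suitable factors produces a \<open>z\<close> for which the inner
  operator agrees with \<open>e\<close> at \<open>y\<close>.  The difference of the two operators obeys the same product
  rule and vanishes at \<open>y\<close>, so its value at \<open>x\<close> commutes with \<open>y\<close>.  That leaves only powers of \<open>y\<close>
  in this value; they do not occur in \<open>e(x)\<close> for reasons of weight, and not in the inner operator
  since every monomial of \<open>z\<close> contains a positive power of \<open>x\<close>.
\<close>

lemma E_inner:
  obtains z where "\<And>i j. lookup z (i, j) \<noteq> 0 \<Longrightarrow> i - j = 2 \<and> -1 \<le> j"
    and "\<And>p. p \<in> plane \<Longrightarrow> E p = inner_e q z p"
proof -
  \<comment> \<open>The coefficient of the inner operator at y is the one of z, shifted by (0, 1), times \<open>q\<^sup>-\<^sup>1 - q\<^sup>i\<close>; the division is harmless since i is nonnegative on the support.\<close>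
  define z where "z = Poly_Mapping.mapp (\<lambda>u c. c / (inverse q - q powi fst u)) (E (mon 0 1) \<star> mon 0 (-1))"
  have lookup_z: "lookup z (i, j) = lookup (E (mon 0 1)) (i, j + 1) / (inverse q - q powi i)" for i j
    by (simp add: z_def lookup_mapp lookup_tmul_mon when_def in_keys_iff)
  have z: "i - j = 2 \<and> -1 \<le> j" if "lookup z (i, j) \<noteq> 0" for i j
  proof -
    have "lookup (E (mon 0 1)) (i, j + 1) \<noteq> 0" using that by (auto simp: lookup_z)
    then show ?thesis using support_E_y plane_lookup[of "E (mon 0 1)" i "j + 1"] by fastforce
  qed
  have z0: "lookup z (i, j) = 0" if "i < 1" for i j
    using z[of i j] that by fastforce
  have y: "E (mon 0 1) = inner_e q z (mon 0 1)"
  proof (rule poly_mapping_eqI, clarify)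
    fix i j
    have r: "lookup (inner_e q z (mon 0 1)) (i, j)
        = (inverse q - q powi i) * lookup z (i, j - 1)"
      unfolding inner_e_def K_eq_torus_k[symmetric, of "mon 0 1", simplified] K_gens
      by (simp add: tmul_linear lookup_minus lookup_tmul_mon algebra_simps del: map_single)
    show "lookup (E (mon 0 1)) (i, j) = lookup (inner_e q z (mon 0 1)) (i, j)"
    proof (cases "i = -1")
      case True
      then show ?thesis unfolding r by (simp add: plane_lookup power_int_minus)
    next
      case False
      then have "inverse q - q powi i \<noteq> 0"
        using powi_eq_iff[of "-1" i] by (simp add: power_int_minus)
      then show ?thesis unfolding r lookup_z by simp
    qed
  qed
  define u where "u = E (mon 1 0) - inner_e q z (mon 1 0)"
  have Ky: "torus_k q (mon 0 1) = scale (inverse q) (mon 0 1)"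
    and Kx: "torus_k q (mon 1 0) = scale q (mon 1 0)"
    using K_gens K_eq_torus_k by simp_all
  have comm: "mon 0 1 \<star> u = u \<star> mon 0 1"
  proof -
    have "E (mon 0 1 \<star> mon 1 0) = scale q (E (mon 1 0 \<star> mon 0 1))"
      unfolding y_x by (rule scale) simp
    then have 1: "mon 0 1 \<star> E (mon 1 0) + E (mon 0 1) \<star> torus_k q (mon 1 0) = scale q
        (mon 1 0 \<star> E (mon 0 1) + E (mon 1 0) \<star> torus_k q (mon 0 1))"
      by (simp add: mult K_eq_torus_k)
    have "inner_e q z (mon 0 1 \<star> mon 1 0) = scale q (inner_e q z (mon 1 0 \<star> mon 0 1))"
      unfolding y_x by (rule inner_linear)
    then have 2: "mon 0 1 \<star> inner_e q z (mon 1 0) + E (mon 0 1) \<star> torus_k q (mon 1 0) = scale q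
        (mon 1 0 \<star> E (mon 0 1) + inner_e q z (mon 1 0) \<star> torus_k q (mon 0 1))"
      by (simp add: inner_e_mult y)
    have "mon 0 1 \<star> u = scale q (u \<star> torus_k q (mon 0 1))"
      using arg_cong2[OF 1 2, of "(-)"] by (simp add: u_def tmul_linear scale_diff scale_add)
    then show ?thesis unfolding Ky by (simp add: tmul_linear scale_scale del: map_single)
  qed
  have "u = 0"
  proof (rule poly_mapping_eqI, clarify)
    fix i j
    have *: "q powi i * lookup u (i, j) = lookup u (i, j)"
      using arg_cong[OF comm, of "\<lambda>p. lookup p (i, j + 1)"] by (simp add: lookup_tmul_mon)
    show "lookup u (i, j) = lookup 0 (i, j)"
    proof (cases "i = 0")
      case True
      have "lookup (E (mon 1 0)) (0, j) = 0"
        using support_E_x[of 0 j] plane_lookup[of "E (mon 1 0)" 0 j] by fastforce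
      moreover have "lookup (inner_e q z (mon 1 0)) (0, j) = 0"
        unfolding inner_e_def Kx
        by (simp add: tmul_linear lookup_minus lookup_tmul_mon z0 del: map_single)
      ultimately show ?thesis by (simp add: u_def lookup_minus True)
    next
      case False
      then show ?thesis using * powi_eq_one_iff[of i] by simp
    qed
  qed
  then have x: "E (mon 1 0) = inner_e q z (mon 1 0)" by (simp add: u_def)
  have "E p = inner_e q z p" if "p \<in> plane" for p
    using that
  proof (induction p rule: plane_induct)
    case one
    show ?case using E_one by (simp add: inner_e_def torus_k_single)
  qed (simp_all add: x y add scale inner_linear mult inner_e_mult K_eq_torus_k)
  then show thesis using z that by blast
qed

text \<open>
  The same argument with the roles of \<open>x\<close> and \<open>y\<close> exchanged.
\<close>

lemma F_inner:
  obtains w where "\<And>i j. lookup w (i, j) \<noteq> 0 \<Longrightarrow> i - j = -2 \<and> -1 \<le> i"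
    and "\<And>p. p \<in> plane \<Longrightarrow> F p = inner_f q w p"
proof -
  \<comment> \<open>Here the shift is by (1, 0) and the factor \<open>q\<^sup>j - q\<^sup>-\<^sup>1\<close>.\<close>
  define w where "w = Poly_Mapping.mapp (\<lambda>u c. c / (q powi snd u - inverse q)) (mon (-1) 0 \<star> F (mon 1 0))"
  have lookup_w: "lookup w (i, j) = lookup (F (mon 1 0)) (i + 1, j) / (q powi j - inverse q)" for i j
    by (simp add: w_def lookup_mapp lookup_tmul_mon when_def in_keys_iff)
  have w: "i - j = -2 \<and> -1 \<le> i" if "lookup w (i, j) \<noteq> 0" for i j
  proof -
    have "lookup (F (mon 1 0)) (i + 1, j) \<noteq> 0" using that by (auto simp: lookup_w)
    then show ?thesis using support_F_x plane_lookup[of "F (mon 1 0)" "i + 1" j] by fastforce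
  qed
  have w0: "lookup w (i, j) = 0" if "j < 1" for i j
    using w[of i j] that by fastforce
  have Ky: "torus_k (inverse q) (mon 0 1) = scale q (mon 0 1)"
    and Kx: "torus_k (inverse q) (mon 1 0) = scale (inverse q) (mon 1 0)"
    by (simp_all add: torus_k_single power_int_minus)
  have x: "F (mon 1 0) = inner_f q w (mon 1 0)"
  proof (rule poly_mapping_eqI, clarify)
    fix i j
    have r: "lookup (inner_f q w (mon 1 0)) (i, j)
        = (q powi j - inverse q) * lookup w (i - 1, j)"
      unfolding inner_f_def Kx
      by (simp add: tmul_linear lookup_minus lookup_tmul_mon algebra_simps del: map_single)
    show "lookup (F (mon 1 0)) (i, j) = lookup (inner_f q w (mon 1 0)) (i, j)"
    proof (cases "j = -1")
      case True
      then show ?thesis unfolding r by (simp add: plane_lookup power_int_minus)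
    next
      case False
      then have "q powi j - inverse q \<noteq> 0"
        using powi_eq_iff[of j "-1"] by (simp add: power_int_minus)
      then show ?thesis unfolding r lookup_w by simp
    qed
  qed
  define u where "u = F (mon 0 1) - inner_f q w (mon 0 1)"
  have comm: "u \<star> mon 1 0 = mon 1 0 \<star> u"
  proof -
    have "F (mon 0 1 \<star> mon 1 0) = scale q (F (mon 1 0 \<star> mon 0 1))"
      unfolding y_x by (rule scale) simp
    then have 1: "F (mon 0 1) \<star> mon 1 0 + torus_k (inverse q) (mon 0 1) \<star> F (mon 1 0) = scale q
        (F (mon 1 0) \<star> mon 0 1 + torus_k (inverse q) (mon 1 0) \<star> F (mon 0 1))"
      by (simp add: mult K'_eq_torus_k)
    have "inner_f q w (mon 0 1 \<star> mon 1 0) = scale q (inner_f q w (mon 1 0 \<star> mon 0 1))"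
      unfolding y_x by (rule inner_linear)
    then have 2: "inner_f q w (mon 0 1) \<star> mon 1 0 + torus_k (inverse q) (mon 0 1) \<star> F (mon 1 0) = scale q
        (F (mon 1 0) \<star> mon 0 1 + torus_k (inverse q) (mon 1 0) \<star> inner_f q w (mon 0 1))"
      by (simp add: inner_f_mult x)
    have "u \<star> mon 1 0 = scale q (torus_k (inverse q) (mon 1 0) \<star> u)"
      using arg_cong2[OF 1 2, of "(-)"] by (simp add: u_def tmul_linear scale_diff scale_add)
    then show ?thesis unfolding Kx by (simp add: tmul_linear scale_scale del: map_single)
  qed
  have "u = 0"
  proof (rule poly_mapping_eqI, clarify)
    fix i j
    have *: "q powi j * lookup u (i, j) = lookup u (i, j)"
      using arg_cong[OF comm, of "\<lambda>p. lookup p (i + 1, j)"] by (simp add: lookup_tmul_mon)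
    show "lookup u (i, j) = lookup 0 (i, j)"
    proof (cases "j = 0")
      case True
      have "lookup (F (mon 0 1)) (i, 0) = 0"
        using support_F_y[of i 0] plane_lookup[of "F (mon 0 1)" i 0] by fastforce
      moreover have "lookup (inner_f q w (mon 0 1)) (i, 0) = 0"
        unfolding inner_f_def Ky
        by (simp add: tmul_linear lookup_minus lookup_tmul_mon w0 del: map_single)
      ultimately show ?thesis by (simp add: u_def lookup_minus True)
    next
      case False
      then show ?thesis using * powi_eq_one_iff[of j] by simp
    qed
  qed
  then have y: "F (mon 0 1) = inner_f q w (mon 0 1)" by (simp add: u_def)
  have "F p = inner_f q w p" if "p \<in> plane" for p
    using that
  proof (induction p rule: plane_induct)
    case one
    show ?case using F_one by (simp add: inner_f_def torus_k_single)
  qed (simp_all add: x y add scale inner_linear mult inner_f_mult K'_eq_torus_k)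
  then show thesis using w that by blast
qed

lemma linear_classification:
  "\<exists>\<tau>. \<tau> \<noteq> 0 \<and> E (mon 1 0) = 0 \<and> E (mon 0 1) = scale \<tau> (mon 1 0) \<and>
     F (mon 1 0) = scale (inverse \<tau>) (mon 0 1) \<and> F (mon 0 1) = 0"
proof -
  obtain z where z: "\<And>i j. lookup z (i, j) \<noteq> 0 \<Longrightarrow> i - j = 2 \<and> -1 \<le> j"
    and E: "\<And>p. p \<in> plane \<Longrightarrow> E p = inner_e q z p" using E_inner by blast
  obtain w where w: "\<And>i j. lookup w (i, j) \<noteq> 0 \<Longrightarrow> i - j = -2 \<and> -1 \<le> i"
    and F: "\<And>p. p \<in> plane \<Longrightarrow> F p = inner_f q w p" using F_inner by blast
  define \<kappa> where "\<kappa> = 1 / (q - inverse q)"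
  define c where "c = scale (inverse (q ^ 2)) (z \<star> w) - w \<star> z"
  have zK: "torus_k q z = scale (q ^ 2) z"
    using torus_k_homogeneous[of z 2 q] z by simp
  have wK: "torus_k q w = scale (inverse (q ^ 2)) w"
    using torus_k_homogeneous[of w "-2" q] w by (simp add: power_int_minus)
  have key_z: "-1 \<le> snd u" "fst u - snd u = 2" if "u \<in> keys z" for u
    using z[of "fst u" "snd u"] that by (simp_all add: in_keys_iff)
  have key_w: "1 \<le> snd u" "fst u - snd u = -2" if "u \<in> keys w" for u
    using w[of "fst u" "snd u"] that by (simp_all add: in_keys_iff)
  have key_zw: "lookup (z \<star> w) (i, j) = 0" "lookup (w \<star> z) (i, j) = 0"
    if "j < 0" for i j
  proof -
    have "(i, j) \<notin> keys (z \<star> w)"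
      using that key_z key_w by (fastforce elim!: keys_tmul simp: prod_eq_iff)
    moreover have "(i, j) \<notin> keys (w \<star> z)"
      using that key_z key_w by (fastforce elim!: keys_tmul simp: prod_eq_iff)
    ultimately show "lookup (z \<star> w) (i, j) = 0" "lookup (w \<star> z) (i, j) = 0"
      by (simp_all add: in_keys_iff)
  qed
  \<comment> \<open>Comparing with the prescribed commutator at x shows that c differs from the constant by an element d with d k(x) = k'(x) d; every monomial of such a d has y-exponent -2, which the supports of z and w rule out.\<close>
  have c_eq: "c = single (0, 0) \<kappa>"
  proof -
    define d where "d = c - scale \<kappa> (mon 0 0)"
    have x: "torus_k q (mon 1 0) = scale q (mon 1 0)"
      "torus_k (inverse q) (mon 1 0) = scale (inverse q) (mon 1 0)"
      by (simp_all add: torus_k_single)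
    have "inner_e q z (inner_f q w (mon 1 0)) = inner_f q w (inner_e q z (mon 1 0))
        + (scale \<kappa> (torus_k q (mon 1 0)) + scale (- \<kappa>) (torus_k (inverse q) (mon 1 0)))"
      using EF[of "mon 1 0"] by (simp add: \<kappa>_def K_eq_torus_k K'_eq_torus_k flip: E F del: map_single)
    then have "c \<star> torus_k q (mon 1 0) - torus_k (inverse q) (mon 1 0) \<star> c
        = scale \<kappa> (torus_k q (mon 1 0)) + scale (- \<kappa>) (torus_k (inverse q) (mon 1 0))"
      unfolding inner_commutator[OF zK wK, of "mon 1 0", folded c_def, symmetric] by simp
    moreover have "scale (- \<kappa>) p = - scale \<kappa> p" for p :: laurent
      by (rule poly_mapping_eqI) simp
    ultimately have d: "d \<star> torus_k q (mon 1 0) = torus_k (inverse q) (mon 1 0) \<star> d"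
      by (simp add: d_def tmul_linear algebra_simps del: map_single)
    have "d = 0"
    proof (rule poly_mapping_eqI, clarify)
      fix i j
      have *: "q * (q powi j * lookup d (i, j)) = inverse q * lookup d (i, j)"
        using arg_cong[OF d, of "\<lambda>p. lookup p (i + 1, j)"] unfolding x
        by (simp add: tmul_linear lookup_tmul_mon del: map_single)
      show "lookup d (i, j) = lookup 0 (i, j)"
      proof (cases "j = -2")
        case True
        then show ?thesis
          by (simp add: d_def c_def lookup_minus key_zw lookup_single when_def)
      next
        case False
        then have "q powi (1 + j) \<noteq> q powi (-1)" by (simp only: powi_eq_iff)
        then have "q * q powi j \<noteq> inverse q" by (simp add: power_int_add power_int_minus)
        then show ?thesis using * by (auto simp flip: mult.assoc)
      qed
    qed
    then show ?thesis by (simp add: d_def)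
  qed
  have \<kappa>: "\<kappa> \<noteq> 0" using q_minus_inverse by (simp add: \<kappa>_def)
  have "z \<noteq> 0" "w \<noteq> 0"
    using c_eq \<kappa> by (auto simp: c_def)
  then obtain u v where u: "is_lead z u" and v: "is_lead w v" by (meson ex_lead)
  have uk: "u \<in> keys z" and vk: "v \<in> keys w"
    using u v by (simp_all add: is_lead_def)
  have "lookup c (u + v) = (inverse (q ^ 2) * twist q u v - twist q v u)
      * (lookup z u * lookup w v)"
    using lookup_lead_tmul[OF u v] lookup_lead_tmul[OF v u]
    by (simp add: c_def lookup_minus add.commute algebra_simps)
  moreover have "inverse (q ^ 2) * twist q u v - twist q v u \<noteq> 0"
  proof -
    \<comment> \<open>The two powers of q below have exponents that differ by 2(m + n + 1).\<close>
    define m n where "m = snd u + 1" and "n = snd v - 1"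
    have mn: "0 \<le> m" "0 \<le> n" using key_z(1)[OF uk] key_w(1)[OF vk] by (simp_all add: m_def n_def)
    have uv: "u = (m + 1, m - 1)" "v = (n - 1, n + 1)"
      using key_z(2)[OF uk] key_w(2)[OF vk] by (simp_all add: m_def n_def prod_eq_iff)
    have "-2 + (m - 1) * (n - 1) < (n + 1) * (m + 1)"
      using mn by (simp add: algebra_simps)
    then have "q powi (-2 + (m - 1) * (n - 1)) \<noteq> q powi ((n + 1) * (m + 1))"
      by (simp only: powi_eq_iff)
    moreover have "q powi (-2 + (m - 1) * (n - 1)) = inverse (q ^ 2) * q powi ((m - 1) * (n - 1))"
      by (subst power_int_add) (simp_all add: power_int_minus)
    ultimately show ?thesis by (simp add: uv twist_def)
  qed
  ultimately have "lookup c (u + v) \<noteq> 0"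
    using uk vk by (simp add: in_keys_iff)
  then have "u + v = 0"
    unfolding c_eq by (auto simp: lookup_single when_def zero_prod_def split: if_splits)
  then have uv: "u = (1, -1)" "v = (-1, 1)"
    using key_z[OF uk] key_w[OF vk] by (auto simp: prod_eq_iff)
  have sqrt2: "0 < sqrt 2" by simp
  have z_keys: "keys z \<subseteq> {(1, -1)}"
  proof
    fix t assume t: "t \<in> keys z"
    have f: "fst t = snd t + 2" "-1 \<le> snd t" using key_z[OF t] by simp_all
    have "weight t \<le> weight u" using u t by (simp add: is_lead_def)
    then have "(1 + sqrt 2) * (real_of_int (snd t) + 1) \<le> 0"
      by (simp add: weight_def uv f algebra_simps)
    then have "real_of_int (snd t) + 1 \<le> 0" using sqrt2 by (simp add: mult_le_0_iff)
    then have "snd t = -1" using f by linarith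
    then show "t \<in> {(1, -1)}" using f by (simp add: prod_eq_iff)
  qed
  have w_keys: "keys w \<subseteq> {(-1, 1)}"
  proof
    fix t assume t: "t \<in> keys w"
    have f: "fst t = snd t - 2" "1 \<le> snd t" using key_w[OF t] by simp_all
    have "weight t \<le> weight v" using v t by (simp add: is_lead_def)
    then have "(1 + sqrt 2) * (real_of_int (snd t) - 1) \<le> 0"
      by (simp add: weight_def uv f algebra_simps)
    then have "real_of_int (snd t) - 1 \<le> 0" using sqrt2 by (simp add: mult_le_0_iff)
    then have "snd t = 1" using f by linarith
    then show "t \<in> {(-1, 1)}" using f by (simp add: prod_eq_iff)
  qed
  define l m where "l = lookup z (1, -1)" and "m = lookup w (-1, 1)"
  have zl: "z = single (1, -1) l"
    by (subst sum_singles_superset[OF _ z_keys]) (simp_all add: l_def)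
  have wm: "w = single (-1, 1) m"
    by (subst sum_singles_superset[OF _ w_keys]) (simp_all add: m_def)
  have "(inverse (q ^ 2) * q) * (l * m) - q * (m * l) = \<kappa>"
    using arg_cong[OF c_eq, of "\<lambda>p. lookup p (0, 0)"]
    by (simp add: c_def zl wm tmul_single twist_def lookup_minus mult.assoc)
  moreover have "inverse (q ^ 2) * q = inverse q" by (simp add: power2_eq_square)
  ultimately have lm: "l * (inverse q - q) * m = \<kappa>" by (simp add: algebra_simps)
  define \<tau> where "\<tau> = l * (inverse q - q)"
  have "\<tau> * (m * (q - inverse q)) = 1"
    using lm q_minus_inverse by (simp add: \<tau>_def \<kappa>_def field_simps)
  then have inv: "\<tau> \<noteq> 0" "m * (q - inverse q) = inverse \<tau>"
    by (auto simp: inverse_unique)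
  show ?thesis
  proof (intro exI[of _ \<tau>] conjI inv(1))
    show "E (mon 1 0) = 0" "F (mon 0 1) = 0"
      by (simp_all add: E F zl wm inner_single_values)
    show "E (mon 0 1) = scale \<tau> (mon 1 0)"
      by (simp add: E zl inner_single_values \<tau>_def)
    show "F (mon 1 0) = scale (inverse \<tau>) (mon 0 1)"
      by (simp add: F wm inner_single_values inv(2))
  qed
qed

end

section \<open>Coordinates on the quantum plane\<close>

lemma calg_quantum_plane: "calg (quantum_plane q)"
  unfolding quantum_plane_def by (rule calg_pres_alg)

lemma qp_relation_iff_eval:
  assumes B: "calg B" and v: "\<And>g. v g \<in> carrier B"
  shows "(\<forall>r\<in>qp_rels q. free_eval B v r = \<zero>\<^bsub>B\<^esub>) \<longleftrightarrow> v Gy \<otimes>\<^bsub>B\<^esub> v Gx = q \<odot>\<^bsub>B\<^esub> (v Gx \<otimes>\<^bsub>B\<^esub> v Gy)"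
proof -
  interpret B: calg B by fact
  have c: "word_val B v \<in> UNIV \<rightarrow> carrier B"
    by (auto simp: B.word_val_closed[OF v])
  have s: "free_eval B v (single w a) = a \<odot>\<^bsub>B\<^esub> word_val B v w" for w a
    by (simp add: B.word_val_closed[OF v])
  show ?thesis
    using v unfolding qp_rels_def
    by (simp add: B.lin_ext_diff[OF c subset_UNIV subset_UNIV] s B.add_neg_eq_zero_iff del: B.lin_ext_single)
qed

lemma qp_gen_closed [simp]: "qp_x q \<in> carrier (quantum_plane q)" "qp_y q \<in> carrier (quantum_plane q)"
  by (simp_all add: qp_x_def qp_y_def quantum_plane_def pres_gen_closed)

lemma qp_relation: "qp_y q \<otimes>\<^bsub>quantum_plane q\<^esub> qp_x q = q \<odot>\<^bsub>quantum_plane q\<^esub> (qp_x q \<otimes>\<^bsub>quantum_plane q\<^esub> qp_y q)"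
  unfolding qp_x_def qp_y_def quantum_plane_def
  by (subst qp_relation_iff_eval[OF calg_pres_alg, symmetric]) (simp_all add: pres_gen_rel)

lemma qp_induct [consumes 1, case_names one x y add mult smult]:
  assumes "a \<in> carrier (quantum_plane q)"
    and "P \<one>\<^bsub>quantum_plane q\<^esub>" and "P (qp_x q)" and "P (qp_y q)"
    and "\<And>a b. a \<in> carrier (quantum_plane q) \<Longrightarrow> b \<in> carrier (quantum_plane q) \<Longrightarrow> P a \<Longrightarrow> P b \<Longrightarrow> P (a \<oplus>\<^bsub>quantum_plane q\<^esub> b)"
    and "\<And>a b. a \<in> carrier (quantum_plane q) \<Longrightarrow> b \<in> carrier (quantum_plane q) \<Longrightarrow> P a \<Longrightarrow> P b \<Longrightarrow> P (a \<otimes>\<^bsub>quantum_plane q\<^esub> b)"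
    and "\<And>c a. a \<in> carrier (quantum_plane q) \<Longrightarrow> P a \<Longrightarrow> P (c \<odot>\<^bsub>quantum_plane q\<^esub> a)"
  shows "P a"
  using assms(1) unfolding quantum_plane_def
proof (induction a rule: pres_alg_induct)
  case (gen g)
  show ?case using assms(3,4) by (cases g) (simp_all add: qp_x_def qp_y_def)
qed (use assms in \<open>simp_all add: quantum_plane_def\<close>)

lemma qp_hom_exists:
  assumes "calg B" "x \<in> carrier B" "y \<in> carrier B" "y \<otimes>\<^bsub>B\<^esub> x = q \<odot>\<^bsub>B\<^esub> (x \<otimes>\<^bsub>B\<^esub> y)"
  shows "\<exists>h. alg_map (quantum_plane q) B h \<and> h (qp_x q) = x \<and> h (qp_y q) = y"
proof -
  define v where "v = case_qp_gen x y"
  have v: "v g \<in> carrier B" for g using assms by (cases g) (simp_all add: v_def)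
  have "\<forall>r\<in>qp_rels q. free_eval B v r = \<zero>\<^bsub>B\<^esub>"
    unfolding qp_relation_iff_eval[OF assms(1) v] using assms(4) by (simp add: v_def)
  note hom = pres_hom_eval[OF assms(1) v bspec[OF this]]
  show ?thesis
    using hom(1) hom(3)[where g = Gx] hom(3)[where g = Gy] unfolding quantum_plane_def qp_x_def qp_y_def
    by (auto simp: v_def)
qed

text \<open>
  Used in both directions: to classify, the operators are carried from the plane to the model;
  to construct, they are carried back.
\<close>

lemma sl2_action_transfer:
  assumes act: "sl2_action A q K K' E F" and B: "calg B"
    and \<phi>: "alg_map A B \<phi>" and \<psi>: "alg_map B A \<psi>"
    and \<psi>\<phi>: "\<And>a. a \<in> carrier A \<Longrightarrow> \<psi> (\<phi> a) = a" and \<phi>\<psi>: "\<And>b. b \<in> carrier B \<Longrightarrow> \<phi> (\<psi> b) = b"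
  shows "sl2_action B q (\<lambda>b. \<phi> (K (\<psi> b))) (\<lambda>b. \<phi> (K' (\<psi> b))) (\<lambda>b. \<phi> (E (\<psi> b))) (\<lambda>b. \<phi> (F (\<psi> b)))"
proof -
  interpret A: sl2_action A q K K' E F by fact
  have A: "calg A" by (rule A.calg_axioms)
  have c: "\<psi> b \<in> carrier A" if "b \<in> carrier B" for b by (rule alg_map_closed[OF \<psi> that])
  have op: "K a \<in> carrier A" "K' a \<in> carrier A" "E a \<in> carrier A" "F a \<in> carrier A" if "a \<in> carrier A" for a
    using A.linear[THEN lin_map_closed] that by simp_all
  have lin: "lin_map B B (\<lambda>b. \<phi> (G (\<psi> b)))" if "lin_map A A G" for G
    using lin_map_closed[OF that]
    by (intro lin_mapI)
       (simp_all add: c alg_mapD[OF \<phi>] alg_mapD[OF \<psi>] lin_map_add[OF that] lin_map_smult[OF that])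
  show ?thesis
  proof (intro sl2_action.intro B sl2_action_axioms.intro lin A.linear)
    show "\<phi> (E (\<psi> \<one>\<^bsub>B\<^esub>)) = \<zero>\<^bsub>B\<^esub>" "\<phi> (F (\<psi> \<one>\<^bsub>B\<^esub>)) = \<zero>\<^bsub>B\<^esub>"
      by (simp_all add: alg_map_one[OF \<psi>] A.E_one A.F_one lin_map_zero[OF A B alg_map_lin[OF \<phi>]])
  qed (simp_all add: c op \<psi>\<phi> \<phi>\<psi> alg_mapD[OF \<phi>] alg_mapD[OF \<psi>] A.K'K A.KK' A.KE A.KF A.EF
      A.K_mult A.K'_mult A.E_mult A.F_mult A.K_one A.K'_one)
qed

context generic_q
begin

abbreviation (input) "A \<equiv> quantum_plane q"

interpretation A: calg A by (rule calg_quantum_plane)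
interpretation M: calg "qp_model q" by (rule calg_qp_model) simp

text \<open>
  Coordinates with respect to the monomials: the homomorphism to the model given by the
  universal property of the plane.
\<close>

definition coord :: "qp_elem \<Rightarrow> laurent" where
  "coord = (SOME h. alg_map A (qp_model q) h \<and> h (qp_x q) = mon 1 0 \<and> h (qp_y q) = mon 0 1)"

lemma coord: "alg_map A (qp_model q) coord" "coord (qp_x q) = mon 1 0" "coord (qp_y q) = mon 0 1"
proof -
  have "\<exists>h. alg_map A (qp_model q) h \<and> h (qp_x q) = mon 1 0 \<and> h (qp_y q) = mon 0 1"
    by (rule qp_hom_exists[OF M.calg_axioms]) (simp_all add: tmul_single twist_def)
  from someI_ex[OF this, folded coord_def]
  show "alg_map A (qp_model q) coord" "coord (qp_x q) = mon 1 0" "coord (qp_y q) = mon 0 1" by simp_all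
qed

lemma coord_simps [simp]:
  "a \<in> carrier A \<Longrightarrow> coord a \<in> plane"
  "a \<in> carrier A \<Longrightarrow> b \<in> carrier A \<Longrightarrow> coord (a \<oplus>\<^bsub>A\<^esub> b) = coord a + coord b"
  "a \<in> carrier A \<Longrightarrow> coord (c \<odot>\<^bsub>A\<^esub> a) = scale c (coord a)"
  "coord \<one>\<^bsub>A\<^esub> = mon 0 0"
  "a \<in> carrier A \<Longrightarrow> b \<in> carrier A \<Longrightarrow> coord (a \<otimes>\<^bsub>A\<^esub> b) = coord a \<star> coord b"
  "coord \<zero>\<^bsub>A\<^esub> = 0"
  using alg_mapD[OF coord(1)] lin_map_zero[OF A.calg_axioms M.calg_axioms alg_map_lin[OF coord(1)]]
  by simp_all

abbreviation (input) expmono :: "int \<times> int \<Rightarrow> qp_elem" where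
  "expmono u \<equiv> qp_mono q (nat (fst u)) (nat (snd u))"

definition of_coord :: "laurent \<Rightarrow> qp_elem" where
  "of_coord = lin_ext A expmono"

lemma qp_mono_closed [simp]: "qp_mono q m n \<in> carrier A"
  by (simp add: qp_mono_def)

lemma coord_mono: "coord (qp_mono q m n) = mon (int m) (int n)"
proof -
  have x: "coord (qp_x q [^]\<^bsub>A\<^esub> m) = mon (int m) 0"
    by (induction m) (simp_all add: coord tmul_single twist_def add.commute)
  have y: "coord (qp_y q [^]\<^bsub>A\<^esub> n) = mon 0 (int n)"
    by (induction n) (simp_all add: coord tmul_single twist_def add.commute)
  show ?thesis by (simp add: qp_mono_def x y tmul_single twist_def)
qed

lemma qp_mono_mult:
  "qp_mono q m n \<otimes>\<^bsub>A\<^esub> qp_mono q r s = (q ^ (n * r)) \<odot>\<^bsub>A\<^esub> qp_mono q (m + r) (n + s)"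
proof -
  have y_x: "qp_y q [^]\<^bsub>A\<^esub> n \<otimes>\<^bsub>A\<^esub> qp_x q = (q ^ n) \<odot>\<^bsub>A\<^esub> (qp_x q \<otimes>\<^bsub>A\<^esub> qp_y q [^]\<^bsub>A\<^esub> n)" for n
  proof (induction n)
    case (Suc n)
    have "qp_y q [^]\<^bsub>A\<^esub> Suc n \<otimes>\<^bsub>A\<^esub> qp_x q = q \<odot>\<^bsub>A\<^esub> (qp_y q [^]\<^bsub>A\<^esub> n \<otimes>\<^bsub>A\<^esub> qp_x q \<otimes>\<^bsub>A\<^esub> qp_y q)"
      by (simp add: A.m_assoc qp_relation A.smult_mult_r)
    also have "\<dots> = (q ^ Suc n) \<odot>\<^bsub>A\<^esub> (qp_x q \<otimes>\<^bsub>A\<^esub> qp_y q [^]\<^bsub>A\<^esub> Suc n)"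
      by (simp add: Suc A.smult_mult_l A.m_assoc flip: A.smult_assoc)
    finally show ?case .
  qed simp
  have y_xr: "qp_y q [^]\<^bsub>A\<^esub> n \<otimes>\<^bsub>A\<^esub> qp_x q [^]\<^bsub>A\<^esub> r = (q ^ (n * r)) \<odot>\<^bsub>A\<^esub> (qp_x q [^]\<^bsub>A\<^esub> r \<otimes>\<^bsub>A\<^esub> qp_y q [^]\<^bsub>A\<^esub> n)"
  proof (induction r)
    case (Suc r)
    have "qp_y q [^]\<^bsub>A\<^esub> n \<otimes>\<^bsub>A\<^esub> qp_x q [^]\<^bsub>A\<^esub> Suc r
        = (q ^ (n * r)) \<odot>\<^bsub>A\<^esub> (qp_x q [^]\<^bsub>A\<^esub> r \<otimes>\<^bsub>A\<^esub> (qp_y q [^]\<^bsub>A\<^esub> n \<otimes>\<^bsub>A\<^esub> qp_x q))"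
      by (simp add: Suc A.smult_mult_l flip: A.m_assoc)
    also have "\<dots> = (q ^ (n * Suc r)) \<odot>\<^bsub>A\<^esub> (qp_x q [^]\<^bsub>A\<^esub> Suc r \<otimes>\<^bsub>A\<^esub> qp_y q [^]\<^bsub>A\<^esub> n)"
      by (simp add: y_x A.smult_mult_r A.m_assoc power_add mult.commute flip: A.smult_assoc)
    finally show ?case .
  qed simp
  have "qp_mono q m n \<otimes>\<^bsub>A\<^esub> qp_mono q r s
      = qp_x q [^]\<^bsub>A\<^esub> m \<otimes>\<^bsub>A\<^esub> (qp_y q [^]\<^bsub>A\<^esub> n \<otimes>\<^bsub>A\<^esub> qp_x q [^]\<^bsub>A\<^esub> r) \<otimes>\<^bsub>A\<^esub> qp_y q [^]\<^bsub>A\<^esub> s"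
    by (simp add: qp_mono_def A.m_assoc)
  also have "\<dots> = (q ^ (n * r)) \<odot>\<^bsub>A\<^esub> ((qp_x q [^]\<^bsub>A\<^esub> m \<otimes>\<^bsub>A\<^esub> qp_x q [^]\<^bsub>A\<^esub> r) \<otimes>\<^bsub>A\<^esub> (qp_y q [^]\<^bsub>A\<^esub> n \<otimes>\<^bsub>A\<^esub> qp_y q [^]\<^bsub>A\<^esub> s))"
    by (simp add: y_xr A.smult_mult_l A.smult_mult_r A.m_assoc)
  finally show ?thesis by (simp add: qp_mono_def A.nat_pow_mult)
qed

lemma of_coord_single: "of_coord (single u c) = c \<odot>\<^bsub>A\<^esub> expmono u"
  by (simp add: of_coord_def)

lemma of_coord_add: "of_coord (p + r) = of_coord p \<oplus>\<^bsub>A\<^esub> of_coord r"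
  unfolding of_coord_def by (rule A.lin_ext_add[of _ UNIV]) auto

lemma of_coord_scale: "of_coord (scale c p) = c \<odot>\<^bsub>A\<^esub> of_coord p"
  unfolding of_coord_def by (rule A.lin_ext_scale) auto

lemma of_coord_closed [simp]: "of_coord p \<in> carrier A"
  unfolding of_coord_def by (rule A.lin_ext_closed) auto

lemma of_coord_zero [simp]: "of_coord 0 = \<zero>\<^bsub>A\<^esub>"
  by (simp add: of_coord_def)

lemma of_coord_mult:
  assumes "p \<in> plane" "r \<in> plane"
  shows "of_coord (p \<star> r) = of_coord p \<otimes>\<^bsub>A\<^esub> of_coord r"
proof -
  have "keys p \<subseteq> quadrant" using assms(1) by (simp add: plane_def)
  then show ?thesis
  proof (induction p rule: pm_support_induct)
    case (single u c)
    have "keys r \<subseteq> quadrant" using assms(2) by (simp add: plane_def)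
    then show ?case
    proof (induction r rule: pm_support_induct)
      case (single v d)
      have uv: "nat (fst u + fst v) = nat (fst u) + nat (fst v)" "nat (snd u + snd v) = nat (snd u) + nat (snd v)"
        using single \<open>u \<in> quadrant\<close> by (simp_all add: quadrant_def nat_add_distrib)
      have tw: "twist q u v = q ^ (nat (snd u) * nat (fst v))"
        using single \<open>u \<in> quadrant\<close>
        by (simp add: quadrant_def twist_def power_int_def nat_mult_distrib)
      show ?case
        by (simp add: tmul_single of_coord_single A.smult_mult_l A.smult_mult_r qp_mono_mult uv tw
            flip: A.smult_assoc) (simp add: ac_simps)
    qed (simp_all add: tmul_add_right of_coord_add A.r_distr)
  qed (simp_all add: tmul_add_left of_coord_add A.l_distr)
qed

lemma of_coord_hom: "alg_map (qp_model q) A of_coord"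
  by (intro alg_mapI lin_mapI)
     (simp_all add: of_coord_add of_coord_scale of_coord_mult of_coord_single qp_mono_def)

lemma coord_of_coord [simp]: "p \<in> plane \<Longrightarrow> coord (of_coord p) = p"
proof -
  assume "p \<in> plane"
  then have "keys p \<subseteq> quadrant" by (simp add: plane_def)
  then show ?thesis
    by (induction p rule: pm_support_induct)
       (simp_all add: of_coord_single of_coord_add coord_mono quadrant_def)
qed

lemma of_coord_coord [simp]: "a \<in> carrier A \<Longrightarrow> of_coord (coord a) = a"
proof (induction a rule: qp_induct)
  case one
  show ?case by (simp add: of_coord_single qp_mono_def)
qed (simp_all add: coord of_coord_single qp_mono_def of_coord_add of_coord_mult of_coord_scale)

lemma coord_inj: "a \<in> carrier A \<Longrightarrow> b \<in> carrier A \<Longrightarrow> coord a = coord b \<longleftrightarrow> a = b"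
  by (metis of_coord_coord)

subsection \<open>Homogeneous components\<close>

text \<open>
  Spans of monomials become conditions on the support of coordinates; in particular, the components
  of different degrees are independent.
\<close>

lemma lin_span_mono:
  "a \<in> lin_span A {qp_mono q m n | m n. P m n} \<longleftrightarrow>
    a \<in> carrier A \<and> (\<forall>i j. lookup (coord a) (i, j) \<noteq> 0 \<longrightarrow> P (nat i) (nat j))"
proof
  assume "a \<in> lin_span A {qp_mono q m n | m n. P m n}"
  then obtain S c where S: "finite S" "S \<subseteq> {qp_mono q m n | m n. P m n}" and a: "a = (\<Oplus>\<^bsub>A\<^esub>b\<in>S. c b \<odot>\<^bsub>A\<^esub> b)"
    unfolding lin_span_def by auto
  have "(\<Oplus>\<^bsub>A\<^esub>b\<in>S. c b \<odot>\<^bsub>A\<^esub> b) \<in> carrier A \<and>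
      (\<forall>i j. lookup (coord (\<Oplus>\<^bsub>A\<^esub>b\<in>S. c b \<odot>\<^bsub>A\<^esub> b)) (i, j) \<noteq> 0 \<longrightarrow> P (nat i) (nat j))"
    using S
  proof (induction S)
    case (insert b S)
    obtain m n where b: "b = qp_mono q m n" "P m n" using insert.prems by auto
    have "S \<subseteq> carrier A" using insert.prems by auto
    then have "(\<Oplus>\<^bsub>A\<^esub>b\<in>insert b S. c b \<odot>\<^bsub>A\<^esub> b) = c b \<odot>\<^bsub>A\<^esub> b \<oplus>\<^bsub>A\<^esub> (\<Oplus>\<^bsub>A\<^esub>b\<in>S. c b \<odot>\<^bsub>A\<^esub> b)"
      using insert.hyps b by (intro A.finsum_insert) auto
    then show ?case using insert b
      by (auto simp: coord_mono lookup_add lookup_single when_def)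
  qed simp
  then show "a \<in> carrier A \<and> (\<forall>i j. lookup (coord a) (i, j) \<noteq> 0 \<longrightarrow> P (nat i) (nat j))"
    by (simp add: a)
next
  assume a: "a \<in> carrier A \<and> (\<forall>i j. lookup (coord a) (i, j) \<noteq> 0 \<longrightarrow> P (nat i) (nat j))"
  let ?k = "keys (coord a)"
  have k: "?k \<subseteq> quadrant" using a coord_simps(1)[of a] by (simp add: plane_def)
  have inj: "inj_on expmono ?k"
  proof (rule inj_onI)
    fix u v assume uv: "u \<in> ?k" "v \<in> ?k" "expmono u = expmono v"
    then have "mon (int (nat (fst u))) (int (nat (snd u))) = mon (int (nat (fst v))) (int (nat (snd v)))"
      by (metis coord_mono)
    then have "(int (nat (fst u)), int (nat (snd u))) = (int (nat (fst v)), int (nat (snd v)))"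
      by (metis keys_single one_neq_zero singleton_inject)
    moreover have "u \<in> quadrant" "v \<in> quadrant" using uv k by blast+
    ultimately show "u = v" by (simp add: quadrant_def prod_eq_iff)
  qed
  define c where "c = (\<lambda>b. lookup (coord a) (inv_into ?k expmono b))"
  have "a = lin_ext A expmono (coord a)" using a by (simp flip: of_coord_def)
  also have "\<dots> = (\<Oplus>\<^bsub>A\<^esub>u\<in>?k. c (expmono u) \<odot>\<^bsub>A\<^esub> expmono u)"
    unfolding lin_ext_def by (rule A.finsum_cong') (auto simp: c_def inv_into_f_f[OF inj])
  also have "\<dots> = (\<Oplus>\<^bsub>A\<^esub>b\<in>expmono ` ?k. c b \<odot>\<^bsub>A\<^esub> b)"
    by (rule A.finsum_reindex[symmetric]) (auto intro: inj)
  finally have "a = (\<Oplus>\<^bsub>A\<^esub>b\<in>expmono ` ?k. c b \<odot>\<^bsub>A\<^esub> b)" .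
  moreover have "expmono ` ?k \<subseteq> {qp_mono q m n | m n. P m n}"
    using a by (fastforce simp: in_keys_iff)
  moreover have "finite (expmono ` ?k)" by simp
  ultimately show "a \<in> lin_span A {qp_mono q m n | m n. P m n}"
    unfolding lin_span_def by blast
qed

lemma hom_part_coord:
  assumes p: "p \<in> carrier A"
  shows "hom_part q i p \<in> carrier A"
    and "lookup (coord (hom_part q i p)) (a, b)
      = (if a + b = int i then lookup (coord p) (a, b) else 0)"
proof -
  define t where "t = Poly_Mapping.mapp (\<lambda>u c. if fst u + snd u = int i then c else 0) (coord p)"
  have lookup_t: "lookup t (a, b) = (if a + b = int i then lookup (coord p) (a, b) else 0)" for a b
    by (simp add: t_def lookup_mapp when_def in_keys_iff)
  have cp: "coord p \<in> plane" using p by simp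
  then have t: "t \<in> plane" by (auto simp: plane_iff lookup_t)
  have pos: "0 \<le> a" "0 \<le> b" if "lookup r (a, b) \<noteq> 0" "r \<in> plane" for r a b
    using that by (auto simp: plane_iff)
  let ?in = "\<lambda>r. r \<in> lin_span A {qp_mono q m n | m n. m + n = i} \<and>
     (\<exists>s \<in> lin_span A {qp_mono q m n | m n. m + n \<noteq> i}. p = r \<oplus>\<^bsub>A\<^esub> s)"
  have "?in (of_coord t)"
  proof (intro conjI bexI[of _ "of_coord (coord p - t)"])
    have pt: "coord p - t \<in> plane" using cp t by simp
    show "of_coord t \<in> lin_span A {qp_mono q m n | m n. m + n = i}"
      unfolding lin_span_mono using t pos[OF _ t]
      by (auto simp: lookup_t simp flip: nat_add_distrib)
    show "of_coord (coord p - t) \<in> lin_span A {qp_mono q m n | m n. m + n \<noteq> i}"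
      unfolding lin_span_mono
    proof (intro conjI allI impI)
      fix a b assume "lookup (coord (of_coord (coord p - t))) (a, b) \<noteq> 0"
      then have nz: "lookup (coord p - t) (a, b) \<noteq> 0" using pt by simp
      then have "a + b \<noteq> int i" by (auto simp: lookup_minus lookup_t)
      then show "nat a + nat b \<noteq> i" using pos[OF nz pt] by auto
    qed simp
    show "p = of_coord t \<oplus>\<^bsub>A\<^esub> of_coord (coord p - t)"
      using p by (simp flip: of_coord_add)
  qed
  moreover have "r = of_coord t" if r: "?in r" for r
  proof -
    obtain s where s: "s \<in> lin_span A {qp_mono q m n | m n. m + n \<noteq> i}" "p = r \<oplus>\<^bsub>A\<^esub> s" using r by blast
    have rc: "r \<in> carrier A" and sc: "s \<in> carrier A" using r s by (auto simp: lin_span_mono)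
    have r0: "lookup (coord r) (a, b) = 0" if "a + b \<noteq> int i" for a b
    proof (rule ccontr)
      assume nz: "lookup (coord r) (a, b) \<noteq> 0"
      then have "nat a + nat b = i" using r by (auto simp: lin_span_mono)
      then show False using that pos[OF nz] rc by simp
    qed
    have s0: "lookup (coord s) (a, b) = 0" if "a + b = int i" for a b
    proof (rule ccontr)
      assume nz: "lookup (coord s) (a, b) \<noteq> 0"
      then have "nat a + nat b \<noteq> i" using s by (auto simp: lin_span_mono)
      then show False using that pos[OF nz] sc by simp
    qed
    have "coord r = t"
    proof (rule poly_mapping_eqI, clarify)
      fix a b
      show "lookup (coord r) (a, b) = lookup t (a, b)"
        using r0[of a b] s0[of a b] s(2) rc sc by (simp add: lookup_t lookup_add)
    qed
    then show ?thesis using rc by auto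
  qed
  ultimately have "hom_part q i p = of_coord t"
    unfolding hom_part_def by (rule the_equality)
  then show "hom_part q i p \<in> carrier A"
    and "lookup (coord (hom_part q i p)) (a, b)
      = (if a + b = int i then lookup (coord p) (a, b) else 0)"
    using t by (simp_all add: lookup_t)
qed

lemma hom_part_eq_zero_iff:
  assumes "p \<in> carrier A"
  shows "hom_part q i p = \<zero>\<^bsub>A\<^esub> \<longleftrightarrow> (\<forall>a b. a + b = int i \<longrightarrow> lookup (coord p) (a, b) = 0)"
proof -
  have "hom_part q i p = \<zero>\<^bsub>A\<^esub> \<longleftrightarrow> coord (hom_part q i p) = 0"
    using coord_inj[OF hom_part_coord(1)[OF assms] A.zero_closed] by simp
  also have "\<dots> \<longleftrightarrow> (\<forall>a b. lookup (coord (hom_part q i p)) (a, b) = 0)"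
    by (auto simp: poly_mapping_eq_iff fun_eq_iff)
  also have "\<dots> \<longleftrightarrow> (\<forall>a b. a + b = int i \<longrightarrow> lookup (coord p) (a, b) = 0)"
    by (simp add: hom_part_coord(2)[OF assms])
  finally show ?thesis .
qed

lemma hom_part_0: "p \<in> carrier A \<Longrightarrow> hom_part q 0 p = \<zero>\<^bsub>A\<^esub> \<longleftrightarrow> lookup (coord p) (0, 0) = 0"
proof -
  assume p: "p \<in> carrier A"
  have "a = 0 \<and> b = 0" if "a + b = 0" "lookup (coord p) (a, b) \<noteq> 0" for a b
    using that p coord_simps(1)[OF p] unfolding plane_iff by (metis add_nonneg_eq_0_iff)
  then have "(\<forall>a b. a + b = int 0 \<longrightarrow> lookup (coord p) (a, b) = 0) \<longleftrightarrow>
      lookup (coord p) (0, 0) = 0"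
    by (intro iffI allI impI) (simp, metis of_nat_0)
  then show ?thesis unfolding hom_part_eq_zero_iff[OF p] .
qed

lemma hom_part_1: "p \<in> carrier A \<Longrightarrow> hom_part q 1 p = \<zero>\<^bsub>A\<^esub> \<longleftrightarrow>
    lookup (coord p) (1, 0) = 0 \<and> lookup (coord p) (0, 1) = 0"
proof -
  assume p: "p \<in> carrier A"
  have "(a, b) = (1, 0) \<or> (a, b) = (0, 1)" if "a + b = 1" "lookup (coord p) (a, b) \<noteq> 0" for a b
  proof -
    have "0 \<le> a" "0 \<le> b" using that coord_simps(1)[OF p] by (auto simp: plane_iff)
    then show ?thesis using that(1) by auto
  qed
  then have "(\<forall>a b. a + b = int 1 \<longrightarrow> lookup (coord p) (a, b) = 0) \<longleftrightarrow>
      lookup (coord p) (1, 0) = 0 \<and> lookup (coord p) (0, 1) = 0"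
    by (intro iffI conjI allI impI) (simp, simp, metis prod.inject of_nat_1)
  then show ?thesis unfolding hom_part_eq_zero_iff[OF p] .
qed

end

section \<open>The classification\<close>

lemma qp_structuresD:
  assumes "q \<noteq> 0" "\<pi> \<in> qp_structures q"
  shows "alg_rep (uq_alg q) (quantum_plane q) \<pi>"
    and "sl2_action (quantum_plane q) q (\<pi> (uq_k q)) (\<pi> (uq_kinv q)) (\<pi> (uq_e q)) (\<pi> (uq_f q))"
  using module_alg_structuresD[OF calg_quantum_plane assms(1)] assms(2) by (simp_all add: qp_structures_def)

context generic_q
begin

interpretation A: calg A by (rule calg_quantum_plane)
interpretation M: calg "qp_model q" by (rule calg_qp_model) simp

lemma kinv_values:
  assumes "\<pi> \<in> qp_structures q" "has_parameter q \<tau> \<pi>"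
  shows "\<pi> (uq_kinv q) (qp_x q) = inverse q \<odot>\<^bsub>A\<^esub> qp_x q" "\<pi> (uq_kinv q) (qp_y q) = q \<odot>\<^bsub>A\<^esub> qp_y q"
proof -
  interpret sl2_action A q "\<pi> (uq_k q)" "\<pi> (uq_kinv q)" "\<pi> (uq_e q)" "\<pi> (uq_f q)"
    by (rule qp_structuresD[OF q_nonzero assms(1)])
  have lin: "\<pi> (uq_kinv q) (c \<odot>\<^bsub>A\<^esub> a) = c \<odot>\<^bsub>A\<^esub> \<pi> (uq_kinv q) a" "\<pi> (uq_kinv q) a \<in> carrier A"
    if "a \<in> carrier A" for a c
    using linear(2) that by (simp_all add: lin_map_smult lin_map_closed)
  have "q \<odot>\<^bsub>A\<^esub> \<pi> (uq_kinv q) (qp_x q) = qp_x q" "inverse q \<odot>\<^bsub>A\<^esub> \<pi> (uq_kinv q) (qp_y q) = qp_y q"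
    using K'K[of "qp_x q"] K'K[of "qp_y q"] assms(2) by (simp_all add: has_parameter_def lin)
  then have "inverse q \<odot>\<^bsub>A\<^esub> (q \<odot>\<^bsub>A\<^esub> \<pi> (uq_kinv q) (qp_x q)) = inverse q \<odot>\<^bsub>A\<^esub> qp_x q"
    "q \<odot>\<^bsub>A\<^esub> (inverse q \<odot>\<^bsub>A\<^esub> \<pi> (uq_kinv q) (qp_y q)) = q \<odot>\<^bsub>A\<^esub> qp_y q" by simp_all
  then show "\<pi> (uq_kinv q) (qp_x q) = inverse q \<odot>\<^bsub>A\<^esub> qp_x q" "\<pi> (uq_kinv q) (qp_y q) = q \<odot>\<^bsub>A\<^esub> qp_y q"
    by (simp_all add: lin flip: A.smult_assoc)
qed

text \<open>
  Since \<open>\<Psi>\<close> is multiplicative and the product rules have the same form on both sides, the elements at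
  which the four generators commute with \<open>\<Psi>\<close> form a subalgebra containing \<open>x\<close> and \<open>y\<close>; then the
  elements of the quantum group that commute with \<open>\<Psi>\<close> form a subalgebra as well.  The case where \<open>\<Psi>\<close>
  is the identity gives uniqueness.
\<close>

lemma intertwining:
  assumes \<pi>1: "\<pi>1 \<in> qp_structures q" "has_parameter q \<tau>1 \<pi>1"
    and \<pi>2: "\<pi>2 \<in> qp_structures q" "has_parameter q \<tau>2 \<pi>2"
    and \<tau>: "\<tau>1 = c * \<tau>2" "\<tau>1 \<noteq> 0"
    and \<Psi>: "alg_map A A \<Psi>" "\<Psi> (qp_x q) = qp_x q" "\<Psi> (qp_y q) = c \<odot>\<^bsub>A\<^esub> qp_y q"
    and h: "h \<in> carrier (uq_alg q)" and a: "a \<in> carrier A"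
  shows "\<Psi> (\<pi>1 h a) = \<pi>2 h (\<Psi> a)"
proof -
  interpret S1: sl2_action A q "\<pi>1 (uq_k q)" "\<pi>1 (uq_kinv q)" "\<pi>1 (uq_e q)" "\<pi>1 (uq_f q)"
    by (rule qp_structuresD[OF q_nonzero \<pi>1(1)])
  interpret S2: sl2_action A q "\<pi>2 (uq_k q)" "\<pi>2 (uq_kinv q)" "\<pi>2 (uq_e q)" "\<pi>2 (uq_f q)"
    by (rule qp_structuresD[OF q_nonzero \<pi>2(1)])
  interpret R1: alg_rep "uq_alg q" A \<pi>1 by (rule qp_structuresD[OF q_nonzero \<pi>1(1)])
  interpret R2: alg_rep "uq_alg q" A \<pi>2 by (rule qp_structuresD[OF q_nonzero \<pi>2(1)])
  note \<Psi>s = alg_mapD[OF \<Psi>(1)]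
  note closed = S1.linear[THEN lin_map_closed] S2.linear[THEN lin_map_closed]
  note act_add = S1.linear[THEN lin_map_add] S2.linear[THEN lin_map_add]
  note act_smult = S1.linear[THEN lin_map_smult] S2.linear[THEN lin_map_smult]
  note prod = S1.K_mult S1.K'_mult S1.E_mult S1.F_mult S2.K_mult S2.K'_mult S2.E_mult S2.F_mult
  note act_one = S1.K_one S1.K'_one S1.E_one S1.F_one S2.K_one S2.K'_one S2.E_one S2.F_one
  have v1: "\<pi>1 (uq_k q) (qp_x q) = q \<odot>\<^bsub>A\<^esub> qp_x q" "\<pi>1 (uq_k q) (qp_y q) = inverse q \<odot>\<^bsub>A\<^esub> qp_y q"
    "\<pi>1 (uq_e q) (qp_x q) = \<zero>\<^bsub>A\<^esub>" "\<pi>1 (uq_e q) (qp_y q) = \<tau>1 \<odot>\<^bsub>A\<^esub> qp_x q"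
    "\<pi>1 (uq_f q) (qp_x q) = inverse \<tau>1 \<odot>\<^bsub>A\<^esub> qp_y q" "\<pi>1 (uq_f q) (qp_y q) = \<zero>\<^bsub>A\<^esub>"
    using \<pi>1(2) by (simp_all add: has_parameter_def)
  have v2: "\<pi>2 (uq_k q) (qp_x q) = q \<odot>\<^bsub>A\<^esub> qp_x q" "\<pi>2 (uq_k q) (qp_y q) = inverse q \<odot>\<^bsub>A\<^esub> qp_y q"
    "\<pi>2 (uq_e q) (qp_x q) = \<zero>\<^bsub>A\<^esub>" "\<pi>2 (uq_e q) (qp_y q) = \<tau>2 \<odot>\<^bsub>A\<^esub> qp_x q"
    "\<pi>2 (uq_f q) (qp_x q) = inverse \<tau>2 \<odot>\<^bsub>A\<^esub> qp_y q" "\<pi>2 (uq_f q) (qp_y q) = \<zero>\<^bsub>A\<^esub>"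
    using \<pi>2(2) by (simp_all add: has_parameter_def)
  note vals = v1 v2 kinv_values[OF \<pi>1] kinv_values[OF \<pi>2]
  have \<Psi>0: "\<Psi> \<zero>\<^bsub>A\<^esub> = \<zero>\<^bsub>A\<^esub>" by (rule lin_map_zero[OF A.calg_axioms A.calg_axioms alg_map_lin[OF \<Psi>(1)]])
  have inv: "inverse \<tau>1 * c = inverse \<tau>2" using \<tau> by (auto simp: field_simps)
  have gens: "\<Psi> (\<pi>1 (uq_k q) a) = \<pi>2 (uq_k q) (\<Psi> a) \<and> \<Psi> (\<pi>1 (uq_kinv q) a) = \<pi>2 (uq_kinv q) (\<Psi> a) \<and>
      \<Psi> (\<pi>1 (uq_e q) a) = \<pi>2 (uq_e q) (\<Psi> a) \<and> \<Psi> (\<pi>1 (uq_f q) a) = \<pi>2 (uq_f q) (\<Psi> a)"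
    if "a \<in> carrier A" for a
    using that
  proof (induction a rule: qp_induct)
    case one
    show ?case by (simp add: act_one \<Psi>s(4) \<Psi>0)
  next
    case x
    show ?case by (simp add: vals \<Psi> \<Psi>s(3) \<Psi>0 inv flip: A.smult_assoc)
  next
    case y
    show ?case
      by (simp add: vals \<Psi> \<Psi>s(3) \<Psi>0 act_smult(5-8) \<tau>(1) flip: A.smult_assoc) (simp add: mult.commute)
  next
    case (add a b)
    then show ?case by (simp add: act_add \<Psi>s(1,2) closed)
  next
    case (mult a b)
    then show ?case by (simp add: prod \<Psi>s(1,2,5) closed)
  next
    case (smult d a)
    then show ?case by (simp add: act_smult \<Psi>s(1,3) closed)
  qed
  have "\<forall>a\<in>carrier A. \<Psi> (\<pi>1 h a) = \<pi>2 h (\<Psi> a)"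
    using h unfolding uq_alg_def
  proof (induction h rule: pres_alg_induct)
    case one
    show ?case by (simp add: R1.act_one_left R2.act_one_left \<Psi>s(1) flip: uq_alg_def)
  next
    case (gen g)
    show ?case using gens by (cases g) (simp_all add: uq_gen_defs)
  next
    case (add h g)
    then show ?case
      by (simp add: R1.act_add_left R2.act_add_left \<Psi>s(1,2) flip: uq_alg_def)
  next
    case (mult h g)
    then show ?case
      by (simp add: R1.act_mult_left R2.act_mult_left \<Psi>s(1) flip: uq_alg_def)
  next
    case (smult d h)
    then show ?case
      by (simp add: R1.act_smult_left R2.act_smult_left \<Psi>s(1,3) flip: uq_alg_def)
  qed
  then show ?thesis using a by blast
qed

lemma structure_unique:
  assumes "\<pi>1 \<in> qp_structures q" "has_parameter q \<tau> \<pi>1" "\<pi>2 \<in> qp_structures q" "has_parameter q \<tau> \<pi>2" "\<tau> \<noteq> 0"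
  shows "\<pi>1 = \<pi>2"
proof -
  interpret R1: alg_rep "uq_alg q" A \<pi>1 by (rule qp_structuresD[OF q_nonzero assms(1)])
  interpret R2: alg_rep "uq_alg q" A \<pi>2 by (rule qp_structuresD[OF q_nonzero assms(3)])
  have id: "alg_map A A (\<lambda>a. a)" by (intro alg_mapI lin_mapI) simp_all
  have ext: "\<pi>1 \<in> extensional (carrier (uq_alg q))" "\<pi>2 \<in> extensional (carrier (uq_alg q))"
    using assms(1,3) by (simp_all add: qp_structures_def module_alg_structures_def)
  show ?thesis
  proof (rule extensionalityI[OF ext])
    fix h assume h: "h \<in> carrier (uq_alg q)"
    have "\<pi>1 h \<in> extensional (carrier A)" "\<pi>2 h \<in> extensional (carrier A)"
      using alg_map_closed[OF R1.hom h] alg_map_closed[OF R2.hom h] by (simp_all add: linear_end_iff)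
    then show "\<pi>1 h = \<pi>2 h"
      by (rule extensionalityI) (rule intertwining[OF assms(1-4) _ assms(5) id _ _ h, of 1], simp_all)
  qed
qed

lemma structures_isomorphic:
  assumes \<pi>1: "\<pi>1 \<in> qp_structures q" "has_parameter q \<tau>1 \<pi>1"
    and \<pi>2: "\<pi>2 \<in> qp_structures q" "has_parameter q \<tau>2 \<pi>2" and \<tau>: "\<tau>1 \<noteq> 0" "\<tau>2 \<noteq> 0"
  shows "iso_structures (uq_sl2 q) A \<pi>1 \<pi>2"
proof -
  define c where "c = \<tau>1 / \<tau>2"
  have c: "c \<noteq> 0" "\<tau>1 = c * \<tau>2" using \<tau> by (simp_all add: c_def)
  have ex: "\<exists>h. alg_map A A h \<and> h (qp_x q) = qp_x q \<and> h (qp_y q) = d \<odot>\<^bsub>A\<^esub> qp_y q" for d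
    by (rule qp_hom_exists[OF A.calg_axioms])
       (simp_all add: A.smult_mult_l A.smult_mult_r qp_relation mult.commute flip: A.smult_assoc)
  obtain \<Psi> where \<Psi>: "alg_map A A \<Psi>" "\<Psi> (qp_x q) = qp_x q" "\<Psi> (qp_y q) = c \<odot>\<^bsub>A\<^esub> qp_y q" using ex by blast
  obtain \<Phi> where \<Phi>: "alg_map A A \<Phi>" "\<Phi> (qp_x q) = qp_x q" "\<Phi> (qp_y q) = inverse c \<odot>\<^bsub>A\<^esub> qp_y q" using ex by blast
  have inv: "\<Phi> (\<Psi> a) = a \<and> \<Psi> (\<Phi> a) = a" if "a \<in> carrier A" for a
    using that
    by (induction a rule: qp_induct)
       (simp_all add: alg_mapD[OF \<Psi>(1)] alg_mapD[OF \<Phi>(1)] \<Psi>(2,3) \<Phi>(2,3) c(1) flip: A.smult_assoc)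
  have bij: "bij_betw \<Psi> (carrier A) (carrier A)"
    by (rule bij_betw_byWitness[of _ \<Phi>]) (use inv in \<open>auto simp: alg_map_closed[OF \<Psi>(1)] alg_map_closed[OF \<Phi>(1)]\<close>)
  have "\<Psi> \<in> alg_aut A" using \<Psi>(1) bij by (simp add: alg_aut_def alg_hom_iff)
  moreover have "\<Psi> (\<pi>1 h (inv_into (carrier A) \<Psi> a)) = \<pi>2 h a"
    if "h \<in> carrier (uq_alg q)" "a \<in> carrier A" for h a
  proof -
    have "inv_into (carrier A) \<Psi> a \<in> carrier A" "\<Psi> (inv_into (carrier A) \<Psi> a) = a"
      using that(2) bij unfolding bij_betw_def
      by (metis inv_into_into, metis f_inv_into_f)
    then show ?thesis
      using intertwining[OF \<pi>1 \<pi>2 c(2) \<tau>(1) \<Psi> that(1)] by simp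
  qed
  ultimately show ?thesis unfolding iso_structures_def by auto
qed

lemma structure_exists:
  assumes "\<tau> \<noteq> 0"
  shows "\<exists>\<pi>. \<pi> \<in> qp_structures q \<and> has_parameter q \<tau> \<pi>"
proof -
  define z where "z = single (1 :: int, -1 :: int) (\<tau> / (inverse q - q))"
  define w where "w = single (-1 :: int, 1 :: int) (1 / (\<tau> * (q - inverse q)))"
  note model = sl2_action_model[OF assms, folded z_def w_def]
  have act: "sl2_action A q (\<lambda>a. of_coord (torus_k q (coord a))) (\<lambda>a. of_coord (torus_k (inverse q) (coord a)))
      (\<lambda>a. of_coord (inner_e q z (coord a))) (\<lambda>a. of_coord (inner_f q w (coord a)))"
    by (rule sl2_action_transfer[OF model(1) A.calg_axioms of_coord_hom coord(1)]) simp_all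
  from sl2_action.structure_exists[OF act q_nonzero]
  obtain \<pi> where \<pi>: "\<pi> \<in> qp_structures q" and vals: "\<forall>a\<in>carrier A.
      \<pi> (uq_k q) a = of_coord (torus_k q (coord a)) \<and>
      \<pi> (uq_kinv q) a = of_coord (torus_k (inverse q) (coord a)) \<and>
      \<pi> (uq_e q) a = of_coord (inner_e q z (coord a)) \<and>
      \<pi> (uq_f q) a = of_coord (inner_f q w (coord a))"
    unfolding qp_structures_def ..
  have gens: "of_coord (mon 1 0) = qp_x q" "of_coord (mon 0 1) = qp_y q"
    using of_coord_coord[of "qp_x q"] of_coord_coord[of "qp_y q"] by (simp_all add: coord)
  have "of_coord (single (1, 0) c) = c \<odot>\<^bsub>A\<^esub> qp_x q"
    "of_coord (single (0, 1) c) = c \<odot>\<^bsub>A\<^esub> qp_y q" for c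
    using of_coord_scale[of c "mon 1 0"] of_coord_scale[of c "mon 0 1"] by (simp_all add: gens)
  then have "has_parameter q \<tau> \<pi>"
    unfolding has_parameter_def
    using vals[THEN bspec, of "qp_x q"] vals[THEN bspec, of "qp_y q"]
    by (simp add: coord model(2-5) torus_k_single power_int_minus)
  then show ?thesis using \<pi> by blast
qed

lemma linear_type_has_parameter:
  assumes "\<pi> \<in> linear_type_structures q"
  shows "\<exists>\<tau>. \<tau> \<noteq> 0 \<and> has_parameter q \<tau> \<pi>"
proof -
  have \<pi>: "\<pi> \<in> qp_structures q" using assms by (simp add: linear_type_structures_def)
  interpret S: sl2_action A q "\<pi> (uq_k q)" "\<pi> (uq_kinv q)" "\<pi> (uq_e q)" "\<pi> (uq_f q)"
    by (rule qp_structuresD[OF q_nonzero \<pi>])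
  note closed [simp] = S.linear[THEN lin_map_closed]
  have gens: "of_coord (mon 1 0) = qp_x q" "of_coord (mon 0 1) = qp_y q"
    using of_coord_coord[of "qp_x q"] of_coord_coord[of "qp_y q"] by (simp_all add: coord)
  interpret T: linear_action q "\<lambda>p. coord (\<pi> (uq_k q) (of_coord p))" "\<lambda>p. coord (\<pi> (uq_kinv q) (of_coord p))"
    "\<lambda>p. coord (\<pi> (uq_e q) (of_coord p))" "\<lambda>p. coord (\<pi> (uq_f q) (of_coord p))"
  proof (intro linear_action.intro plane_action.intro linear_action_axioms.intro generic_q_axioms)
    show "sl2_action (qp_model q) q (\<lambda>p. coord (\<pi> (uq_k q) (of_coord p))) (\<lambda>p. coord (\<pi> (uq_kinv q) (of_coord p)))
      (\<lambda>p. coord (\<pi> (uq_e q) (of_coord p))) (\<lambda>p. coord (\<pi> (uq_f q) (of_coord p)))"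
      by (rule sl2_action_transfer[OF S.sl2_action_axioms M.calg_axioms coord(1) of_coord_hom]) simp_all
  qed (use assms in \<open>simp_all add: linear_type_structures_def gens hom_part_0 hom_part_1[unfolded One_nat_def]\<close>)
  obtain \<tau> where \<tau>: "\<tau> \<noteq> 0" and vals: "coord (\<pi> (uq_e q) (qp_x q)) = 0" "coord (\<pi> (uq_e q) (qp_y q)) = scale \<tau> (mon 1 0)"
    "coord (\<pi> (uq_f q) (qp_x q)) = scale (inverse \<tau>) (mon 0 1)" "coord (\<pi> (uq_f q) (qp_y q)) = 0"
    using T.linear_classification by (auto simp: gens)
  have "has_parameter q \<tau> \<pi>"
    unfolding has_parameter_def
    using T.K_gens vals by (simp add: gens coord_inj[symmetric] coord)
  then show ?thesis using \<tau> by blast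
qed

lemma has_parameter_linear_type:
  assumes "\<pi> \<in> qp_structures q" "\<tau> \<noteq> 0" "has_parameter q \<tau> \<pi>"
  shows "\<pi> \<in> linear_type_structures q"
  using assms unfolding has_parameter_def linear_type_structures_def
  by (simp add: hom_part_0 hom_part_1[unfolded One_nat_def] coord lookup_single)

lemma parameter_unique: "has_parameter q \<tau> \<pi> \<Longrightarrow> has_parameter q \<tau>' \<pi> \<Longrightarrow> \<tau> = \<tau>'"
proof -
  assume "has_parameter q \<tau> \<pi>" "has_parameter q \<tau>' \<pi>"
  then have "\<tau> \<odot>\<^bsub>A\<^esub> qp_x q = \<tau>' \<odot>\<^bsub>A\<^esub> qp_x q" by (simp add: has_parameter_def)
  then have "coord (\<tau> \<odot>\<^bsub>A\<^esub> qp_x q) = coord (\<tau>' \<odot>\<^bsub>A\<^esub> qp_x q)" by simp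
  then show ?thesis by (simp add: coord) (metis lookup_single_eq)
qed

end

theorem theorem9:
  fixes q :: complex
  assumes "q \<noteq> 0"
    and "\<forall>n::nat. n > 0 \<longrightarrow> q ^ n \<noteq> 1"
  shows "(\<forall>\<tau>. \<tau> \<noteq> 0 \<longrightarrow> (\<exists>!\<pi>. \<pi> \<in> qp_structures q \<and> has_parameter q \<tau> \<pi>))
    \<and> linear_type_structures q = {\<pi> \<in> qp_structures q. \<exists>\<tau>. \<tau> \<noteq> 0 \<and> has_parameter q \<tau> \<pi>}
    \<and> (\<forall>\<pi> \<in> linear_type_structures q. \<exists>!\<tau>. \<tau> \<noteq> 0 \<and> has_parameter q \<tau> \<pi>)
    \<and> (\<forall>\<pi>1 \<in> linear_type_structures q. \<forall>\<pi>2 \<in> linear_type_structures q.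
         iso_structures (uq_sl2 q) (quantum_plane q) \<pi>1 \<pi>2)
    \<and> (\<forall>\<pi> \<in> linear_type_structures q. \<forall>\<pi>1 \<in> qp_structures q. has_parameter q 1 \<pi>1 \<longrightarrow>
         iso_structures (uq_sl2 q) (quantum_plane q) \<pi> \<pi>1)"
proof -
  interpret generic_q q
    using assms by unfold_locales auto
  have sub: "\<pi> \<in> qp_structures q" if "\<pi> \<in> linear_type_structures q" for \<pi>
    using that by (simp add: linear_type_structures_def)
  show ?thesis
  proof (intro conjI)
    show "\<forall>\<tau>. \<tau> \<noteq> 0 \<longrightarrow> (\<exists>!\<pi>. \<pi> \<in> qp_structures q \<and> has_parameter q \<tau> \<pi>)"
      using structure_exists structure_unique by blast
    show "linear_type_structures q = {\<pi> \<in> qp_structures q. \<exists>\<tau>. \<tau> \<noteq> 0 \<and> has_parameter q \<tau> \<pi>}"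
      using linear_type_has_parameter has_parameter_linear_type sub by blast
    show "\<forall>\<pi> \<in> linear_type_structures q. \<exists>!\<tau>. \<tau> \<noteq> 0 \<and> has_parameter q \<tau> \<pi>"
      using linear_type_has_parameter parameter_unique by blast
    show "\<forall>\<pi>1 \<in> linear_type_structures q. \<forall>\<pi>2 \<in> linear_type_structures q.
         iso_structures (uq_sl2 q) (quantum_plane q) \<pi>1 \<pi>2"
    proof (intro ballI)
      fix \<pi>1 \<pi>2 assume \<pi>: "\<pi>1 \<in> linear_type_structures q" "\<pi>2 \<in> linear_type_structures q"
      obtain \<tau>1 \<tau>2 where \<tau>: "\<tau>1 \<noteq> 0" "has_parameter q \<tau>1 \<pi>1" "\<tau>2 \<noteq> 0" "has_parameter q \<tau>2 \<pi>2"
        using linear_type_has_parameter[OF \<pi>(1)] linear_type_has_parameter[OF \<pi>(2)] by blast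
      show "iso_structures (uq_sl2 q) (quantum_plane q) \<pi>1 \<pi>2"
        by (rule structures_isomorphic[OF sub[OF \<pi>(1)] \<tau>(2) sub[OF \<pi>(2)] \<tau>(4,1,3)])
    qed
    show "\<forall>\<pi> \<in> linear_type_structures q. \<forall>\<pi>1 \<in> qp_structures q. has_parameter q 1 \<pi>1 \<longrightarrow>
         iso_structures (uq_sl2 q) (quantum_plane q) \<pi> \<pi>1"
    proof (intro ballI impI)
      fix \<pi> \<pi>1 assume \<pi>: "\<pi> \<in> linear_type_structures q" "\<pi>1 \<in> qp_structures q" "has_parameter q 1 \<pi>1"
      obtain \<tau> where \<tau>: "\<tau> \<noteq> 0" "has_parameter q \<tau> \<pi>"
        using linear_type_has_parameter[OF \<pi>(1)] by blast
      show "iso_structures (uq_sl2 q) (quantum_plane q) \<pi> \<pi>1"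
        by (rule structures_isomorphic[OF sub[OF \<pi>(1)] \<tau>(2) \<pi>(2,3) \<tau>(1) one_neq_zero])
    qed
  qed
qed

end
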